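(* Let $M$ be an (oriented) surface immersed in $\mathbb H^3$ and let $\mathcal N:M\to\mathbb S^5\subseteq\mathfrak o(1,3)$ be its Gauss map. Then the following are equivalent: (i) $M$ has constant mean curvature; (ii) $\mathcal N$ is harmonic; (iii) the complex quadratic form $\mathcal Q_{\mathcal N}$ induced by $\mathcal N$ on $M$ is holomorphic.
   Context: On $\mathbb R^4$ let $(x*y)=-x_1y_1+x_2y_2+x_3y_3+x_4y_4$; $\mathbb H^3=\{x:(x*x)=-1,\ x_1>0\}$ with the induced metric (curvature $-1$). $O(1,3)$ is the group of linear maps preserving $( * )$ and mapping $\mathbb H^3$ to itself, with Lie algebra $\mathfrak o(1,3)$ and the bi-invariant pseudo-Riemannian metric determined by $\langle u,v\rangle=\frac12\operatorname{tr}(uv)$ on $\mathfrak o(1,3)$. $O(3)$ is the subgroup fixing $e_1$, and $\mathbb H^3=O(1,3)/O(3)$ isometrically via $\pi(x)=xe_1$. $\mathbb S^5=\{V\in\mathfrak o(1,3):\langle V,V\rangle=1\}$ is the unit pseudo-sphere. For $x\in O(1,3)$ let $\ell_x$ be the restriction of $d\pi_x$ to $(T_x(xO(3)))^\perp$, a linear isometry onto $T_{\pi(x)}\mathbb H^3$. For $p\in\mathbb H^3$, $\Gamma_p:T_p\mathbb H^3\to\mathfrak o(1,3)$ is $\Gamma_p(u)=d(R_{x^{-1}})_x\ell_x^{-1}(u)$ for any $x\in\pi^{-1}(p)$, where $R_y(z)=zy$ (independent of $x$). If $M$ is oriented by a unit normal field $\eta$ (tangent to $\mathbb H^3$), its Gauss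 map is $\mathcal N(p)=\Gamma_p(\eta(p))$. Surfaces are connected. Harmonic means vanishing tension field as a map into the pseudo-Riemannian manifold $\mathbb S^5$. Complex quadratic form: if $F:U\subseteq\mathbb C\to M$ is a local conformal parametrization with complex coordinate $z=x+iy$, put $2F_z=F_x-iF_y$ and $2\mathcal N_z=\mathcal N_x-i\mathcal N_y$; then $\mathcal Q_{\mathcal N}=\langle\mathcal N_z,\Gamma(F_z)\rangle\,dz^2$, with $\langle\cdot,\cdot\rangle$ and $\Gamma$ extended complex (bi)linearly. *)

theory Defs
  imports "HOL-Analysis.Analysis"
begin

section \<open>Smooth maps, local Riemannian geometry\<close>

(* Differentiability class C^k on an open set of a finite-dimensional space, through directional
   derivatives. *)
primrec Ck_on :: "nat \<Rightarrow> 'a::euclidean_space set \<Rightarrow> ('a \<Rightarrow> 'b::euclidean_space) \<Rightarrow> bool" where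
  "Ck_on 0 S f \<longleftrightarrow> continuous_on S f"
| "Ck_on (Suc k) S f \<longleftrightarrow>
     (\<forall>x\<in>S. f differentiable (at x)) \<and> (\<forall>v. Ck_on k S (\<lambda>x. frechet_derivative f (at x) v))"

definition smooth_on :: "'a::euclidean_space set \<Rightarrow> ('a \<Rightarrow> 'b::euclidean_space) \<Rightarrow> bool" where
  "smooth_on S f \<longleftrightarrow> (\<forall>k. Ck_on k S f)"

definition pd :: "'n::finite \<Rightarrow> (real^'n \<Rightarrow> 'b::real_normed_vector) \<Rightarrow> real^'n \<Rightarrow> 'b" where
  "pd i f x = frechet_derivative f (at x) (axis i 1)"

(* Coefficients g_ij of the metric that a bilinear form B on the target induces through F. *)
definition induced_metric ::
    "('b::real_normed_vector \<Rightarrow> 'b \<Rightarrow> real) \<Rightarrow> (real^'n::finite \<Rightarrow> 'b) \<Rightarrow> real^'n \<Rightarrow> real^'n^'n" where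
  "induced_metric B F x = (\<chi> i j. B (pd i F x) (pd j F x))"

(* Gamma^k_ij of the Levi-Civita connection of the (pseudo-Riemannian) metric g_ij. *)
definition christoffel :: "(real^'n::finite \<Rightarrow> real^'n^'n) \<Rightarrow> real^'n \<Rightarrow> 'n \<Rightarrow> 'n \<Rightarrow> 'n \<Rightarrow> real" where
  "christoffel g x k i j =
     (\<Sum>l\<in>UNIV. matrix_inv (g x) $ k $ l *
        (pd i (\<lambda>y. g y $ j $ l) x + pd j (\<lambda>y. g y $ i $ l) x - pd l (\<lambda>y. g y $ i $ j) x)) / 2"

(* Tension field tau(u), the trace with respect to g of the second fundamental form (nabla du) of a
   map u from (domain, g) to (target, h), in local coordinates:
   tau^c = g^ij (d_i d_j u^c - Gamma(g)^k_ij d_k u^c + Gamma(h)^c_ab(u) d_i u^a d_j u^b). *)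
definition tension ::
    "(real^'m::finite \<Rightarrow> real^'m^'m) \<Rightarrow> (real^'n::finite \<Rightarrow> real^'n^'n) \<Rightarrow>
     (real^'m \<Rightarrow> real^'n) \<Rightarrow> real^'m \<Rightarrow> real^'n" where
  "tension g h u x =
     (\<chi> c. \<Sum>i\<in>UNIV. \<Sum>j\<in>UNIV. matrix_inv (g x) $ i $ j *
        (pd i (pd j (\<lambda>y. u y $ c)) x
         - (\<Sum>k\<in>UNIV. christoffel g x k i j * pd k (\<lambda>y. u y $ c) x)
         + (\<Sum>a\<in>UNIV. \<Sum>b\<in>UNIV. christoffel h (u x) c a b *
              pd i (\<lambda>y. u y $ a) x * pd j (\<lambda>y. u y $ b) x)))"

(* Velocities of curves in S; only applied to smooth submanifolds, where requiring the curve to be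
   differentiable at the base point alone gives the same space as smooth curves do. *)
definition tangent_space :: "'a::real_normed_vector set \<Rightarrow> 'a \<Rightarrow> 'a set" where
  "tangent_space S x =
     {v. \<exists>c. c (0::real) = x \<and> (\<forall>t. c t \<in> S) \<and> (c has_vector_derivative v) (at 0)}"


section \<open>Hyperbolic space and its isometry group\<close>

definition lor :: "real^4 \<Rightarrow> real^4 \<Rightarrow> real" where
  "lor x y = - (x$1 * y$1) + x$2 * y$2 + x$3 * y$3 + x$4 * y$4"

definition hyp3 :: "(real^4) set" where
  "hyp3 = {x. lor x x = -1 \<and> x$1 > 0}"

definition O13 :: "(real^4^4) set" where
  "O13 = {A. (\<forall>x y. lor (A *v x) (A *v y) = lor x y) \<and> (\<lambda>x. A *v x) ` hyp3 \<subseteq> hyp3}"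

definition O3 :: "(real^4^4) set" where
  "O3 = {A \<in> O13. A *v axis 1 1 = axis 1 1}"

definition o13 :: "(real^4^4) set" where
  "o13 = tangent_space O13 (mat 1)"

definition lie_ip :: "real^4^4 \<Rightarrow> real^4^4 \<Rightarrow> real" where
  "lie_ip u v = trace (u ** v) / 2"

(* The bi-invariant metric on T_x O(1,3), obtained from lie_ip by left translation. *)
definition group_metric :: "real^4^4 \<Rightarrow> real^4^4 \<Rightarrow> real^4^4 \<Rightarrow> real" where
  "group_metric x u v = lie_ip (matrix_inv x ** u) (matrix_inv x ** v)"

definition S5 :: "(real^4^4) set" where
  "S5 = {V \<in> o13. lie_ip V V = 1}"

definition proj :: "real^4^4 \<Rightarrow> real^4" where
  "proj x = x *v axis 1 1"

(* The orthogonal complement of T_x(x O(3)) in T_x O(1,3). *)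
definition horizontal :: "real^4^4 \<Rightarrow> (real^4^4) set" where
  "horizontal x =
     {u \<in> tangent_space O13 x. \<forall>v \<in> tangent_space ((\<lambda>k. x ** k) ` O3) x. group_metric x u v = 0}"

definition ell_inv :: "real^4^4 \<Rightarrow> real^4 \<Rightarrow> real^4^4" where
  "ell_inv x = inv_into (horizontal x) (frechet_derivative proj (at x))"

(* The result does not depend on the chosen x over p. *)
definition Gam :: "real^4 \<Rightarrow> real^4 \<Rightarrow> real^4^4" where
  "Gam p u = (let x = (SOME x. x \<in> O13 \<and> proj x = p)
              in frechet_derivative (\<lambda>z. z ** matrix_inv x) (at x) (ell_inv x u))"


section \<open>Oriented surfaces immersed in hyperbolic space\<close>

(* An atlas is given by its local parametrizations X : D \<rightarrow> M, i.e. the inverses of the charts. *)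
definition smooth_atlas :: "'m topology \<Rightarrow> ((real^2) set \<times> (real^2 \<Rightarrow> 'm)) set \<Rightarrow> bool" where
  "smooth_atlas M A \<longleftrightarrow>
     (\<forall>(D, X) \<in> A. open D \<and> openin M (X ` D) \<and>
        homeomorphic_map (top_of_set D) (subtopology M (X ` D)) X) \<and>
     (\<Union>(D, X) \<in> A. X ` D) = topspace M \<and>
     (\<forall>(D, X) \<in> A. \<forall>(E, Y) \<in> A. smooth_on {x \<in> D. X x \<in> Y ` E} (\<lambda>x. inv_into E Y (X x)))"

definition surface :: "'m topology \<Rightarrow> ((real^2) set \<times> (real^2 \<Rightarrow> 'm)) set \<Rightarrow> bool" where
  "surface M A \<longleftrightarrow> Hausdorff_space M \<and> second_countable M \<and> connected_space M \<and> smooth_atlas M A"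

definition immersed_in_hyp3 ::
    "'m topology \<Rightarrow> ((real^2) set \<times> (real^2 \<Rightarrow> 'm)) set \<Rightarrow> ('m \<Rightarrow> real^4) \<Rightarrow> bool" where
  "immersed_in_hyp3 M A f \<longleftrightarrow>
     f ` topspace M \<subseteq> hyp3 \<and>
     (\<forall>(D, X) \<in> A. smooth_on D (f \<circ> X) \<and>
        (\<forall>x \<in> D. inj (frechet_derivative (f \<circ> X) (at x))))"

definition unit_normal_field ::
    "'m topology \<Rightarrow> ((real^2) set \<times> (real^2 \<Rightarrow> 'm)) set \<Rightarrow> ('m \<Rightarrow> real^4) \<Rightarrow> ('m \<Rightarrow> real^4) \<Rightarrow> bool" where
  "unit_normal_field M A f \<eta> \<longleftrightarrow>
     (\<forall>p \<in> topspace M. \<eta> p \<in> tangent_space hyp3 (f p) \<and> lor (\<eta> p) (\<eta> p) = 1) \<and>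
     (\<forall>(D, X) \<in> A. smooth_on D (\<eta> \<circ> X) \<and>
        (\<forall>x \<in> D. \<forall>v. lor (\<eta> (X x)) (frechet_derivative (f \<circ> X) (at x) v) = 0))"

(* H = (1/2) g^ij b_ij. The Levi-Civita derivative in the hyperbolic space of d_j F along d_i differs
   from d_i d_j F by a multiple of the position vector F, to which the normal n is orthogonal; hence
   b_ij = (d_i d_j F * n) is the second fundamental form in the hyperbolic space. *)
definition mean_curvature :: "(real^2 \<Rightarrow> real^4) \<Rightarrow> (real^2 \<Rightarrow> real^4) \<Rightarrow> real^2 \<Rightarrow> real" where
  "mean_curvature F n x =
     (\<Sum>i\<in>UNIV. \<Sum>j\<in>UNIV. matrix_inv (induced_metric lor F x) $ i $ j * lor (pd i (pd j F) x) (n x)) / 2"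

definition constant_mean_curvature ::
    "((real^2) set \<times> (real^2 \<Rightarrow> 'm)) set \<Rightarrow> ('m \<Rightarrow> real^4) \<Rightarrow> ('m \<Rightarrow> real^4) \<Rightarrow> bool" where
  "constant_mean_curvature A f \<eta> \<longleftrightarrow>
     (\<exists>c. \<forall>(D, X) \<in> A. \<forall>x \<in> D. mean_curvature (f \<circ> X) (\<eta> \<circ> X) x = c)"

definition gauss_map :: "('m \<Rightarrow> real^4) \<Rightarrow> ('m \<Rightarrow> real^4) \<Rightarrow> 'm \<Rightarrow> real^4^4" where
  "gauss_map f \<eta> p = Gam (f p) (\<eta> p)"


section \<open>Harmonic maps into the pseudo-sphere\<close>

(* Since S5 has dimension 5, these are exactly the inverses of smooth charts of S5. *)
definition S5_parametrization :: "(real^5) set \<Rightarrow> (real^5 \<Rightarrow> real^4^4) \<Rightarrow> bool" where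
  "S5_parametrization W \<psi> \<longleftrightarrow>
     open W \<and> smooth_on W \<psi> \<and> \<psi> ` W \<subseteq> S5 \<and> inj_on \<psi> W \<and>
     (\<forall>y \<in> W. inj (frechet_derivative \<psi> (at y)))"

(* u is the expression of N in the coordinates X of the surface and \<psi> of the pseudo-sphere; the
   surface carries the metric induced by f. *)
definition harmonic_into_S5 ::
    "'m topology \<Rightarrow> ((real^2) set \<times> (real^2 \<Rightarrow> 'm)) set \<Rightarrow> ('m \<Rightarrow> real^4) \<Rightarrow> ('m \<Rightarrow> real^4^4) \<Rightarrow> bool" where
  "harmonic_into_S5 M A f N \<longleftrightarrow>
     N ` topspace M \<subseteq> S5 \<and>
     (\<forall>(D, X) \<in> A. \<forall>W \<psi> V u.
        S5_parametrization W \<psi> \<and> open V \<and> V \<subseteq> D \<and> smooth_on V u \<and> u ` V \<subseteq> W \<and>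
        (\<forall>x \<in> V. N (X x) = \<psi> (u x)) \<longrightarrow>
        (\<forall>x \<in> V. tension (induced_metric lor (f \<circ> X)) (induced_metric lie_ip \<psi>) u x = 0))"


section \<open>The complex quadratic form\<close>

definition conformal_parametrization ::
    "'m topology \<Rightarrow> ((real^2) set \<times> (real^2 \<Rightarrow> 'm)) set \<Rightarrow> ('m \<Rightarrow> real^4) \<Rightarrow>
     complex set \<Rightarrow> (complex \<Rightarrow> 'm) \<Rightarrow> bool" where
  "conformal_parametrization M A f U G \<longleftrightarrow>
     open U \<and> continuous_map (top_of_set U) M G \<and> inj_on G U \<and>
     (\<forall>(D, X) \<in> A. smooth_on {z \<in> U. G z \<in> X ` D} (\<lambda>z. inv_into D X (G z))) \<and>
     (\<forall>z \<in> U. let Fx = frechet_derivative (f \<circ> G) (at z) 1;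
                  Fy = frechet_derivative (f \<circ> G) (at z) \<i>
              in lor Fx Fx > 0 \<and> lor Fx Fx = lor Fy Fy \<and> lor Fx Fy = 0)"

(* An element a + ib of the complexification of a real vector space is the pair (a, b). *)

definition wirtinger :: "(complex \<Rightarrow> 'b::real_normed_vector) \<Rightarrow> complex \<Rightarrow> 'b \<times> 'b" where
  "wirtinger F z = ((1/2) *\<^sub>R frechet_derivative F (at z) 1, - (1/2) *\<^sub>R frechet_derivative F (at z) \<i>)"

definition complex_bilinear ::
    "('b \<Rightarrow> 'b \<Rightarrow> real) \<Rightarrow> 'b \<times> 'b \<Rightarrow> 'b \<times> 'b \<Rightarrow> complex" where
  "complex_bilinear B u v =
     Complex (B (fst u) (fst v) - B (snd u) (snd v)) (B (fst u) (snd v) + B (snd u) (fst v))"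

definition complex_linear :: "('a \<Rightarrow> 'b) \<Rightarrow> 'a \<times> 'a \<Rightarrow> 'b \<times> 'b" where
  "complex_linear L u = (L (fst u), L (snd u))"

(* The coefficient <N_z, Gamma(F_z)> of dz^2 in the parametrization G. *)
definition quadratic_coeff ::
    "('m \<Rightarrow> real^4) \<Rightarrow> ('m \<Rightarrow> real^4^4) \<Rightarrow> (complex \<Rightarrow> 'm) \<Rightarrow> complex \<Rightarrow> complex" where
  "quadratic_coeff f N G z =
     complex_bilinear lie_ip (wirtinger (N \<circ> G) z)
       (complex_linear (Gam (f (G z))) (wirtinger (f \<circ> G) z))"

definition quadratic_form_holomorphic ::
    "'m topology \<Rightarrow> ((real^2) set \<times> (real^2 \<Rightarrow> 'm)) set \<Rightarrow> ('m \<Rightarrow> real^4) \<Rightarrow> ('m \<Rightarrow> real^4^4) \<Rightarrow> bool" where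
  "quadratic_form_holomorphic M A f N \<longleftrightarrow>
     (\<forall>U G. conformal_parametrization M A f U G \<longrightarrow> quadratic_coeff f N G holomorphic_on U)"

end

theory Submission
  imports Defs "HOL-Real_Asymp.Real_Asymp"
begin

text \<open>
  In the Lorentz model the Gauss map is the bivector \<open>\<N> = f \<and> \<eta>\<close>. The Weingarten and Codazzi equations
  show that the part of the trace of its second derivatives tangential to the pseudo-sphere is
  \<open>- 2 f \<and> \<nabla>H\<close>, so \<open>\<N>\<close> is harmonic iff \<open>\<nabla>H = 0\<close>, i.e. iff \<open>H\<close> is constant on the connected surface. In a
  conformal parametrization the Codazzi equations turn the Cauchy--Riemann equations for the coefficient
  of the quadratic form into \<open>\<nabla>H = 0\<close> as well. To conclude from holomorphy one needs conformal
  parametrizations around every point. Isothermal coordinates solve a Beltrami equation, whose coefficient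
  can be made periodic and close to a constant by a cutoff near the point; the equation is then solved by a
  Neumann series for the Fourier coefficients.
\<close>

section \<open>Calculus of smooth maps\<close>

text \<open>All three conditions are compared with one pointwise condition: the partial derivatives
  of \<open>H\<close> vanish in every chart (\<open>stationary\<close>). The coordinate form of
  harmonicity is handled by lowering the index of the tension field: Christoffel symbols of an
  induced metric pair with the coordinate vectors like plain second derivatives, so the test becomes
  one on the matrix-valued map alone. The obstacle is the step from holomorphy, as it needs a smooth
  solution of a Beltrami equation with variable coefficient \<open>\<tau>\<close>. Zooming in at
  \<open>x0\<close> by a factor \<open>e\<close> makes \<open>\<tau> - \<tau> x0\<close> vanish as
  \<open>e\<close> tends to 0; the cutoff is 1 on \<open>[-1, 1]\<close> and supported in
  \<open>[-2, 2]\<close>, inside one period \<open>[-pi, pi]\<close>. Smallness is measured by the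
  absolute sum of the Fourier coefficients, which is submultiplicative, so the Neumann series
  converges once this sum is at most \<open>Im \<tau>0 / 4\<close>. Its terms are indexed by lists
  of frequencies and never regrouped, so everything is an unconditional sum of exponentials;
  smoothness comes from weighted versions of the same sum.\<close>

lemma Ck_on_subset: "Ck_on k S f \<Longrightarrow> T \<subseteq> S \<Longrightarrow> Ck_on k T f"
  by (induction k arbitrary: f) (auto intro: continuous_on_subset)

lemma Ck_on_Suc_imp: "Ck_on (Suc k) S f \<Longrightarrow> Ck_on k S f"
proof (induction k arbitrary: f)
  case 0
  then show ?case
    by (auto simp: continuous_on_eq_continuous_within
        intro: differentiable_imp_continuous_within differentiable_at_withinI)
next
  case (Suc k)
  then show ?case by (metis Ck_on.simps(2))
qed

lemma frechet_cong_open: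
  assumes "open S" "x \<in> S" "\<And>y. y \<in> S \<Longrightarrow> f y = g y"
  shows "frechet_derivative f (at x) = frechet_derivative g (at x)"
proof -
  have "(f has_derivative D) (at x) \<longleftrightarrow> (g has_derivative D) (at x)" for D
    using assms by (metis has_derivative_transform_within_open)
  then show ?thesis by (simp add: frechet_derivative_def)
qed

lemma differentiable_cong_open:
  assumes "open S" "x \<in> S" "\<And>y. y \<in> S \<Longrightarrow> f y = g y" "f differentiable (at x)"
  shows "g differentiable (at x)"
proof -
  obtain D where "(f has_derivative D) (at x)" using assms(4) by (auto simp: differentiable_def)
  then have "(g has_derivative D) (at x)"
    using has_derivative_transform_within_open[OF _ assms(1,2)] assms(3) by blast
  then show ?thesis by (auto simp: differentiable_def)
qed

lemma Ck_on_cong: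
  assumes "open S" "\<And>y. y \<in> S \<Longrightarrow> f y = g y" "Ck_on k S f"
  shows "Ck_on k S g"
  using assms(2,3)
proof (induction k arbitrary: f g)
  case 0
  then show ?case using continuous_on_cong by force
next
  case (Suc k)
  have "\<forall>x\<in>S. g differentiable (at x)"
    using Suc.prems assms(1) differentiable_cong_open[of S _ f g] by auto
  moreover have "Ck_on k S (\<lambda>x. frechet_derivative g (at x) v)" for v
  proof (rule Suc.IH)
    show "Ck_on k S (\<lambda>x. frechet_derivative f (at x) v)" using Suc.prems by simp
    show "frechet_derivative f (at y) v = frechet_derivative g (at y) v" if "y \<in> S" for y
      using frechet_cong_open[OF assms(1) that, of f g] Suc.prems by simp
  qed
  ultimately show ?case by simp
qed

lemma frechet_derivative_eq: "(f has_derivative D) (at x) \<Longrightarrow> frechet_derivative f (at x) = D"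
  by (metis frechet_derivative_at)

lemma Ck_on_SucI:
  assumes "open S" "\<And>x. x \<in> S \<Longrightarrow> (f has_derivative D x) (at x)" "\<And>v. Ck_on k S (\<lambda>x. D x v)"
  shows "Ck_on (Suc k) S f"
proof -
  have "Ck_on k S (\<lambda>x. frechet_derivative f (at x) v)" for v
    by (rule Ck_on_cong[OF assms(1) _ assms(3)[of v]]) (simp add: frechet_derivative_eq[OF assms(2)])
  then show ?thesis using assms(2) by (auto simp: differentiable_def)
qed

lemma Ck_on_has_derivative:
  "Ck_on (Suc k) S f \<Longrightarrow> x \<in> S \<Longrightarrow> (f has_derivative frechet_derivative f (at x)) (at x)"
  by (simp add: frechet_derivative_works)

lemma Ck_on_const: "Ck_on k S (\<lambda>x. c)"
  by (induction k arbitrary: c) auto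

lemma Ck_on_bounded_linear:
  assumes "bounded_linear L" shows "open S \<Longrightarrow> Ck_on k S L"
proof (cases k)
  case 0
  then show ?thesis using assms linear_continuous_on by auto
next
  case (Suc j)
  then show "open S \<Longrightarrow> ?thesis"
    using Ck_on_SucI[of S L "\<lambda>x. L" j] assms bounded_linear_imp_has_derivative Ck_on_const by blast
qed

lemma Ck_on_add: "open S \<Longrightarrow> Ck_on k S f \<Longrightarrow> Ck_on k S g \<Longrightarrow> Ck_on k S (\<lambda>x. f x + g x)"
proof (induction k arbitrary: f g)
  case 0
  then show ?case by (auto intro: continuous_intros)
next
  case (Suc k)
  then show ?case
    by (intro Ck_on_SucI[OF Suc.prems(1) has_derivative_add[OF Ck_on_has_derivative Ck_on_has_derivative]]) auto
qed

lemma Ck_on_bilinear: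
  assumes B: "bounded_bilinear B" and S: "open S"
  shows "Ck_on k S f \<Longrightarrow> Ck_on k S g \<Longrightarrow> Ck_on k S (\<lambda>x. B (f x) (g x))"
proof (induction k arbitrary: f g)
    case 0
    then show ?case using bounded_bilinear.continuous_on[OF B] by auto
  next
    case (Suc k)
    have "Ck_on k S (\<lambda>x. B (f x) (frechet_derivative g (at x) v) + B (frechet_derivative f (at x) v) (g x))" for v
      using Suc by (intro Ck_on_add[OF S] Suc.IH) (auto intro: Ck_on_Suc_imp)
    then show ?case
      by (intro Ck_on_SucI[OF S bounded_bilinear.FDERIV[OF B Ck_on_has_derivative[OF Suc.prems(1)] Ck_on_has_derivative[OF Suc.prems(2)]]])
qed

lemma Ck_on_sum: "open S \<Longrightarrow> (\<And>i. i \<in> I \<Longrightarrow> Ck_on k S (f i)) \<Longrightarrow> Ck_on k S (\<lambda>x. \<Sum>i\<in>I. f i x)"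
  by (induction I rule: infinite_finite_induct) (auto intro: Ck_on_const Ck_on_add)

lemma linear_euclidean_expansion:
  fixes L :: "'a::euclidean_space \<Rightarrow> 'b::real_vector"
  assumes "linear L"
  shows "L w = (\<Sum>b\<in>Basis. (w \<bullet> b) *\<^sub>R L b)"
  using linear_sum[OF assms, of "\<lambda>b. (w \<bullet> b) *\<^sub>R b" Basis]
  by (simp add: euclidean_representation linear_cmul[OF assms])

text \<open>The chain rule evaluates the derivative of \<open>g\<close> in a direction that moves
  with the point, whereas \<open>Ck_on\<close> only controls fixed directions. Expanding the
  direction in the basis gives a sum of products that the induction hypothesis and the bilinear rule
  cover.\<close>

lemma Ck_on_compose:
  assumes S: "open S" and T: "open T" and sub: "f ` S \<subseteq> T"
  shows "Ck_on k T g \<Longrightarrow> Ck_on k S f \<Longrightarrow> Ck_on k S (\<lambda>x. g (f x))"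
proof (induction k arbitrary: g)
  case 0
  then show ?case using sub by (auto intro: continuous_on_compose2)
next
  case (Suc k)
  let ?D = "\<lambda>x v. frechet_derivative g (at (f x)) (frechet_derivative f (at x) v)"
  have der: "((\<lambda>x. g (f x)) has_derivative ?D x) (at x)" if "x \<in> S" for x
    using has_derivative_compose[OF Ck_on_has_derivative[OF Suc.prems(2) that], of g]
      Ck_on_has_derivative[OF Suc.prems(1), of "f x"] that sub by blast
  have "Ck_on k S (\<lambda>x. ?D x v)" for v
  proof (rule Ck_on_cong[OF S])
    show "Ck_on k S (\<lambda>x. \<Sum>b\<in>Basis. (frechet_derivative f (at x) v \<bullet> b) *\<^sub>R frechet_derivative g (at (f x)) b)"
    proof (intro Ck_on_sum[OF S] Ck_on_bilinear[OF bounded_bilinear_scaleR S]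
        Ck_on_bilinear[OF bounded_bilinear_inner S] Ck_on_const)
      show "Ck_on k S (\<lambda>x. frechet_derivative f (at x) v)" using Suc.prems by simp
      show "Ck_on k S (\<lambda>x. frechet_derivative g (at (f x)) b)" for b
        using Suc.IH[of "\<lambda>y. frechet_derivative g (at y) b"] Suc.prems Ck_on_Suc_imp by auto
    qed
    show "(\<Sum>b\<in>Basis. (frechet_derivative f (at x) v \<bullet> b) *\<^sub>R frechet_derivative g (at (f x)) b) = ?D x v"
      if "x \<in> S" for x
      using linear_euclidean_expansion[OF has_derivative_linear[OF Ck_on_has_derivative[OF Suc.prems(1)]]] that sub
      by (simp add: image_subset_iff)
  qed
  then show ?case using Ck_on_SucI[OF S der] by blast
qed

lemma smooth_on_subset: "smooth_on S f \<Longrightarrow> T \<subseteq> S \<Longrightarrow> smooth_on T f"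
  unfolding smooth_on_def using Ck_on_subset by blast

lemma smooth_on_cong: "open S \<Longrightarrow> (\<And>y. y \<in> S \<Longrightarrow> f y = g y) \<Longrightarrow> smooth_on S f \<Longrightarrow> smooth_on S g"
  unfolding smooth_on_def using Ck_on_cong[of S f g] by blast

lemma smooth_on_has_derivative:
  "smooth_on S f \<Longrightarrow> x \<in> S \<Longrightarrow> (f has_derivative frechet_derivative f (at x)) (at x)"
  unfolding smooth_on_def using Ck_on_has_derivative by blast

lemma smooth_on_differentiable: "smooth_on S f \<Longrightarrow> x \<in> S \<Longrightarrow> f differentiable (at x)"
  using smooth_on_has_derivative differentiable_def by blast

lemma smooth_on_frechet_derivative:
  "smooth_on S f \<Longrightarrow> smooth_on S (\<lambda>x. frechet_derivative f (at x) v)"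
  unfolding smooth_on_def by (metis Ck_on.simps(2))

lemma smooth_on_continuous_on: "smooth_on S f \<Longrightarrow> continuous_on S f"
  unfolding smooth_on_def by (metis Ck_on.simps(1))

lemma smooth_on_const: "smooth_on S (\<lambda>x. c)"
  unfolding smooth_on_def using Ck_on_const by blast

lemma smooth_on_bounded_linear: "open S \<Longrightarrow> bounded_linear L \<Longrightarrow> smooth_on S L"
  unfolding smooth_on_def using Ck_on_bounded_linear by blast

lemma smooth_on_ident: "open S \<Longrightarrow> smooth_on S (\<lambda>x. x)"
  by (rule smooth_on_bounded_linear) (auto simp: bounded_linear_ident)

lemma smooth_on_bilinear:
  "bounded_bilinear B \<Longrightarrow> open S \<Longrightarrow> smooth_on S f \<Longrightarrow> smooth_on S g \<Longrightarrow> smooth_on S (\<lambda>x. B (f x) (g x))"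
  unfolding smooth_on_def using Ck_on_bilinear[of B S _ f g] by blast

lemma smooth_on_add: "open S \<Longrightarrow> smooth_on S f \<Longrightarrow> smooth_on S g \<Longrightarrow> smooth_on S (\<lambda>x. f x + g x)"
  unfolding smooth_on_def using Ck_on_add[of S _ f g] by blast

lemma smooth_on_sum: "open S \<Longrightarrow> (\<And>i. i \<in> I \<Longrightarrow> smooth_on S (f i)) \<Longrightarrow> smooth_on S (\<lambda>x. \<Sum>i\<in>I. f i x)"
  unfolding smooth_on_def using Ck_on_sum[of S I _ f] by blast

lemma smooth_on_compose:
  "open S \<Longrightarrow> open T \<Longrightarrow> f ` S \<subseteq> T \<Longrightarrow> smooth_on T g \<Longrightarrow> smooth_on S f \<Longrightarrow> smooth_on S (\<lambda>x. g (f x))"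
  unfolding smooth_on_def using Ck_on_compose[of S T f _ g] by blast

lemma smooth_on_linear_compose:
  "open S \<Longrightarrow> bounded_linear L \<Longrightarrow> smooth_on S f \<Longrightarrow> smooth_on S (\<lambda>x. L (f x))"
  using smooth_on_compose[of S UNIV f L] smooth_on_bounded_linear[of UNIV L] by auto

lemma smooth_on_scaleR: "open S \<Longrightarrow> smooth_on S f \<Longrightarrow> smooth_on S g \<Longrightarrow> smooth_on S (\<lambda>x. f x *\<^sub>R g x)"
  by (rule smooth_on_bilinear[OF bounded_bilinear_scaleR])

lemma smooth_on_mult:
  fixes f g :: "'a::euclidean_space \<Rightarrow> 'b::{euclidean_space,real_normed_algebra}"
  shows "open S \<Longrightarrow> smooth_on S f \<Longrightarrow> smooth_on S g \<Longrightarrow> smooth_on S (\<lambda>x. f x * g x)"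
  by (rule smooth_on_bilinear[OF bounded_bilinear_mult])

lemma smooth_on_minus: "open S \<Longrightarrow> smooth_on S f \<Longrightarrow> smooth_on S (\<lambda>x. - f x)"
  by (rule smooth_on_linear_compose[OF _ bounded_linear_minus[OF bounded_linear_ident]])

lemma smooth_on_diff: "open S \<Longrightarrow> smooth_on S f \<Longrightarrow> smooth_on S g \<Longrightarrow> smooth_on S (\<lambda>x. f x - g x)"
  using smooth_on_add[of S f "\<lambda>x. - g x"] smooth_on_minus[of S g] by simp

lemma smooth_on_nth: "open S \<Longrightarrow> smooth_on S f \<Longrightarrow> smooth_on S (\<lambda>x. f x $ i)"
  by (rule smooth_on_linear_compose[OF _ bounded_linear_vec_nth])

lemma Ck_on_real_SucI:
  fixes f f' :: "real \<Rightarrow> real"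
  assumes "open S" "\<And>x. x \<in> S \<Longrightarrow> (f has_field_derivative f' x) (at x)" "Ck_on k S f'"
  shows "Ck_on (Suc k) S f"
proof (rule Ck_on_SucI[OF assms(1)])
  show "(f has_derivative (*) (f' x)) (at x)" if "x \<in> S" for x
    using assms(2)[OF that] by (simp add: has_field_derivative_def)
  show "Ck_on k S (\<lambda>x. f' x * v)" for v
    by (intro Ck_on_bilinear[OF bounded_bilinear_mult assms(1) assms(3)] Ck_on_const)
qed

text \<open>The derivative is a polynomial in \<open>inverse\<close> itself, so the induction on the
  order closes without a formula for higher derivatives.\<close>

lemma smooth_on_real_inverse: "smooth_on {x::real. x \<noteq> 0} inverse"
proof -
  have S: "open {x::real. x \<noteq> 0}" by (auto intro: open_Collect_neq continuous_intros)
  have "Ck_on k {x::real. x \<noteq> 0} inverse" for k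
  proof (induction k)
    case 0
    show ?case by (auto intro!: continuous_intros)
  next
    case (Suc k)
    have "Ck_on k {x::real. x \<noteq> 0} (\<lambda>x. -1 * (inverse x * inverse x))"
      by (intro Ck_on_bilinear[OF bounded_bilinear_mult S] Suc Ck_on_const)
    then show ?case
      by (intro Ck_on_real_SucI[OF S, where f' = "\<lambda>x. -1 * (inverse x * inverse x)"])
         (auto intro!: derivative_eq_intros simp: power2_eq_square)
  qed
  then show ?thesis by (simp add: smooth_on_def)
qed

lemma smooth_on_divide:
  fixes f g :: "'a::euclidean_space \<Rightarrow> real"
  assumes "open S" "smooth_on S f" "smooth_on S g" "\<And>x. x \<in> S \<Longrightarrow> g x \<noteq> 0"
  shows "smooth_on S (\<lambda>x. f x / g x)"
proof -
  have T: "open {x::real. x \<noteq> 0}" by (auto intro: open_Collect_neq continuous_intros)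
  have "smooth_on S (\<lambda>x. f x * inverse (g x))"
    by (intro smooth_on_mult smooth_on_compose[OF _ T _ smooth_on_real_inverse]) (use assms in auto)
  then show ?thesis by (simp add: divide_inverse)
qed

lemma smooth_on_real_sqrt: "smooth_on {x::real. x > 0} sqrt"
proof -
  have S: "open {x::real. x > 0}" by (auto intro: open_Collect_less continuous_intros)
  have "Ck_on k {x::real. x > 0} sqrt" for k
  proof (induction k)
    case 0
    show ?case by (auto intro!: continuous_intros)
  next
    case (Suc k)
    have "Ck_on k {x::real. x > 0} (\<lambda>x. (1/2) * inverse (sqrt x))"
      by (intro Ck_on_bilinear[OF bounded_bilinear_mult S] Ck_on_const
          Ck_on_compose[OF S _ _ _ Suc, where T = "{x. x \<noteq> 0}" and g = inverse])
         (use smooth_on_real_inverse in \<open>auto simp: smooth_on_def intro: open_Collect_neq continuous_intros\<close>)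
    then show ?case
      by (intro Ck_on_real_SucI[OF S, where f' = "\<lambda>x. (1/2) * inverse (sqrt x)"])
         (auto intro!: derivative_eq_intros simp: field_simps)
  qed
  then show ?thesis by (simp add: smooth_on_def)
qed

lemma smooth_on_sqrt:
  fixes f :: "'a::euclidean_space \<Rightarrow> real"
  assumes "open S" "smooth_on S f" "\<And>x. x \<in> S \<Longrightarrow> f x > 0"
  shows "smooth_on S (\<lambda>x. sqrt (f x))"
  by (rule smooth_on_compose[OF assms(1) _ _ smooth_on_real_sqrt assms(2)])
     (use assms in \<open>auto intro: open_Collect_less continuous_intros\<close>)

section \<open>Symmetry of second derivatives\<close>

text \<open>Two applications of the mean value theorem to the second difference over the
  parallelogram spanned by \<open>h u\<close> and \<open>h v\<close>: in direction \<open>u\<close>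
  to the difference of two opposite sides, then in direction \<open>v\<close> to the resulting
  derivative. The bound on \<open>h\<close> keeps the parallelogram in the ball.\<close>

lemma mixed_difference_mvt:
  fixes f :: "'a::euclidean_space \<Rightarrow> real"
  assumes f: "smooth_on (ball x e) f" and h: "0 < h" "h * (norm u + norm v) < e"
  obtains s t where "0 < s" "s < h" "0 < t" "t < h"
    "f (x + h *\<^sub>R u + h *\<^sub>R v) - f (x + h *\<^sub>R u) - f (x + h *\<^sub>R v) + f x =
       h * h * frechet_derivative (\<lambda>y. frechet_derivative f (at y) u) (at (x + s *\<^sub>R u + t *\<^sub>R v)) v"
proof -
  have in_ball: "x + s *\<^sub>R u + t *\<^sub>R v \<in> ball x e" if "0 \<le> s" "s \<le> h" "0 \<le> t" "t \<le> h" for s t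
  proof -
    have "norm (s *\<^sub>R u + t *\<^sub>R v) \<le> s * norm u + t * norm v"
      using norm_triangle_ineq[of "s *\<^sub>R u" "t *\<^sub>R v"] that by simp
    also have "\<dots> \<le> h * norm u + h * norm v"
      using that by (intro add_mono mult_right_mono) auto
    also have "\<dots> < e" using h by (simp add: algebra_simps)
    finally show ?thesis
      using norm_minus_cancel[of "s *\<^sub>R u + t *\<^sub>R v"] by (simp add: dist_norm)
  qed
  let ?g = "\<lambda>y. frechet_derivative f (at y) u"
  have d1: "((\<lambda>s. f (x + s *\<^sub>R u + t *\<^sub>R v)) has_field_derivative ?g (x + s *\<^sub>R u + t *\<^sub>R v)) (at s)"
    if "0 \<le> s" "s \<le> h" "0 \<le> t" "t \<le> h" for s t
  proof -
    have "((\<lambda>s. f (x + s *\<^sub>R u + t *\<^sub>R v)) has_derivative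
        (\<lambda>r. frechet_derivative f (at (x + s *\<^sub>R u + t *\<^sub>R v)) (r *\<^sub>R u))) (at s)"
      by (rule has_derivative_compose[of "\<lambda>s. x + s *\<^sub>R u + t *\<^sub>R v", OF _ smooth_on_has_derivative[OF f in_ball[OF that]]])
         (auto intro!: derivative_eq_intros)
    then show ?thesis
      unfolding has_field_derivative_def
      by (rule has_derivative_eq_rhs)
         (use linear_cmul[OF has_derivative_linear[OF smooth_on_has_derivative[OF f in_ball[OF that]]]]
           in \<open>auto simp: fun_eq_iff mult.commute\<close>)
  qed
  have "\<exists>s>0. s < h \<and> (\<lambda>s. f (x + s *\<^sub>R u + h *\<^sub>R v) - f (x + s *\<^sub>R u)) h - (\<lambda>s. f (x + s *\<^sub>R u + h *\<^sub>R v) - f (x + s *\<^sub>R u)) 0 =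
     (h - 0) * (?g (x + s *\<^sub>R u + h *\<^sub>R v) - ?g (x + s *\<^sub>R u))"
    using h d1[of _ h] d1[of _ 0]
    by (intro MVT2) (auto intro!: derivative_eq_intros)
  then obtain s where s: "0 < s" "s < h" and e1: "f (x + h *\<^sub>R u + h *\<^sub>R v) - f (x + h *\<^sub>R u) - (f (x + h *\<^sub>R v) - f x) =
     h * (?g (x + s *\<^sub>R u + h *\<^sub>R v) - ?g (x + s *\<^sub>R u))" by auto
  have g: "smooth_on (ball x e) ?g" by (rule smooth_on_frechet_derivative[OF f])
  have d2: "((\<lambda>t. ?g (x + s *\<^sub>R u + t *\<^sub>R v)) has_field_derivative
      frechet_derivative ?g (at (x + s *\<^sub>R u + t *\<^sub>R v)) v) (at t)" if "0 \<le> t" "t \<le> h" for t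
  proof -
    have in': "x + s *\<^sub>R u + t *\<^sub>R v \<in> ball x e" using in_ball s that by auto
    have "((\<lambda>t. ?g (x + s *\<^sub>R u + t *\<^sub>R v)) has_derivative
        (\<lambda>r. frechet_derivative ?g (at (x + s *\<^sub>R u + t *\<^sub>R v)) (r *\<^sub>R v))) (at t)"
      by (rule has_derivative_compose[of "\<lambda>t. x + s *\<^sub>R u + t *\<^sub>R v", OF _ smooth_on_has_derivative[OF g in']])
         (auto intro!: derivative_eq_intros)
    then show ?thesis
      unfolding has_field_derivative_def
      by (rule has_derivative_eq_rhs)
         (use linear_cmul[OF has_derivative_linear[OF smooth_on_has_derivative[OF g in']]]
           in \<open>auto simp: fun_eq_iff mult.commute\<close>)
  qed
  have "\<exists>t>0. t < h \<and> ?g (x + s *\<^sub>R u + h *\<^sub>R v) - ?g (x + s *\<^sub>R u + 0 *\<^sub>R v) =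
     (h - 0) * frechet_derivative ?g (at (x + s *\<^sub>R u + t *\<^sub>R v)) v"
    by (intro MVT2[where f = "\<lambda>t. ?g (x + s *\<^sub>R u + t *\<^sub>R v)"]) (use h d2 in auto)
  then obtain t where t: "0 < t" "t < h" and e2: "?g (x + s *\<^sub>R u + h *\<^sub>R v) - ?g (x + s *\<^sub>R u) =
     h * frechet_derivative ?g (at (x + s *\<^sub>R u + t *\<^sub>R v)) v" by auto
  show thesis
    using that[OF s t] e1 unfolding e2 by simp
qed

text \<open>The second difference is symmetric in \<open>u\<close> and \<open>v\<close>, so the two
  iterated derivatives take equal values at points tending to \<open>x\<close>; their continuity
  passes this to the limit.\<close>

lemma symmetric_second_derivative_real:
  fixes f :: "'a::euclidean_space \<Rightarrow> real"
  assumes S: "open S" "x \<in> S" and f: "smooth_on S f"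
  shows "frechet_derivative (\<lambda>y. frechet_derivative f (at y) u) (at x) v =
         frechet_derivative (\<lambda>y. frechet_derivative f (at y) v) (at x) u"
proof -
  obtain e where e: "e > 0" "ball x e \<subseteq> S" using S openE by blast
  note fb = smooth_on_subset[OF f e(2)]
  let ?A = "\<lambda>y. frechet_derivative (\<lambda>y. frechet_derivative f (at y) u) (at y) v"
  let ?B = "\<lambda>y. frechet_derivative (\<lambda>y. frechet_derivative f (at y) v) (at y) u"
  \<comment> \<open>The summand 1 keeps \<open>K\<close> positive when both directions vanish;
    \<open>n + 2\<close> below makes \<open>h n * K\<close> strictly smaller than \<open>e\<close>
    already at \<open>n = 0\<close>.\<close>
  define K where "K = norm u + norm v + 1"
  have K: "K > 0" by (simp add: K_def add_nonneg_pos)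
  define h where "h n = e / (K * (real n + 2))" for n :: nat
  have h0: "h n > 0" for n using e K by (simp add: h_def)
  have hK: "h n * (norm u + norm v) < e" for n
  proof -
    have "h n * (norm u + norm v) \<le> h n * K" using h0[of n] by (simp add: K_def)
    also have "\<dots> = e / (real n + 2)" using K by (simp add: h_def)
    also have "\<dots> < e" using e by (simp add: field_simps add_pos_nonneg)
    finally show ?thesis .
  qed
  have hlim: "h \<longlonglongrightarrow> 0"
    unfolding h_def using K by real_asymp
  have "\<exists>s t s' t'. (0 < s \<and> s < h n) \<and> (0 < t \<and> t < h n) \<and> (0 < s' \<and> s' < h n) \<and> (0 < t' \<and> t' < h n) \<and>
      ?A (x + s *\<^sub>R u + t *\<^sub>R v) = ?B (x + s' *\<^sub>R v + t' *\<^sub>R u)" for n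
  proof -
    obtain s t where st: "0 < s" "s < h n" "0 < t" "t < h n"
      "f (x + h n *\<^sub>R u + h n *\<^sub>R v) - f (x + h n *\<^sub>R u) - f (x + h n *\<^sub>R v) + f x = h n * h n * ?A (x + s *\<^sub>R u + t *\<^sub>R v)"
      using mixed_difference_mvt[OF fb h0 hK] by blast
    obtain s' t' where st': "0 < s'" "s' < h n" "0 < t'" "t' < h n"
      "f (x + h n *\<^sub>R v + h n *\<^sub>R u) - f (x + h n *\<^sub>R v) - f (x + h n *\<^sub>R u) + f x = h n * h n * ?B (x + s' *\<^sub>R v + t' *\<^sub>R u)"
      using mixed_difference_mvt[OF fb h0, of n v u] hK by (metis add.commute)
    have "h n * h n * ?A (x + s *\<^sub>R u + t *\<^sub>R v) = h n * h n * ?B (x + s' *\<^sub>R v + t' *\<^sub>R u)"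
      unfolding st(5)[symmetric] st'(5)[symmetric] by (simp add: add_ac)
    then have "?A (x + s *\<^sub>R u + t *\<^sub>R v) = ?B (x + s' *\<^sub>R v + t' *\<^sub>R u)" using h0[of n] by simp
    then show ?thesis using st st' by blast
  qed
  then obtain s t s' t' where
    b: "\<And>n. 0 < s n \<and> s n < h n" "\<And>n. 0 < t n \<and> t n < h n" "\<And>n. 0 < s' n \<and> s' n < h n" "\<And>n. 0 < t' n \<and> t' n < h n"
    and eq: "\<And>n. ?A (x + s n *\<^sub>R u + t n *\<^sub>R v) = ?B (x + s' n *\<^sub>R v + t' n *\<^sub>R u)"
    by metis
  have z: "r \<longlonglongrightarrow> 0" if "\<And>n. 0 < r n \<and> r n < h n" for r :: "nat \<Rightarrow> real"
    by (rule tendsto_sandwich[OF always_eventually always_eventually tendsto_const hlim])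
       (use that in \<open>auto simp: less_imp_le\<close>)
  have lim: "(\<lambda>n. x + p n *\<^sub>R a + q n *\<^sub>R b) \<longlonglongrightarrow> x" if "p \<longlonglongrightarrow> 0" "q \<longlonglongrightarrow> 0" for p q :: "nat \<Rightarrow> real" and a b :: 'a
    using tendsto_add[OF tendsto_add[OF tendsto_const[of x] tendsto_scaleR[OF that(1) tendsto_const[of a]]]
        tendsto_scaleR[OF that(2) tendsto_const[of b]]] by simp
  have cA: "isCont ?A x" and cB: "isCont ?B x"
    using smooth_on_continuous_on[OF smooth_on_frechet_derivative[OF smooth_on_frechet_derivative[OF f]]] S
    by (auto simp: continuous_on_eq_continuous_at)
  have "(\<lambda>n. ?A (x + s n *\<^sub>R u + t n *\<^sub>R v)) \<longlonglongrightarrow> ?A x"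
    by (rule isCont_tendsto_compose[OF cA lim[OF z z]]) (use b in auto)
  moreover have "(\<lambda>n. ?B (x + s' n *\<^sub>R v + t' n *\<^sub>R u)) \<longlonglongrightarrow> ?B x"
    by (rule isCont_tendsto_compose[OF cB lim[OF z z]]) (use b in auto)
  ultimately show ?thesis using eq LIMSEQ_unique by simp
qed

lemma frechet_derivative_bounded_linear:
  assumes "bounded_linear L" "f differentiable (at x)"
  shows "frechet_derivative (\<lambda>y. L (f y)) (at x) v = L (frechet_derivative f (at x) v)"
  using bounded_linear.has_derivative[OF assms(1)] assms(2) frechet_derivative_works frechet_derivative_eq
  by metis

lemma symmetric_second_derivative:
  fixes f :: "'a::euclidean_space \<Rightarrow> 'b::euclidean_space"
  assumes S: "open S" "x \<in> S" and f: "smooth_on S f"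
  shows "frechet_derivative (\<lambda>y. frechet_derivative f (at y) u) (at x) v =
         frechet_derivative (\<lambda>y. frechet_derivative f (at y) v) (at x) u"
proof (rule euclidean_eqI)
  fix b :: 'b
  have L: "bounded_linear (\<lambda>w::'b. w \<bullet> b)" by (rule bounded_linear_inner_left)
  have "frechet_derivative (\<lambda>y. frechet_derivative f (at y) u) (at x) v \<bullet> b =
      frechet_derivative (\<lambda>y. frechet_derivative (\<lambda>y. f y \<bullet> b) (at y) u) (at x) v" for u v
  proof -
    have "frechet_derivative (\<lambda>y. frechet_derivative f (at y) u) (at x) v \<bullet> b =
      frechet_derivative (\<lambda>y. frechet_derivative f (at y) u \<bullet> b) (at x) v"
      using frechet_derivative_bounded_linear[OF L smooth_on_differentiable[OF smooth_on_frechet_derivative[OF f] S(2)]]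
      by simp
    also have "\<dots> = frechet_derivative (\<lambda>y. frechet_derivative (\<lambda>y. f y \<bullet> b) (at y) u) (at x) v"
      by (rule fun_cong[OF frechet_cong_open[OF S]])
         (simp add: frechet_derivative_bounded_linear[OF L smooth_on_differentiable[OF f]])
    finally show ?thesis .
  qed
  then show "frechet_derivative (\<lambda>y. frechet_derivative f (at y) u) (at x) v \<bullet> b =
         frechet_derivative (\<lambda>y. frechet_derivative f (at y) v) (at x) u \<bullet> b"
    using symmetric_second_derivative_real[OF S smooth_on_linear_compose[OF S(1) L f]] by simp
qed

section \<open>Fourier series of smooth functions\<close>

text \<open>Functions are considered on the closed interval only and are not assumed periodic; a
  jump across the period shows up as a boundary term in \<open>fc_deriv\<close>.\<close>

definition fc :: "(real \<Rightarrow> complex) \<Rightarrow> int \<Rightarrow> complex" where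
  "fc \<phi> k = integral {-pi..pi} (\<lambda>s. \<phi> s * cis (- of_int k * s)) / (2 * pi)"

lemma fc_integrable:
  "continuous_on {-pi..pi} \<phi> \<Longrightarrow> (\<lambda>s. \<phi> s * cis (- of_int k * s)) integrable_on {-pi..pi}"
  by (intro integrable_continuous_interval continuous_intros)

lemma fc_bound:
  assumes "continuous_on {-pi..pi} \<phi>" "\<And>s. s \<in> {-pi..pi} \<Longrightarrow> norm (\<phi> s) \<le> B"
  shows "norm (fc \<phi> k) \<le> B"
proof -
  have "norm (integral {-pi..pi} (\<lambda>s. \<phi> s * cis (- of_int k * s))) \<le> B * (pi - - pi)"
    using assms by (intro integral_bound) (auto intro!: continuous_intros simp: norm_mult)
  then show ?thesis by (simp add: fc_def norm_divide field_simps)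
qed

lemma fc_diff:
  "continuous_on {-pi..pi} \<phi> \<Longrightarrow> continuous_on {-pi..pi} \<psi> \<Longrightarrow> fc (\<lambda>s. \<phi> s - \<psi> s) k = fc \<phi> k - fc \<psi> k"
  unfolding fc_def left_diff_distrib
  by (subst Henstock_Kurzweil_Integration.integral_diff[OF fc_integrable fc_integrable]) (auto simp: diff_divide_distrib)

lemma fc_cmult: "fc (\<lambda>s. c * \<phi> s) k = c * fc \<phi> k"
  unfolding fc_def by (simp add: mult.assoc)

lemma fc_cong: "(\<And>s. s \<in> {-pi..pi} \<Longrightarrow> \<phi> s = \<psi> s) \<Longrightarrow> fc \<phi> k = fc \<psi> k"
  unfolding fc_def by (metis (no_types, lifting) Henstock_Kurzweil_Integration.integral_cong)

text \<open>Integration by parts. Both endpoints carry the same exponential factor, as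
  \<open>cis (- k pi) = cis (k pi)\<close> for an integer \<open>k\<close>; hence only the jump of
  \<open>\<phi>\<close> enters.\<close>

lemma fc_deriv:
  assumes d: "\<And>s. s \<in> {-pi..pi} \<Longrightarrow> (\<phi> has_vector_derivative \<phi>' s) (at s within {-pi..pi})"
    and c: "continuous_on {-pi..pi} \<phi>'"
  shows "fc \<phi>' k = \<i> * of_int k * fc \<phi> k + (\<phi> pi - \<phi> (-pi)) * cis (of_int k * pi) / (2 * pi)"
proof -
  have c0: "continuous_on {-pi..pi} \<phi>"
    by (rule continuous_on_vector_derivative[OF d])
  have cisk: "cis (- of_int k * pi) = cis (of_int k * pi)"
    using cis_multiple_2pi[of "of_int k"] cis_mult[of "- of_int k * pi" "2 * pi * of_int k"]
    by (simp add: algebra_simps)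
  have 1: "((\<lambda>s. \<phi>' s * cis (- of_int k * s) - \<i> * of_int k * (\<phi> s * cis (- of_int k * s))) has_integral
      \<phi> pi * cis (- of_int k * pi) - \<phi> (-pi) * cis (- of_int k * (-pi))) {-pi..pi}"
  proof (intro fundamental_theorem_of_calculus)
    fix s assume s: "s \<in> {-pi..pi}"
    have "((\<lambda>s. cis (- of_int k * s)) has_vector_derivative (- \<i> * of_int k * cis (- of_int k * s))) (at s within {-pi..pi})"
      unfolding has_vector_derivative_def
      by (auto intro!: derivative_eq_intros simp: fun_eq_iff scaleR_conv_of_real algebra_simps)
    from has_vector_derivative_mult[OF d[OF s] this]
    show "((\<lambda>s. \<phi> s * cis (- of_int k * s)) has_vector_derivative
       \<phi>' s * cis (- of_int k * s) - \<i> * of_int k * (\<phi> s * cis (- of_int k * s))) (at s within {-pi..pi})"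
      by (simp add: algebra_simps)
  qed auto
  have 2: "((\<lambda>s. \<phi>' s * cis (- of_int k * s) - \<i> * of_int k * (\<phi> s * cis (- of_int k * s))) has_integral
      2 * pi * fc \<phi>' k - \<i> * of_int k * (2 * pi * fc \<phi> k)) {-pi..pi}"
    unfolding fc_def
    by (intro has_integral_diff has_integral_mult_right)
       (use integrable_integral[OF fc_integrable[OF c]] integrable_integral[OF fc_integrable[OF c0]] in auto)
  have "2 * pi * fc \<phi>' k - \<i> * of_int k * (2 * pi * fc \<phi> k) =
     (\<phi> pi - \<phi> (-pi)) * cis (of_int k * pi)"
    using has_integral_unique[OF 2 1] cisk by (simp add: algebra_simps)
  then show ?thesis by (simp add: field_simps)
qed

text \<open>The operator \<open>1 - d^2/ds^2\<close> multiplies coefficients by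
  \<open>1 + k^2\<close>, which unlike \<open>k^2\<close> never vanishes; dividing by it gives decay
  without a separate case \<open>k = 0\<close>. The zeros at the endpoints remove the boundary
  terms.\<close>

lemma fc_second_deriv:
  assumes d: "\<And>s. s \<in> {-pi..pi} \<Longrightarrow> (\<phi> has_vector_derivative \<phi>' s) (at s within {-pi..pi})"
    and d': "\<And>s. s \<in> {-pi..pi} \<Longrightarrow> (\<phi>' has_vector_derivative \<phi>'' s) (at s within {-pi..pi})"
    and c: "continuous_on {-pi..pi} \<phi>''"
    and z: "\<phi> pi = 0" "\<phi> (-pi) = 0" "\<phi>' pi = 0" "\<phi>' (-pi) = 0"
  shows "fc (\<lambda>s. \<phi> s - \<phi>'' s) k = (1 + (of_int k)\<^sup>2) * fc \<phi> k"
proof -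
  have c0: "continuous_on {-pi..pi} \<phi>" "continuous_on {-pi..pi} \<phi>'"
    by (rule continuous_on_vector_derivative[OF d], assumption, rule continuous_on_vector_derivative[OF d'], assumption)
  have "fc \<phi>'' k = \<i> * of_int k * (\<i> * of_int k * fc \<phi> k)"
    using fc_deriv[OF d c0(2)] fc_deriv[OF d' c] z by simp
  then show ?thesis
    unfolding fc_diff[OF c0(1) c] by (simp add: algebra_simps power2_eq_square)
qed

lemma int_inverse_square_summable: "(\<lambda>k::int. 1 / (1 + (of_int k)\<^sup>2) :: real) summable_on UNIV"
proof -
  have s: "summable (\<lambda>n::nat. 1 / (1 + (real n)\<^sup>2))"
  proof (rule summable_comparison_test_ev[OF _ inverse_power_summable[of 2]])
    show "\<forall>\<^sub>F n in sequentially. norm (1 / (1 + (real n)\<^sup>2)) \<le> inverse (real n ^ 2)"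
      using eventually_gt_at_top[of 0] by eventually_elim (auto simp: inverse_eq_divide intro!: divide_left_mono mult_pos_pos add_pos_nonneg)
  qed simp
  then have s1: "(\<lambda>n::nat. 1 / (1 + (real n)\<^sup>2)) summable_on UNIV"
    by (subst summable_on_UNIV_nonneg_real_iff) auto
  have "(\<lambda>k::int. 1 / (1 + (of_int k)\<^sup>2) :: real) summable_on (range int)"
    by (subst summable_on_reindex) (use s1 in \<open>auto simp: o_def\<close>)
  moreover have "(\<lambda>k::int. 1 / (1 + (of_int k)\<^sup>2) :: real) summable_on (range (\<lambda>n. - int n))"
    by (subst summable_on_reindex) (use s1 in \<open>auto simp: o_def inj_def\<close>)
  moreover have "UNIV = range int \<union> range (\<lambda>n. - int n)"
    using int_cases2 by blast
  ultimately show ?thesis using summable_on_union by metis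
qed

lemma int_pair_inverse_square_summable:
  "(\<lambda>(k::int, l::int). 1 / ((1 + (of_int k)\<^sup>2) * (1 + (of_int l)\<^sup>2)) :: real) summable_on UNIV"
proof -
  have "(\<lambda>x. norm (1 / ((1 + (of_int (fst x))\<^sup>2) * (1 + (of_int (snd x))\<^sup>2)) :: real)) summable_on (UNIV :: int set) \<times> (UNIV :: int set)"
    unfolding Infinite_Sum.abs_summable_on_Sigma_iff
  proof (intro conjI ballI)
    fix k :: int
    show "(\<lambda>y. norm (1 / ((1 + (of_int (fst (k, y)))\<^sup>2) * (1 + (of_int (snd (k, y)))\<^sup>2)) :: real)) summable_on UNIV"
      using summable_on_cmult_right[OF int_inverse_square_summable, of "1 / (1 + (of_int k)\<^sup>2)"] by simp
    show "(\<lambda>x. norm (\<Sum>\<^sub>\<infinity>y. norm (1 / ((1 + (of_int (fst (x, y::int)))\<^sup>2) * (1 + (of_int (snd (x, y)))\<^sup>2)) :: real))) summable_on (UNIV::int set)"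
    proof -
      have "(\<Sum>\<^sub>\<infinity>y. norm (1 / ((1 + (of_int (fst (x, y)))\<^sup>2) * (1 + (of_int (snd (x, y)))\<^sup>2)) :: real)) =
         1 / (1 + (of_int x)\<^sup>2) * (\<Sum>\<^sub>\<infinity>y. 1 / (1 + (of_int y)\<^sup>2))" for x :: int
        using infsum_cmult_right'[of "1 / (1 + (of_int x)\<^sup>2)" "\<lambda>y::int. 1 / (1 + (of_int y)\<^sup>2) :: real" UNIV]
        by (simp add: abs_mult)
      moreover have "(\<Sum>\<^sub>\<infinity>y::int. 1 / (1 + (of_int y)\<^sup>2) :: real) \<ge> 0" by (intro infsum_nonneg) auto
      ultimately show ?thesis
        using summable_on_cmult_left[OF int_inverse_square_summable] by (simp add: abs_mult)
    qed
  qed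
  then show ?thesis by (simp add: case_prod_unfold)
qed

text \<open>Uniform approximation by a polynomial \<open>p\<close> leaves an error of at most
  \<open>e / 2\<close> in every coefficient, and integration by parts bounds
  \<open>k * fc p k\<close>. As \<open>p\<close> need not be periodic, the bound \<open>C\<close>
  contains its jump across the period.\<close>

lemma Riemann_Lebesgue_continuous:
  assumes g: "continuous_on {-pi..pi} g" and e: "e > 0"
  obtains N :: nat where "\<And>k. \<bar>k\<bar> \<ge> int N \<Longrightarrow> norm (fc g k) < e"
proof -
  obtain p where p: "polynomial_function p" "\<And>x. x \<in> {-pi..pi} \<Longrightarrow> norm (g x - p x) < e / 2"
    using Stone_Weierstrass_polynomial_function[OF compact_Icc g, of "e / 2"] e by auto
  obtain p' where p': "polynomial_function p'" "\<And>x. (p has_vector_derivative (p' x)) (at x)"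
    using has_vector_derivative_polynomial_function[OF p(1)] by blast
  have cp: "continuous_on {-pi..pi} p" "continuous_on {-pi..pi} p'"
    using p(1) p'(1) continuous_on_polymonial_function by blast+
  obtain B where B: "\<And>s. s \<in> {-pi..pi} \<Longrightarrow> norm (p' s) \<le> B"
    using compact_imp_bounded[OF compact_continuous_image[OF cp(2) compact_Icc]]
    by (meson bounded_iff imageI)
  define C where "C = B + norm (p pi - p (-pi)) / (2 * pi)"
  have C: "\<bar>of_int k\<bar> * norm (fc p k) \<le> C" for k
  proof -
    have "\<i> * of_int k * fc p k = fc p' k - (p pi - p (-pi)) * cis (of_int k * pi) / (2 * pi)"
      using fc_deriv[of p p' k] p' cp by (simp add: has_vector_derivative_at_within)
    then have "norm (\<i> * of_int k * fc p k) = norm (fc p' k - (p pi - p (-pi)) * cis (of_int k * pi) / (2 * pi))"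
      by simp
    also have "\<dots> \<le> norm (fc p' k) + norm ((p pi - p (-pi)) * cis (of_int k * pi) / (2 * pi))"
      by (rule norm_triangle_ineq4)
    also have "\<dots> \<le> B + norm (p pi - p (-pi)) / (2 * pi)"
      using fc_bound[OF cp(2) B] by (simp add: norm_mult norm_divide)
    finally show ?thesis by (simp add: C_def norm_mult)
  qed
  obtain N :: nat where N: "real N > 2 * \<bar>C\<bar> / e" using reals_Archimedean2 by blast
  show thesis
  proof (rule that[of N])
    fix k :: int assume k: "\<bar>k\<bar> \<ge> int N"
    have kN: "\<bar>of_int k :: real\<bar> \<ge> real N" using k by linarith
    have "norm (fc p k) < e / 2"
    proof (rule ccontr)
      assume "\<not> ?thesis"
      then have "\<bar>of_int k :: real\<bar> * (e / 2) \<le> \<bar>of_int k\<bar> * norm (fc p k)" by (intro mult_left_mono) auto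
      also have "\<dots> \<le> \<bar>C\<bar>" using C[of k] by linarith
      finally have "\<bar>of_int k :: real\<bar> \<le> 2 * \<bar>C\<bar> / e" using e by (simp add: field_simps)
      then show False using N kN by linarith
    qed
    moreover have "norm (fc (\<lambda>s. g s - p s) k) \<le> e / 2"
      using p(2) by (intro fc_bound continuous_intros g cp) (simp add: less_imp_le)
    moreover have "fc g k = fc (\<lambda>s. g s - p s) k + fc p k"
      using fc_diff[OF g cp(1)] by simp
    ultimately show "norm (fc g k) < e"
      using norm_triangle_ineq[of "fc (\<lambda>s. g s - p s) k" "fc p k"] by simp
  qed
qed

lemma fc_const: "fc (\<lambda>_. c) k = (if k = 0 then c else 0)"
proof (cases "k = 0")
  case True
  then show ?thesis by (simp add: fc_def scaleR_conv_of_real)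
next
  case False
  have "fc (\<lambda>_. 0) k = \<i> * of_int k * fc (\<lambda>_. c) k"
    using fc_deriv[of "\<lambda>_. c" "\<lambda>_. 0" k] by simp
  then show ?thesis using False by (simp add: fc_def)
qed

text \<open>\<open>has_sum\<close> is a limit over all finite sets; this allows evaluating it along
  the symmetric partial sums, which telescope.\<close>

lemma filterlim_int_symmetric_intervals:
  "filterlim (\<lambda>n. {- int n..int n}) (finite_subsets_at_top UNIV) sequentially"
proof -
  have "\<forall>\<^sub>F n in sequentially. X \<subseteq> {- int n..int n}" if fin: "finite X" for X
  proof -
    obtain B where B: "\<And>x. x \<in> X \<Longrightarrow> \<bar>x\<bar> \<le> B"
      using bdd_above_finite[OF finite_imageI[OF fin, of abs]] by (auto simp: bdd_above_def)
    show ?thesis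
      using eventually_ge_at_top[of "nat B"] by eventually_elim (use B in fastforce)
  qed
  then show ?thesis by (auto simp: filterlim_finite_subsets_at_top)
qed

lemma telescope_int_sum:
  fixes G :: "int \<Rightarrow> 'a::ab_group_add"
  shows "(\<Sum>k\<in>{- int n..int n}. G (k - 1) - G k) = G (- int n - 1) - G (int n)"
proof (induction n)
  case (Suc n)
  have "{- int (Suc n)..int (Suc n)} = insert (- int (Suc n)) (insert (int (Suc n)) {- int n..int n})" by auto
  then have "(\<Sum>k\<in>{- int (Suc n)..int (Suc n)}. G (k - 1) - G k) =
     (G (- int (Suc n) - 1) - G (- int (Suc n))) + ((G (int (Suc n) - 1) - G (int (Suc n))) + (\<Sum>k\<in>{- int n..int n}. G (k - 1) - G k))"
    by simp
  also have "\<dots> = G (- int (Suc n) - 1) - G (int (Suc n))"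
    unfolding Suc by (simp add: algebra_simps) (metis add.commute diff_minus_eq_add minus_diff_eq uminus_add_conv_diff)
  finally show ?case .
qed simp

lemma slope_tendsto:
  fixes f :: "real \<Rightarrow> complex"
  assumes "(f has_vector_derivative d) (at x)"
  shows "((\<lambda>s. (f s - f x) / of_real (s - x)) \<longlongrightarrow> d) (at x)"
proof -
  have "((\<lambda>s. norm (f s - f x - (s - x) *\<^sub>R d) / norm (s - x)) \<longlongrightarrow> 0) (at x)"
    using assms by (simp add: has_vector_derivative_def has_derivative_iff_norm)
  then have "((\<lambda>s. norm ((f s - f x) / of_real (s - x) - d)) \<longlongrightarrow> 0) (at x)"
  proof (rule Lim_transform_eventually)
    have "norm (f s - f x - (s - x) *\<^sub>R d) / norm (s - x) = norm ((f s - f x) / of_real (s - x) - d)" if "s \<noteq> x" for s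
    proof -
      have "(f s - f x) / of_real (s - x) - d = (f s - f x - (s - x) *\<^sub>R d) / of_real (s - x)"
        using that by (simp add: field_simps scaleR_conv_of_real flip: of_real_diff)
      then show ?thesis by (simp only: norm_divide norm_of_real real_norm_def)
    qed
    then show "\<forall>\<^sub>F s in at x. norm (f s - f x - (s - x) *\<^sub>R d) / norm (s - x) = norm ((f s - f x) / of_real (s - x) - d)"
      by (simp add: eventually_at_filter)
  qed
  then show ?thesis by (rule LIM_zero_cancel[OF tendsto_norm_zero_cancel])
qed

text \<open>The quotient of \<open>\<phi> - \<phi> x\<close> by \<open>cis (s - x) - 1\<close> is continuous, and the partial sums of the
  Fourier series at \<open>x\<close> telescope in terms of its coefficients, which tend to zero.\<close>

lemma fourier_inversion:
  assumes x: "x \<in> {-pi<..<pi}" and c: "continuous_on {-pi..pi} \<phi>"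
    and d: "(\<phi> has_vector_derivative d) (at x)"
    and sum: "(\<lambda>k. norm (fc \<phi> k)) summable_on UNIV"
  shows "((\<lambda>k. fc \<phi> k * cis (of_int k * x)) has_sum \<phi> x) UNIV"
proof -
  \<comment> \<open>At \<open>s = x\<close> the value is the limit of the quotient, since
    \<open>cis (s - x) - 1\<close> has derivative \<open>\<i>\<close> there.\<close>
  define g where "g s = (if s = x then d / \<i> else (\<phi> s - \<phi> x) / (cis (s - x) - 1))" for s
  \<comment> \<open>The denominator could vanish again only at distance \<open>2 * pi\<close>, which
    is out of reach because \<open>x\<close> lies in the open interval.\<close>
  have ne: "cis (s - x) \<noteq> 1" if "s \<in> {-pi..pi}" "s \<noteq> x" for s
  proof
    assume "cis (s - x) = 1"
    then have "cos (s - x) = 1" by (metis cis.sel(1) one_complex.sel(1))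
    then obtain n :: int where n: "s - x = of_int n * (2 * pi)"
      using cos_one_2pi_int by (metis mult.assoc)
    moreover have "\<bar>s - x\<bar> < 2 * pi" using x that by (auto simp: abs_if)
    ultimately have "\<bar>of_int n :: real\<bar> * (2 * pi) < 1 * (2 * pi)" by (simp add: abs_mult)
    then have "\<bar>of_int n :: real\<bar> < 1" using pi_gt_zero by (simp only: mult_less_cancel_right_pos)
    then have "n = 0" by linarith
    then show False using n that by simp
  qed
  have cg: "continuous_on {-pi..pi} g"
    unfolding continuous_on_eq_continuous_within
  proof
    fix s assume s: "s \<in> {-pi..pi}"
    show "continuous (at s within {-pi..pi}) g"
    proof (cases "s = x")
      case False
      have "continuous (at s within {-pi..pi}) (\<lambda>s. (\<phi> s - \<phi> x) / (cis (s - x) - 1))"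
      proof (intro continuous_intros)
        show "continuous (at s within {-pi..pi}) \<phi>" using c s by (simp add: continuous_on_eq_continuous_within)
        have "continuous_on UNIV (\<lambda>s. cis (s - x))" by (intro continuous_intros)
        then show "continuous (at s within {-pi..pi}) (\<lambda>s. cis (s - x))"
          by (simp add: continuous_on_eq_continuous_at continuous_at_imp_continuous_within)
        show "cis (s - x) - 1 \<noteq> 0" using ne[OF s False] by simp
      qed
      moreover have "\<forall>\<^sub>F r in at s within {-pi..pi}. (\<phi> r - \<phi> x) / (cis (r - x) - 1) = g r"
        unfolding eventually_at using False by (intro exI[of _ "\<bar>s - x\<bar>"]) (auto simp: g_def dist_real_def)
      ultimately have "(g \<longlongrightarrow> (\<phi> s - \<phi> x) / (cis (s - x) - 1)) (at s within {-pi..pi})"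
        unfolding continuous_within by (rule Lim_transform_eventually)
      moreover have "g s = (\<phi> s - \<phi> x) / (cis (s - x) - 1)" using False by (simp add: g_def)
      ultimately show ?thesis unfolding continuous_within by simp
    next
      case True
      have "((\<lambda>s. cis (s - x)) has_vector_derivative \<i>) (at x)"
        unfolding has_vector_derivative_def by (auto intro!: derivative_eq_intros)
      from tendsto_divide[OF slope_tendsto[OF d] slope_tendsto[OF this]]
      have "((\<lambda>s. (\<phi> s - \<phi> x) / of_real (s - x) / ((cis (s - x) - 1) / of_real (s - x))) \<longlongrightarrow> d / \<i>) (at x)"
        by simp
      then have gl: "(g \<longlongrightarrow> d / \<i>) (at x)"
        by (rule Lim_transform_eventually) (auto simp: g_def eventually_at_filter)
      have "g x = d / \<i>" by (simp add: g_def)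
      then show ?thesis
        unfolding True continuous_within using tendsto_within_subset[OF gl subset_UNIV] by simp
    qed
  qed
  let ?G = "\<lambda>k. fc g k * cis (of_int k * x)"
  \<comment> \<open>Multiplying \<open>g\<close> by \<open>cis s\<close> shifts its coefficients by
    one. So \<open>\<phi> s - \<phi> x = (cis (s - x) - 1) * g s\<close> makes each term of the
    series a difference of consecutive values of \<open>?G\<close>, up to the constant at
    \<open>k = 0\<close>.\<close>
  have eq: "fc \<phi> k * cis (of_int k * x) = (if k = 0 then \<phi> x else 0) + (?G (k - 1) - ?G k)" for k
  proof -
    have "fc (\<lambda>s. \<phi> s - \<phi> x) k = cis (- x) * fc g (k - 1) - fc g k"
    proof -
      have "fc (\<lambda>s. \<phi> s - \<phi> x) k = fc (\<lambda>s. cis (- x) * (g s * cis s) - g s) k"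
      proof (rule fc_cong)
        fix s assume s: "s \<in> {-pi..pi}"
        have "\<phi> s - \<phi> x = (cis (s - x) - 1) * g s"
          using ne[OF s] by (cases "s = x") (auto simp: g_def)
        then show "\<phi> s - \<phi> x = cis (- x) * (g s * cis s) - g s"
          using cis_mult[of "-x" s] by (simp add: algebra_simps)
      qed
      also have "\<dots> = cis (- x) * fc (\<lambda>s. g s * cis s) k - fc g k"
        using cg by (subst fc_diff) (auto intro!: continuous_intros simp: fc_cmult)
      also have "fc (\<lambda>s. g s * cis s) k = fc g (k - 1)"
      proof -
        have "cis s * cis (- of_int k * s) = cis (- of_int (k - 1) * s)" for s
          by (simp add: cis_mult algebra_simps)
        then show ?thesis unfolding fc_def by (simp only: mult.assoc)
      qed
      finally show ?thesis .
    qed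
    moreover have "fc (\<lambda>s. \<phi> s - \<phi> x) k = fc \<phi> k - (if k = 0 then \<phi> x else 0)"
      using fc_diff[OF c continuous_on_const, of "\<phi> x"] by (simp add: fc_const)
    ultimately have e: "fc \<phi> k = (if k = 0 then \<phi> x else 0) + (cis (- x) * fc g (k - 1) - fc g k)"
      by (metis add.commute diff_eq_eq)
    have ring: "(c + (a * p - q)) * E = c * E + (p * (a * E) - q * E)" for c a p q E :: complex
      by algebra
    have "fc \<phi> k * cis (of_int k * x) = (if k = 0 then \<phi> x else 0) * cis (of_int k * x) +
        (fc g (k - 1) * (cis (- x) * cis (of_int k * x)) - fc g k * cis (of_int k * x))"
      unfolding e by (rule ring)
    moreover have "cis (- x) * cis (of_int k * x) = cis (of_int (k - 1) * x)"
      by (simp add: cis_mult algebra_simps)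
    moreover have "(if k = 0 then \<phi> x else 0) * cis (of_int k * x) = (if k = 0 then \<phi> x else 0)" by simp
    ultimately show ?thesis by simp
  qed
  have "(\<lambda>n. \<Sum>k\<in>{- int n..int n}. fc \<phi> k * cis (of_int k * x)) \<longlonglongrightarrow> \<phi> x"
  proof -
    have "(\<Sum>k\<in>{- int n..int n}. fc \<phi> k * cis (of_int k * x)) = \<phi> x + (?G (- int n - 1) - ?G (int n))" for n
      unfolding eq sum.distrib using telescope_int_sum[of ?G n] by simp
    moreover have "(\<lambda>n. ?G (- int n - 1) - ?G (int n)) \<longlonglongrightarrow> 0"
    proof (rule LIMSEQ_I)
      fix r :: real assume r: "r > 0"
      obtain N where N: "\<And>k. \<bar>k\<bar> \<ge> int N \<Longrightarrow> norm (fc g k) < r / 2"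
        using Riemann_Lebesgue_continuous[OF cg, of "r / 2"] r by auto
      have "norm (?G (- int n - 1) - ?G (int n) - 0) < r" if "n \<ge> N" for n
        using norm_triangle_ineq4[of "?G (- int n - 1)" "?G (int n)"] N[of "- int n - 1"] N[of "int n"] that
        by (simp add: norm_mult)
      then show "\<exists>no. \<forall>n\<ge>no. norm (?G (- int n - 1) - ?G (int n) - 0) < r" by blast
    qed
    ultimately show ?thesis
      using tendsto_add[OF tendsto_const[of "\<phi> x" sequentially], of "\<lambda>n. ?G (- int n - 1) - ?G (int n)" 0] by simp
  qed
  moreover define h where "h = (\<lambda>k. fc \<phi> k * cis (of_int k * x))"
  ultimately have lim: "(\<lambda>n. sum h {- int n..int n}) \<longlonglongrightarrow> \<phi> x" by simp
  have s: "h summable_on UNIV"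
    unfolding h_def by (rule abs_summable_summable) (use sum in \<open>simp add: norm_mult\<close>)
  have "(sum h \<longlongrightarrow> infsum h UNIV) (finite_subsets_at_top UNIV)"
    by (rule infsum_tendsto[OF s])
  from filterlim_compose[OF this filterlim_int_symmetric_intervals] lim
  have "infsum h UNIV = \<phi> x" by (rule LIMSEQ_unique)
  then show ?thesis using has_sum_infsum[OF s] by (simp add: h_def)
qed

section \<open>Double Fourier series with a scale parameter\<close>

text \<open>The first two coordinates are the angles, the third is the scale of the zoom. The bound
  4 exceeds \<open>pi\<close>, so the closed period square lies in the open box and derivatives
  exist up to its edge.\<close>

definition box3 :: "real \<Rightarrow> (real \<times> real \<times> real) set" where
  "box3 r = {x. \<bar>fst x\<bar> < 4 \<and> \<bar>fst (snd x)\<bar> < 4 \<and> \<bar>snd (snd x)\<bar> < r}"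

text \<open>The vanishing region contains the edge of the period square, so all boundary terms of
  integrations by parts disappear; being open, it passes the property on to derivatives.\<close>

definition nice :: "real \<Rightarrow> (real \<times> real \<times> real \<Rightarrow> complex) \<Rightarrow> bool" where
  "nice r f \<longleftrightarrow> smooth_on (box3 r) f \<and> (\<forall>x\<in>box3 r. 2 < \<bar>fst x\<bar> \<or> 2 < \<bar>fst (snd x)\<bar> \<longrightarrow> f x = 0)"

definition Ds :: "(real \<times> real \<times> real \<Rightarrow> complex) \<Rightarrow> real \<times> real \<times> real \<Rightarrow> complex" where
  "Ds f x = frechet_derivative f (at x) (1, 0, 0)"

definition Dt :: "(real \<times> real \<times> real \<Rightarrow> complex) \<Rightarrow> real \<times> real \<times> real \<Rightarrow> complex" where
  "Dt f x = frechet_derivative f (at x) (0, 1, 0)"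

text \<open>This is \<open>(1 - Ds^2) (1 - Dt^2)\<close>. Its symbol is the product
  \<open>freq_weight\<close>, the reciprocal of which is summable over all pairs of
  integers.\<close>

definition LL :: "(real \<times> real \<times> real \<Rightarrow> complex) \<Rightarrow> real \<times> real \<times> real \<Rightarrow> complex" where
  "LL f = (let g = (\<lambda>x. f x - Dt (Dt f) x) in (\<lambda>x. g x - Ds (Ds g) x))"

definition fc2 :: "(real \<times> real \<times> real \<Rightarrow> complex) \<Rightarrow> real \<Rightarrow> int \<Rightarrow> int \<Rightarrow> complex" where
  "fc2 f e k l = fc (\<lambda>t. fc (\<lambda>s. f (s, t, e)) k) l"

abbreviation freq_weight :: "int \<Rightarrow> int \<Rightarrow> real" where
  "freq_weight k l \<equiv> (1 + (of_int k)\<^sup>2) * (1 + (of_int l)\<^sup>2)"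

lemma open_box3: "open (box3 r)"
  unfolding box3_def by (intro open_Collect_conj open_Collect_less continuous_intros)

lemma in_box3: "s \<in> {-pi..pi} \<Longrightarrow> t \<in> {-pi..pi} \<Longrightarrow> \<bar>e\<bar> < r \<Longrightarrow> (s, t, e) \<in> box3 r"
  using pi_less_4 by (auto simp: box3_def)

lemma pi_gt_2: "2 < pi"
  using pi_gt3 by linarith

lemma niceD:
  assumes "nice r f"
  shows "smooth_on (box3 r) f" "x \<in> box3 r \<Longrightarrow> 2 < \<bar>fst x\<bar> \<or> 2 < \<bar>fst (snd x)\<bar> \<Longrightarrow> f x = 0"
  using assms by (auto simp: nice_def)

lemma nice_continuous:
  assumes "nice r f" "continuous_on S g" "g ` S \<subseteq> box3 r"
  shows "continuous_on S (\<lambda>x. f (g x))"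
  using continuous_on_compose2[OF smooth_on_continuous_on[OF niceD(1)[OF assms(1)]] assms(2,3)] .

lemma nice_directional:
  assumes f: "nice r f"
  shows "nice r (\<lambda>x. frechet_derivative f (at x) v)"
  unfolding nice_def
proof (intro conjI ballI impI)
  show "smooth_on (box3 r) (\<lambda>x. frechet_derivative f (at x) v)"
    by (rule smooth_on_frechet_derivative[OF niceD(1)[OF f]])
  fix x assume x: "x \<in> box3 r" "2 < \<bar>fst x\<bar> \<or> 2 < \<bar>fst (snd x)\<bar>"
  have Z: "open (box3 r \<inter> {x. 2 < \<bar>fst x\<bar> \<or> 2 < \<bar>fst (snd x)\<bar>})"
    by (intro open_Int open_box3 open_Collect_disj open_Collect_less continuous_intros)
  have "frechet_derivative f (at x) = frechet_derivative (\<lambda>_. 0) (at x)"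
    by (rule frechet_cong_open[OF Z]) (use x niceD(2)[OF f] in auto)
  then show "frechet_derivative f (at x) v = 0" by simp
qed

lemma nice_Ds: "nice r f \<Longrightarrow> nice r (Ds f)"
  unfolding Ds_def[abs_def] by (rule nice_directional)

lemma nice_Dt: "nice r f \<Longrightarrow> nice r (Dt f)"
  unfolding Dt_def[abs_def] by (rule nice_directional)

lemma nice_diff: "nice r f \<Longrightarrow> nice r g \<Longrightarrow> nice r (\<lambda>x. f x - g x)"
  unfolding nice_def by (auto intro: smooth_on_diff[OF open_box3])

lemma nice_LL: "nice r f \<Longrightarrow> nice r (LL f)"
  unfolding LL_def Let_def by (intro nice_diff nice_Ds nice_Dt)

lemma nice_funpow_LL: "nice r f \<Longrightarrow> nice r ((LL ^^ m) f)"
  by (induction m) (auto intro: nice_LL)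

lemma nice_slice_deriv:
  assumes f: "nice r f" and x: "(s, t, e) \<in> box3 r"
  shows "((\<lambda>s. f (s, t, e)) has_vector_derivative Ds f (s, t, e)) (at s within A)"
    and "((\<lambda>t. f (s, t, e)) has_vector_derivative Dt f (s, t, e)) (at t within B)"
proof -
  note d = smooth_on_has_derivative[OF niceD(1)[OF f] x]
  note lin = linear_cmul[OF has_derivative_linear[OF d]]
  have "((\<lambda>s. f (s, t, e)) has_derivative (\<lambda>h. frechet_derivative f (at (s, t, e)) (h, 0, 0))) (at s)"
    by (rule has_derivative_compose[of "\<lambda>s. (s, t, e)", OF _ d])
       (intro has_derivative_Pair has_derivative_ident has_derivative_const)
  moreover have "(\<lambda>h. frechet_derivative f (at (s, t, e)) (h, 0, 0)) = (\<lambda>h. h *\<^sub>R frechet_derivative f (at (s, t, e)) (1, 0, 0))"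
  proof
    show "frechet_derivative f (at (s, t, e)) (h, 0, 0) = h *\<^sub>R frechet_derivative f (at (s, t, e)) (1, 0, 0)" for h
      using lin[of h "(1, 0, 0)"] by simp
  qed
  ultimately have "((\<lambda>s. f (s, t, e)) has_vector_derivative Ds f (s, t, e)) (at s)"
    unfolding has_vector_derivative_def Ds_def by (rule has_derivative_eq_rhs)
  then show "((\<lambda>s. f (s, t, e)) has_vector_derivative Ds f (s, t, e)) (at s within A)"
    by (rule has_vector_derivative_at_within)
  have "((\<lambda>t. f (s, t, e)) has_derivative (\<lambda>h. frechet_derivative f (at (s, t, e)) (0, h, 0))) (at t)"
    by (rule has_derivative_compose[of "\<lambda>t. (s, t, e)", OF _ d])
       (intro has_derivative_Pair has_derivative_ident has_derivative_const)
  moreover have "(\<lambda>h. frechet_derivative f (at (s, t, e)) (0, h, 0)) = (\<lambda>h. h *\<^sub>R frechet_derivative f (at (s, t, e)) (0, 1, 0))"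
  proof
    show "frechet_derivative f (at (s, t, e)) (0, h, 0) = h *\<^sub>R frechet_derivative f (at (s, t, e)) (0, 1, 0)" for h
      using lin[of h "(0, 1, 0)"] by simp
  qed
  ultimately have "((\<lambda>t. f (s, t, e)) has_vector_derivative Dt f (s, t, e)) (at t)"
    unfolding has_vector_derivative_def Dt_def by (rule has_derivative_eq_rhs)
  then show "((\<lambda>t. f (s, t, e)) has_vector_derivative Dt f (s, t, e)) (at t within B)"
    by (rule has_vector_derivative_at_within)
qed

lemma nice_slice_continuous:
  assumes "nice r f" "\<bar>e\<bar> < r"
  shows "t \<in> {-pi..pi} \<Longrightarrow> continuous_on {-pi..pi} (\<lambda>s. f (s, t, e))"
    and "s \<in> {-pi..pi} \<Longrightarrow> continuous_on {-pi..pi} (\<lambda>t. f (s, t, e))"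
    and "continuous_on ({-pi..pi} \<times> {-pi..pi}) (\<lambda>x. f (fst x, snd x, e))"
  using assms by (auto intro!: nice_continuous[OF assms(1)] continuous_intros simp: in_box3)

lemma nice_zero_at_pi:
  assumes "nice r f" "\<bar>e\<bar> < r" "x \<in> {-pi..pi}"
  shows "f (pi, x, e) = 0" "f (- pi, x, e) = 0" "f (x, pi, e) = 0" "f (x, - pi, e) = 0"
  using assms pi_gt_2 by (auto intro!: niceD(2)[OF assms(1)] in_box3)

text \<open>Differentiation under the integral sign; it supplies the regularity in \<open>t\<close>
  of the coefficients in \<open>s\<close> that the expansion in the second variable needs.\<close>

lemma fc_slice_deriv:
  assumes f: "nice r f" and e: "\<bar>e\<bar> < r" and t: "t \<in> {-pi..pi}"
  shows "((\<lambda>t. fc (\<lambda>s. f (s, t, e)) k) has_vector_derivative fc (\<lambda>s. Dt f (s, t, e)) k) (at t within {-pi..pi})"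
proof -
  have "((\<lambda>t. integral (cbox (-pi) pi) (\<lambda>s. f (s, t, e) * cis (- of_int k * s))) has_vector_derivative
      integral (cbox (-pi) pi) (\<lambda>s. Dt f (s, t, e) * cis (- of_int k * s))) (at t within {-pi..pi})"
  proof (rule leibniz_rule_vector_derivative)
    show "((\<lambda>t. f (s, t, e) * cis (- of_int k * s)) has_vector_derivative Dt f (s, t, e) * cis (- of_int k * s))
        (at t within {-pi..pi})" if "t \<in> {-pi..pi}" "s \<in> cbox (-pi) pi" for s t
      by (rule has_vector_derivative_mult_left[OF nice_slice_deriv(2)[OF f in_box3]]) (use that e in auto)
    show "(\<lambda>s. f (s, t, e) * cis (- of_int k * s)) integrable_on cbox (-pi) pi" if "t \<in> {-pi..pi}" for t
      using fc_integrable[OF nice_slice_continuous(1)[OF f e that]] by simp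
    have "continuous_on ({-pi..pi} \<times> cbox (-pi) pi) (\<lambda>x. Dt f (snd x, fst x, e) * cis (- of_int k * snd x))"
      by (intro continuous_on_mult nice_continuous[OF nice_Dt[OF f]] continuous_intros)
         (use e in \<open>auto simp: in_box3\<close>)
    then show "continuous_on ({-pi..pi} \<times> cbox (-pi) pi) (\<lambda>(t, s). Dt f (s, t, e) * cis (- of_int k * s))"
      by (simp add: case_prod_unfold)
  qed (use t in auto)
  from bounded_linear.has_vector_derivative[OF bounded_linear_divide this, of "2 * pi"]
  show ?thesis by (simp add: fc_def)
qed

lemma fc_slice_continuous:
  assumes f: "nice r f" and e: "\<bar>e\<bar> < r"
  shows "continuous_on {-pi..pi} (\<lambda>t. fc (\<lambda>s. f (s, t, e)) k)"
  by (rule continuous_on_vector_derivative[OF fc_slice_deriv[OF f e]])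

lemma fc2_bound:
  assumes f: "nice r f" and e: "\<bar>e\<bar> < r"
    and B: "\<And>s t. s \<in> {-pi..pi} \<Longrightarrow> t \<in> {-pi..pi} \<Longrightarrow> norm (f (s, t, e)) \<le> B"
  shows "norm (fc2 f e k l) \<le> B"
  unfolding fc2_def
  by (intro fc_bound[OF fc_slice_continuous[OF f e]] fc_bound[OF nice_slice_continuous(1)[OF f e]] B)

lemma fc_slice_Dss:
  assumes f: "nice r f" and e: "\<bar>e\<bar> < r" and t: "t \<in> {-pi..pi}"
  shows "fc (\<lambda>s. f (s, t, e) - Ds (Ds f) (s, t, e)) k = (1 + (of_int k)\<^sup>2) * fc (\<lambda>s. f (s, t, e)) k"
  by (rule fc_second_deriv[OF nice_slice_deriv(1)[OF f in_box3] nice_slice_deriv(1)[OF nice_Ds[OF f] in_box3]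
        nice_slice_continuous(1)[OF nice_Ds[OF nice_Ds[OF f]] e t]])
     (use e t nice_zero_at_pi[OF f e t] nice_zero_at_pi[OF nice_Ds[OF f] e t] in auto)

lemma fc2_Dss:
  assumes f: "nice r f" and e: "\<bar>e\<bar> < r"
  shows "fc2 (\<lambda>x. f x - Ds (Ds f) x) e k l = (1 + (of_int k)\<^sup>2) * fc2 f e k l"
proof -
  have "fc2 (\<lambda>x. f x - Ds (Ds f) x) e k l = fc (\<lambda>t. (1 + (of_int k)\<^sup>2) * fc (\<lambda>s. f (s, t, e)) k) l"
    unfolding fc2_def by (rule fc_cong) (rule fc_slice_Dss[OF f e])
  then show ?thesis by (simp add: fc_cmult fc2_def)
qed

lemma fc2_Dtt:
  assumes f: "nice r f" and e: "\<bar>e\<bar> < r"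
  shows "fc2 (\<lambda>x. f x - Dt (Dt f) x) e k l = (1 + (of_int l)\<^sup>2) * fc2 f e k l"
proof -
  have z: "fc (\<lambda>s. g (s, t, e)) k = 0" if "nice r g" "t = pi \<or> t = - pi" for g t
  proof -
    have "fc (\<lambda>s. g (s, t, e)) k = fc (\<lambda>s. 0) k"
      by (rule fc_cong) (use nice_zero_at_pi[OF that(1) e] that(2) in auto)
    then show ?thesis by (simp add: fc_const)
  qed
  have "fc2 (\<lambda>x. f x - Dt (Dt f) x) e k l =
      fc (\<lambda>t. fc (\<lambda>s. f (s, t, e)) k - fc (\<lambda>s. Dt (Dt f) (s, t, e)) k) l"
    unfolding fc2_def
    by (intro fc_cong fc_diff nice_slice_continuous(1)[OF f e] nice_slice_continuous(1)[OF nice_Dt[OF nice_Dt[OF f]] e])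
  also have "\<dots> = (1 + (of_int l)\<^sup>2) * fc (\<lambda>t. fc (\<lambda>s. f (s, t, e)) k) l"
    by (rule fc_second_deriv[OF fc_slice_deriv[OF f e] fc_slice_deriv[OF nice_Dt[OF f] e]
          fc_slice_continuous[OF nice_Dt[OF nice_Dt[OF f]] e]])
       (auto intro!: z f nice_Dt)
  finally show ?thesis by (simp add: fc2_def)
qed

lemma fc2_LL:
  assumes f: "nice r f" and e: "\<bar>e\<bar> < r"
  shows "fc2 (LL f) e k l = of_real (freq_weight k l) * fc2 f e k l"
  unfolding LL_def Let_def
    fc2_Dss[OF nice_diff[OF f nice_Dt[OF nice_Dt[OF f]]] e] fc2_Dtt[OF f e] by simp

lemma fc2_funpow_LL:
  assumes f: "nice r f" and e: "\<bar>e\<bar> < r"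
  shows "fc2 ((LL ^^ m) f) e k l = of_real (freq_weight k l ^ m) * fc2 f e k l"
  by (induction m) (simp_all add: fc2_LL[OF nice_funpow_LL[OF f] e])

lemma freq_weight_pos: "freq_weight k l > 0"
  by (intro mult_pos_pos) (auto intro: add_pos_nonneg)

text \<open>The coefficients of \<open>(LL ^^ m) f\<close> are bounded by its supremum on the period
  square, and they are those of \<open>f\<close> times the \<open>m\<close>-th power of the
  weight.\<close>

lemma fc2_decay:
  assumes f: "nice r f" and e: "\<bar>e\<bar> < r"
  obtains B where "\<And>k l. norm (fc2 f e k l) * freq_weight k l ^ m \<le> B"
proof -
  let ?g = "(LL ^^ m) f"
  note g = nice_funpow_LL[OF f, of m]
  have "bounded ((\<lambda>x. ?g (fst x, snd x, e)) ` ({-pi..pi} \<times> {-pi..pi}))"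
    by (intro compact_imp_bounded compact_continuous_image nice_slice_continuous(3)[OF g e] compact_Times compact_Icc)
  then obtain B where B: "\<forall>x\<in>{-pi..pi} \<times> {-pi..pi}. norm (?g (fst x, snd x, e)) \<le> B"
    by (auto simp: bounded_iff)
  have "norm (fc2 f e k l) * freq_weight k l ^ m \<le> B" for k l
  proof -
    have "norm (fc2 f e k l) * freq_weight k l ^ m = norm (fc2 ?g e k l)"
      unfolding fc2_funpow_LL[OF f e] norm_mult norm_of_real
      using zero_less_power[OF freq_weight_pos[of k l], of m] by simp
    also have "\<dots> \<le> B" by (rule fc2_bound[OF g e]) (use B in auto)
    finally show ?thesis .
  qed
  then show thesis by (rule that)
qed

lemma fc2_weighted_summable:
  assumes f: "nice r f" and e: "\<bar>e\<bar> < r"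
  shows "(\<lambda>(k, l). norm (fc2 f e k l) * freq_weight k l ^ m) summable_on UNIV"
proof -
  \<comment> \<open>One power more than asked for: dividing by the surplus factor produces the
    summable majorant.\<close>
  obtain B where B: "\<And>k l. norm (fc2 f e k l) * freq_weight k l ^ Suc m \<le> B"
    using fc2_decay[OF f e, of "Suc m"] by blast
  show ?thesis
  proof (rule summable_on_comparison_test)
    show "(\<lambda>x. B * (case x of (k, l) \<Rightarrow> 1 / freq_weight k l)) summable_on UNIV"
      by (rule summable_on_cmult_right[OF int_pair_inverse_square_summable])
    fix x :: "int \<times> int"
    obtain k l where x: "x = (k, l)" by (cases x)
    have "norm (fc2 f e k l) * freq_weight k l ^ m = norm (fc2 f e k l) * freq_weight k l ^ Suc m / freq_weight k l"
      unfolding nonzero_eq_divide_eq[OF less_imp_neq[OF freq_weight_pos, symmetric]] power_Suc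
      by (simp only: mult.assoc mult.commute mult.left_commute)
    also have "\<dots> \<le> B / freq_weight k l"
      using B freq_weight_pos[of k l] by (intro divide_right_mono) auto
    finally show "(case x of (k, l) \<Rightarrow> norm (fc2 f e k l) * freq_weight k l ^ m) \<le> B * (case x of (k, l) \<Rightarrow> 1 / freq_weight k l)"
      by (simp add: x)
    show "0 \<le> (case x of (k, l) \<Rightarrow> norm (fc2 f e k l) * freq_weight k l ^ m)"
      using freq_weight_pos[of k l] by (simp add: x)
  qed
qed

text \<open>Summability of the coefficients in \<open>s\<close> alone, at fixed \<open>t\<close>, as
  required by the outer application of \<open>fourier_inversion\<close>.\<close>

lemma fc_slice_summable:
  assumes f: "nice r f" and e: "\<bar>e\<bar> < r" and t: "t \<in> {-pi..pi}"
  shows "(\<lambda>k. norm (fc (\<lambda>s. f (s, t, e)) k)) summable_on UNIV"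
proof -
  have g: "nice r (\<lambda>x. f x - Ds (Ds f) x)" by (intro nice_diff nice_Ds f)
  have "bounded ((\<lambda>s. f (s, t, e) - Ds (Ds f) (s, t, e)) ` {-pi..pi})"
    by (intro compact_imp_bounded compact_continuous_image nice_slice_continuous(1)[OF g e t] compact_Icc)
  then obtain B where B: "\<forall>s\<in>{-pi..pi}. norm (f (s, t, e) - Ds (Ds f) (s, t, e)) \<le> B"
    by (auto simp: bounded_iff)
  show ?thesis
  proof (rule summable_on_comparison_test)
    show "(\<lambda>k::int. B * (1 / (1 + (of_int k)\<^sup>2))) summable_on UNIV"
      by (rule summable_on_cmult_right[OF int_inverse_square_summable])
    fix k :: int
    have pos: "1 + (of_int k :: real)\<^sup>2 > 0" by (intro add_pos_nonneg) auto
    have "norm (fc (\<lambda>s. f (s, t, e) - Ds (Ds f) (s, t, e)) k) \<le> B"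
      by (rule fc_bound[OF nice_slice_continuous(1)[OF g e t]]) (use B in auto)
    moreover have "norm (1 + (of_int k :: complex)\<^sup>2) = 1 + (of_int k :: real)\<^sup>2"
    proof -
      have "1 + (of_int k :: complex)\<^sup>2 = of_real (1 + (of_int k)\<^sup>2)" by simp
      then show ?thesis using pos by (metis abs_of_pos norm_of_real)
    qed
    ultimately show "norm (fc (\<lambda>s. f (s, t, e)) k) \<le> B * (1 / (1 + (of_int k)\<^sup>2))"
      unfolding fc_slice_Dss[OF f e t] norm_mult using pos by (simp add: field_simps)
  qed auto
qed

lemma summable_pair_slice:
  fixes F :: "'a \<Rightarrow> 'b \<Rightarrow> real"
  assumes "(\<lambda>(k, l). F k l) summable_on UNIV"
  shows "(\<lambda>l. F k l) summable_on UNIV"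
proof -
  have "(\<lambda>(k, l). F k l) summable_on (Pair k ` UNIV)"
    by (rule summable_on_subset_banach[OF assms]) auto
  then show ?thesis by (subst (asm) summable_on_reindex) (auto simp: o_def inj_on_def)
qed

text \<open>Absolute summability allows summing first over \<open>l\<close>, then over
  \<open>k\<close>. Inversion in \<open>t\<close> turns the inner sums into the coefficients in
  \<open>s\<close> of the slice at \<open>t\<close>, and inversion in \<open>s\<close> sums these to
  \<open>f\<close>.\<close>

lemma fourier_inversion_2d:
  assumes f: "nice r f" and e: "\<bar>e\<bar> < r" and s: "s \<in> {-pi<..<pi}" and t: "t \<in> {-pi<..<pi}"
  shows "((\<lambda>(k, l). fc2 f e k l * cis (of_int k * s + of_int l * t)) has_sum f (s, t, e)) UNIV"
proof -
  have t': "t \<in> {-pi..pi}" and s': "s \<in> {-pi..pi}" using s t by auto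
  let ?F = "\<lambda>(k, l). fc2 f e k l * cis (of_int k * s + of_int l * t)"
  have sm0: "(\<lambda>(k, l). norm (fc2 f e k l)) summable_on UNIV"
    using fc2_weighted_summable[OF f e, of 0] by simp
  then have "(\<lambda>x. norm (?F x)) summable_on UNIV"
    by (simp add: case_prod_unfold norm_mult)
  then have "(?F has_sum infsum ?F UNIV) (UNIV \<times> UNIV)"
    using abs_summable_summable has_sum_infsum by fastforce
  moreover have inner: "((\<lambda>l. ?F (k, l)) has_sum (fc (\<lambda>s. f (s, t, e)) k * cis (of_int k * s))) UNIV" for k
  proof -
    have "((\<lambda>l. fc (\<lambda>t. fc (\<lambda>s. f (s, t, e)) k) l * cis (of_int l * t)) has_sum (fc (\<lambda>s. f (s, t, e)) k)) UNIV"
    proof (rule fourier_inversion[OF t fc_slice_continuous[OF f e]])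
      have "((\<lambda>t. fc (\<lambda>s. f (s, t, e)) k) has_vector_derivative fc (\<lambda>s. Dt f (s, t, e)) k) (at t within {-pi..pi})"
        by (rule fc_slice_deriv[OF f e t'])
      moreover have "at t within {-pi..pi} = at t"
        using t by (intro at_within_interior) (simp add: interior_atLeastAtMost_real)
      ultimately show "((\<lambda>t. fc (\<lambda>s. f (s, t, e)) k) has_vector_derivative fc (\<lambda>s. Dt f (s, t, e)) k) (at t)"
        by simp
      show "(\<lambda>l. norm (fc (\<lambda>t. fc (\<lambda>s. f (s, t, e)) k) l)) summable_on UNIV"
        using summable_pair_slice[OF sm0] by (simp add: fc2_def)
    qed
    from has_sum_cmult_left[OF this, of "cis (of_int k * s)"]
    show ?thesis by (simp add: fc2_def cis_mult mult.assoc add.commute)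
  qed
  ultimately have "((\<lambda>k. fc (\<lambda>s. f (s, t, e)) k * cis (of_int k * s)) has_sum infsum ?F UNIV) UNIV"
    by (rule has_sum_SigmaD)
  moreover have "((\<lambda>k. fc (\<lambda>s. f (s, t, e)) k * cis (of_int k * s)) has_sum f (s, t, e)) UNIV"
    by (rule fourier_inversion[OF s nice_slice_continuous(1)[OF f e t'] nice_slice_deriv(1)[OF f in_box3[OF s' t' e]]
          fc_slice_summable[OF f e t']])
  ultimately have "infsum ?F UNIV = f (s, t, e)" by (rule has_sum_unique)
  then show ?thesis
    using \<open>(?F has_sum infsum ?F UNIV) (UNIV \<times> UNIV)\<close> by simp
qed

text \<open>\<open>Ds\<close> and \<open>Dt\<close> differentiate along the slice
  \<open>e = 0\<close>, on which \<open>f\<close> is constantly zero.\<close>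

lemma nice_zero_slice:
  assumes f: "nice r f" and z: "\<And>s t. (s, t, 0) \<in> box3 r \<Longrightarrow> f (s, t, 0) = 0" and b: "(s, t, 0) \<in> box3 r"
  shows "Ds f (s, t, 0) = 0" "Dt f (s, t, 0) = 0"
proof -
  have r: "0 < r" and st: "\<bar>s\<bar> < 4" "\<bar>t\<bar> < 4" using b by (auto simp: box3_def)
  have o: "open {-4<..<4::real}" by simp
  have "((\<lambda>s. f (s, t, 0)) has_vector_derivative 0) (at s)"
    by (rule has_vector_derivative_transform_within_open[OF _ o, of "\<lambda>_. 0"])
       (use st r z in \<open>auto simp: box3_def\<close>)
  then show "Ds f (s, t, 0) = 0"
    using vector_derivative_unique_at nice_slice_deriv(1)[OF f b] by metis
  have "((\<lambda>t. f (s, t, 0)) has_vector_derivative 0) (at t)"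
    by (rule has_vector_derivative_transform_within_open[OF _ o, of "\<lambda>_. 0"])
       (use st r z in \<open>auto simp: box3_def\<close>)
  then show "Dt f (s, t, 0) = 0"
    using vector_derivative_unique_at nice_slice_deriv(2)[OF f b] by metis
qed

lemma LL_zero_slice:
  assumes f: "nice r f" and z: "\<And>s t. (s, t, 0) \<in> box3 r \<Longrightarrow> f (s, t, 0) = 0" and b: "(s, t, 0) \<in> box3 r"
  shows "LL f (s, t, 0) = 0"
proof -
  let ?g = "\<lambda>x. f x - Dt (Dt f) x"
  have g: "nice r ?g" by (intro nice_diff nice_Dt f)
  have z1: "Dt f (s, t, 0) = 0" if "(s, t, 0) \<in> box3 r" for s t by (rule nice_zero_slice(2)[OF f z that])
  have z2: "Dt (Dt f) (s, t, 0) = 0" if "(s, t, 0) \<in> box3 r" for s t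
    by (rule nice_zero_slice(2)[OF nice_Dt[OF f] z1 that])
  have zg: "?g (s, t, 0) = 0" if "(s, t, 0) \<in> box3 r" for s t using z z2 that by simp
  have z3: "Ds ?g (s, t, 0) = 0" if "(s, t, 0) \<in> box3 r" for s t by (rule nice_zero_slice(1)[OF g zg that])
  have "Ds (Ds ?g) (s, t, 0) = 0" by (rule nice_zero_slice(1)[OF nice_Ds[OF g] z3 b])
  then show ?thesis using zg[OF b] by (simp add: LL_def Let_def)
qed

text \<open>On the slice \<open>e = 0\<close> also \<open>LL f\<close> vanishes, so uniform
  continuity on a compact box makes it uniformly small for small \<open>e\<close>. Dividing its
  coefficients by \<open>freq_weight\<close> then bounds the whole sum of those of \<open>f\<close>,
  not merely each single one.\<close>

lemma small_fourier_coefficients: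
  assumes f: "nice r f" and r: "r > 0" and z: "\<And>s t. (s, t, 0) \<in> box3 r \<Longrightarrow> f (s, t, 0) = 0" and d: "\<delta> > 0"
  obtains e where "0 < e" "e < r" "(\<Sum>\<^sub>\<infinity>(k, l). norm (fc2 f e k l)) \<le> \<delta>"
proof -
  define Z where "Z = (\<Sum>\<^sub>\<infinity>(k, l). 1 / freq_weight k l)"
  have Z0: "Z \<ge> 0" unfolding Z_def using freq_weight_pos by (intro infsum_nonneg) (auto simp: less_imp_le)
  define \<delta>' where "\<delta>' = \<delta> / (Z + 1)"
  have d': "\<delta>' > 0" using d Z0 by (simp add: \<delta>'_def)
  define K where "K = {-pi..pi} \<times> {-pi..pi} \<times> {-r/2..r/2}"
  have KB: "K \<subseteq> box3 r" using r pi_less_4 by (auto simp: K_def box3_def)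
  have "uniformly_continuous_on K (LL f)"
  proof (rule compact_uniformly_continuous)
    show "continuous_on K (LL f)"
      using nice_continuous[OF nice_LL[OF f] continuous_on_id, of K] KB by simp
    show "compact K" unfolding K_def by (intro compact_Times compact_Icc)
  qed
  then obtain d where dd: "d > 0" "\<And>x y. x \<in> K \<Longrightarrow> y \<in> K \<Longrightarrow> dist y x < d \<Longrightarrow> dist (LL f y) (LL f x) < \<delta>'"
    unfolding uniformly_continuous_on_def using d' by metis
  \<comment> \<open>Half of \<open>d\<close> gives the strict distance bound, half of
    \<open>r\<close> keeps the point in the compact set \<open>K\<close>.\<close>
  define e where "e = min (d / 2) (r / 2)"
  have e: "0 < e" "e < r" "\<bar>e\<bar> < r" "e \<le> r / 2" "e < d" using dd r by (auto simp: e_def)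
  have B: "norm (LL f (s, t, e)) \<le> \<delta>'" if "s \<in> {-pi..pi}" "t \<in> {-pi..pi}" for s t
  proof -
    have "dist (LL f (s, t, e)) (LL f (s, t, 0)) < \<delta>'"
      by (rule dd(2)) (use that e r in \<open>auto simp: K_def dist_Pair_Pair dist_real_def\<close>)
    then show ?thesis
      using LL_zero_slice[OF f z in_box3[OF that]] r by (simp add: less_imp_le)
  qed
  have le: "norm (fc2 f e k l) \<le> \<delta>' * (1 / freq_weight k l)" for k l
  proof -
    have "norm (fc2 (LL f) e k l) \<le> \<delta>'" by (rule fc2_bound[OF nice_LL[OF f] e(3) B])
    then have "freq_weight k l * norm (fc2 f e k l) \<le> \<delta>'"
      unfolding fc2_LL[OF f e(3)] norm_mult norm_of_real using freq_weight_pos[of k l] by simp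
    then show ?thesis using freq_weight_pos[of k l] by (simp add: field_simps)
  qed
  have "(\<Sum>\<^sub>\<infinity>(k, l). norm (fc2 f e k l)) \<le> (\<Sum>\<^sub>\<infinity>(k, l). \<delta>' * (1 / freq_weight k l))"
  proof (rule infsum_mono)
    show "(\<lambda>(k, l). norm (fc2 f e k l)) summable_on UNIV" using fc2_weighted_summable[OF f e(3), of 0] by simp
    show "(\<lambda>(k, l). \<delta>' * (1 / freq_weight k l)) summable_on UNIV"
      using summable_on_cmult_right[OF int_pair_inverse_square_summable, of \<delta>'] by (simp add: case_prod_unfold)
  qed (use le in auto)
  also have "\<dots> = \<delta>' * Z"
    unfolding Z_def infsum_cmult_right'[symmetric] by (simp add: case_prod_unfold)
  also have "\<dots> \<le> \<delta>" using Z0 d by (simp add: \<delta>'_def field_simps)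
  finally show thesis using that e by blast
qed

section \<open>A smooth cutoff function\<close>

text \<open>The classical flat function at 0, with powers of \<open>x\<close> in the denominator:
  the family is closed under differentiation up to linear combinations, so smoothness follows by an
  induction over all \<open>n\<close> at once.\<close>

definition flat_exp :: "nat \<Rightarrow> real \<Rightarrow> real" where
  "flat_exp n x = (if x > 0 then exp (- (1 / x)) / x ^ n else 0)"

lemma flat_exp_tendsto_0: "(flat_exp n \<longlongrightarrow> 0) (at 0)"
  unfolding filterlim_at_split
proof
  show "(flat_exp n \<longlongrightarrow> 0) (at_left 0)"
    by (rule tendsto_eventually) (auto simp: eventually_at_filter flat_exp_def)
  have "((\<lambda>x. inverse x ^ n / exp (inverse x)) \<longlongrightarrow> 0) (at_right (0::real))"
    by (rule filterlim_compose[OF tendsto_power_div_exp_0 filterlim_inverse_at_top_right])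
  then show "(flat_exp n \<longlongrightarrow> 0) (at_right 0)"
    by (rule Lim_transform_eventually)
       (auto simp: eventually_at_filter flat_exp_def exp_minus field_simps power_inverse)
qed

lemma flat_exp_deriv:
  "(flat_exp n has_field_derivative (flat_exp (n + 2) x - real n * flat_exp (n + 1) x)) (at x)"
proof -
  consider "x > 0" | "x < 0" | "x = 0" by linarith
  then show ?thesis
  proof cases
    case 1
    have "((\<lambda>x. exp (- (1 / x)) * inverse (x ^ n)) has_field_derivative
        (exp (- (1 / x)) * (1 / x\<^sup>2) * inverse (x ^ n) + exp (- (1 / x)) * - (real n * x ^ (n - 1) * (inverse (x ^ n))\<^sup>2))) (at x)"
      using 1 by (auto intro!: derivative_eq_intros simp: power2_eq_square)
    moreover have "exp (- (1 / x)) * (1 / x\<^sup>2) * inverse (x ^ n) + exp (- (1 / x)) * - (real n * x ^ (n - 1) * (inverse (x ^ n))\<^sup>2)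
        = flat_exp (n + 2) x - real n * flat_exp (n + 1) x"
      using 1 by (cases n) (auto simp: flat_exp_def field_simps power2_eq_square)
    moreover have "\<forall>\<^sub>F y in nhds x. flat_exp n y = exp (- (1 / y)) * inverse (y ^ n)"
      using eventually_nhds_in_open[of "{0<..}" x] 1
      by (auto simp: flat_exp_def divide_inverse elim: eventually_mono)
    ultimately show ?thesis by (simp add: DERIV_cong_ev)
  next
    case 2
    have ev: "\<forall>\<^sub>F y in nhds x. flat_exp n y = 0"
      using eventually_nhds_in_open[of "{..<0}" x] 2 by (auto simp: flat_exp_def elim: eventually_mono)
    have "(flat_exp n has_field_derivative 0) (at x)"
      by (rule DERIV_cong_ev[THEN iffD2, OF refl ev refl]) simp
    then show ?thesis using 2 by (simp add: flat_exp_def)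
  next
    case 3
    \<comment> \<open>At 0 the difference quotient of \<open>flat_exp n\<close> is
      \<open>flat_exp (Suc n)\<close>, whose limit is already known.\<close>
    have "((\<lambda>h. (flat_exp n (0 + h) - flat_exp n 0) / h) \<longlongrightarrow> 0) (at 0)"
      by (rule Lim_transform_eventually[OF flat_exp_tendsto_0[of "Suc n"]])
         (auto simp: eventually_at_filter flat_exp_def)
    then show ?thesis using 3 by (simp add: DERIV_def flat_exp_def)
  qed
qed

lemma smooth_flat_exp: "smooth_on UNIV (flat_exp n)"
proof -
  have "Ck_on k UNIV (flat_exp n)" for k
  proof (induction k arbitrary: n)
    case 0
    show ?case using DERIV_isCont[OF flat_exp_deriv] by (auto simp: continuous_on_eq_continuous_at)
  next
    case (Suc k)
    have "Ck_on k UNIV (\<lambda>x. flat_exp (n + 2) x + (- real n) * flat_exp (n + 1) x)"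
      by (intro Ck_on_add Ck_on_bilinear[OF bounded_bilinear_mult] Ck_on_const Suc open_UNIV)
    then show ?case using Ck_on_real_SucI[OF open_UNIV, of "flat_exp n", OF flat_exp_deriv] by simp
  qed
  then show ?thesis by (simp add: smooth_on_def)
qed

text \<open>A bump equal to 1 on \<open>[-1, 1]\<close> and to 0 outside \<open>(-2, 2)\<close>. The
  denominator is positive because \<open>4 - s^2\<close> and \<open>s^2 - 1\<close> add up to 3 and
  so are never both nonpositive.\<close>

definition cutoff :: "real \<Rightarrow> real" where
  "cutoff s = flat_exp 0 (4 - s\<^sup>2) / (flat_exp 0 (4 - s\<^sup>2) + flat_exp 0 (s\<^sup>2 - 1))"

lemma cutoff_denom: "flat_exp 0 (4 - s\<^sup>2) + flat_exp 0 (s\<^sup>2 - 1) > 0"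
  by (auto simp: flat_exp_def add_pos_pos)

lemma cutoff_eq_1: "\<bar>s\<bar> \<le> 1 \<Longrightarrow> cutoff s = 1"
  using cutoff_denom[of s] abs_square_le_1[of s] by (auto simp: cutoff_def flat_exp_def)

lemma cutoff_eq_0: "\<bar>s\<bar> \<ge> 2 \<Longrightarrow> cutoff s = 0"
  using abs_le_square_iff[of 2 s] by (auto simp: cutoff_def flat_exp_def)

lemma smooth_cutoff: "smooth_on UNIV cutoff"
proof -
  have "smooth_on UNIV (\<lambda>s. flat_exp 0 (4 - s\<^sup>2))" "smooth_on UNIV (\<lambda>s. flat_exp 0 (s\<^sup>2 - 1))"
    unfolding power2_eq_square
    by (rule smooth_on_compose[OF open_UNIV open_UNIV subset_UNIV smooth_flat_exp];
        intro smooth_on_diff smooth_on_const smooth_on_mult smooth_on_ident open_UNIV)+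
  then have "smooth_on UNIV (\<lambda>s. flat_exp 0 (4 - s\<^sup>2) / (flat_exp 0 (4 - s\<^sup>2) + flat_exp 0 (s\<^sup>2 - 1)))"
    by (intro smooth_on_divide smooth_on_add open_UNIV) (use cutoff_denom in \<open>auto simp: less_imp_neq[symmetric]\<close>)
  then show ?thesis by (simp add: cutoff_def[abs_def])
qed

section \<open>Exponential sums and the Beltrami equation\<close>

text \<open>The index type is arbitrary and \<open>\<kappa>\<close> may repeat frequencies: the
  solution of the Beltrami equation is indexed by lists, many of which share their total
  frequency.\<close>

definition expsum :: "('i \<Rightarrow> complex) \<Rightarrow> ('i \<Rightarrow> 'a::euclidean_space) \<Rightarrow> 'a \<Rightarrow> complex" where
  "expsum c \<kappa> x = (\<Sum>\<^sub>\<infinity>i. c i * cis (\<kappa> i \<bullet> x))"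

definition rapid :: "('i \<Rightarrow> complex) \<Rightarrow> ('i \<Rightarrow> 'a::euclidean_space) \<Rightarrow> bool" where
  "rapid c \<kappa> \<longleftrightarrow> (\<forall>m. (\<lambda>i. norm (c i) * (1 + norm (\<kappa> i)) ^ m) summable_on UNIV)"

lemma rapid_norm_summable: "rapid c \<kappa> \<Longrightarrow> (\<lambda>i. norm (c i)) summable_on UNIV"
  unfolding rapid_def by (drule spec[of _ 0]) simp

lemma rapid_expsum_has_sum:
  assumes "rapid c \<kappa>"
  shows "((\<lambda>i. c i * cis (\<kappa> i \<bullet> x)) has_sum expsum c \<kappa> x) UNIV"
  unfolding expsum_def
  by (rule has_sum_infsum[OF abs_summable_summable])
     (use rapid_norm_summable[OF assms] in \<open>simp add: norm_mult\<close>)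

text \<open>Differentiation multiplies a coefficient by at most
  \<open>norm v * norm (\<kappa> i)\<close>, which costs one power of the weight.\<close>

lemma rapid_directional:
  assumes "rapid c \<kappa>"
  shows "rapid (\<lambda>i. \<i> * of_real (\<kappa> i \<bullet> v) * c i) \<kappa>"
  unfolding rapid_def
proof
  fix m
  have "(\<lambda>i. norm v * (norm (c i) * (1 + norm (\<kappa> i)) ^ Suc m)) summable_on UNIV"
    using assms unfolding rapid_def by (intro summable_on_cmult_right) blast
  then show "(\<lambda>i. norm (\<i> * of_real (\<kappa> i \<bullet> v) * c i) * (1 + norm (\<kappa> i)) ^ m) summable_on UNIV"
  proof (rule summable_on_comparison_test)
    fix i
    have "norm (\<i> * of_real (\<kappa> i \<bullet> v) * c i) * (1 + norm (\<kappa> i)) ^ m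
        = \<bar>\<kappa> i \<bullet> v\<bar> * (norm (c i) * (1 + norm (\<kappa> i)) ^ m)"
      by (simp add: norm_mult)
    also have "\<dots> \<le> (norm v * (1 + norm (\<kappa> i))) * (norm (c i) * (1 + norm (\<kappa> i)) ^ m)"
    proof (rule mult_right_mono)
      have "\<bar>\<kappa> i \<bullet> v\<bar> \<le> norm (\<kappa> i) * norm v" by (rule Cauchy_Schwarz_ineq2)
      also have "\<dots> \<le> norm v * (1 + norm (\<kappa> i))" by (simp add: algebra_simps)
      finally show "\<bar>\<kappa> i \<bullet> v\<bar> \<le> norm v * (1 + norm (\<kappa> i))" .
    qed auto
    finally show "norm (\<i> * of_real (\<kappa> i \<bullet> v) * c i) * (1 + norm (\<kappa> i)) ^ m
        \<le> norm v * (norm (c i) * (1 + norm (\<kappa> i)) ^ Suc m)" by (simp add: mult_ac)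
  qed auto
qed

text \<open>The constant of the quadratic remainder does not depend on \<open>a\<close>, which makes
  termwise differentiation uniform in the index.\<close>

lemma cis_quadratic_approximation: "norm (cis (a + h) - cis a - \<i> * of_real h * cis a) \<le> h\<^sup>2"
proof -
  have "norm (exp (\<i> * of_real h) - (\<Sum>k\<le>1. (\<i> * of_real h) ^ k / fact k)) \<le>
      exp \<bar>Re (\<i> * of_real h)\<bar> * norm (\<i> * of_real h) ^ Suc 1 / fact 1"
    by (rule Taylor_exp)
  then have "norm (cis h - 1 - \<i> * of_real h) \<le> h\<^sup>2"
    by (simp add: cis_conv_exp norm_mult power2_eq_square diff_diff_eq)
  moreover have "cis (a + h) - cis a - \<i> * of_real h * cis a = cis a * (cis h - 1 - \<i> * of_real h)"
    by (simp add: cis_mult[symmetric] algebra_simps)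
  ultimately show ?thesis by (simp add: norm_mult)
qed

lemma has_sum_subtract:
  fixes f g :: "'i \<Rightarrow> 'b::real_normed_vector"
  assumes f: "(f has_sum a) A" and g: "(g has_sum b) A"
  shows "((\<lambda>i. f i - g i) has_sum (a - b)) A"
proof -
  have "((\<lambda>i. - g i) has_sum - b) A" using g by (simp add: has_sum_uminus)
  from has_sum_add[OF f this] show ?thesis by simp
qed

text \<open>The remainders of the single exponentials add up to at most \<open>K\<close> times the
  squared distance, where \<open>K\<close> is the coefficient sum with the second power of the
  weight. The sum \<open>K1\<close> with the first power bounds the candidate derivative.\<close>

lemma expsum_has_derivative:
  assumes r: "rapid c \<kappa>"
  shows "(expsum c \<kappa> has_derivative (\<lambda>v. expsum (\<lambda>i. \<i> * of_real (\<kappa> i \<bullet> v) * c i) \<kappa> x)) (at x)"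
proof -
  let ?D = "\<lambda>v. expsum (\<lambda>i. \<i> * of_real (\<kappa> i \<bullet> v) * c i) \<kappa> x"
  note hs = rapid_expsum_has_sum[OF rapid_directional[OF r], of _ x]
  define K1 where "K1 = (\<Sum>\<^sub>\<infinity>i. norm (c i) * (1 + norm (\<kappa> i)) ^ 1)"
  define K where "K = (\<Sum>\<^sub>\<infinity>i. norm (c i) * (1 + norm (\<kappa> i)) ^ 2)"
  have s: "((\<lambda>i. norm (c i) * (1 + norm (\<kappa> i)) ^ m) has_sum (\<Sum>\<^sub>\<infinity>i. norm (c i) * (1 + norm (\<kappa> i)) ^ m)) UNIV" for m
    using r unfolding rapid_def by (intro has_sum_infsum) blast
  have bl: "bounded_linear ?D"
  proof (rule bounded_linear_intro)
    fix u v
    have "((\<lambda>i. \<i> * of_real (\<kappa> i \<bullet> u) * c i * cis (\<kappa> i \<bullet> x) + \<i> * of_real (\<kappa> i \<bullet> v) * c i * cis (\<kappa> i \<bullet> x))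
        has_sum (?D u + ?D v)) UNIV"
      by (rule has_sum_add[OF hs hs])
    then have "((\<lambda>i. \<i> * of_real (\<kappa> i \<bullet> (u + v)) * c i * cis (\<kappa> i \<bullet> x)) has_sum (?D u + ?D v)) UNIV"
      by (simp add: inner_add_right algebra_simps)
    then show "?D (u + v) = ?D u + ?D v" by (rule has_sum_unique[OF hs])
    fix a :: real
    have "((\<lambda>i. of_real a * (\<i> * of_real (\<kappa> i \<bullet> u) * c i * cis (\<kappa> i \<bullet> x))) has_sum (of_real a * ?D u)) UNIV"
      by (rule has_sum_cmult_right[OF hs])
    then have "((\<lambda>i. \<i> * of_real (\<kappa> i \<bullet> (a *\<^sub>R u)) * c i * cis (\<kappa> i \<bullet> x)) has_sum (a *\<^sub>R ?D u)) UNIV"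
      by (simp add: scaleR_conv_of_real mult_ac)
    then show "?D (a *\<^sub>R u) = a *\<^sub>R ?D u" by (rule has_sum_unique[OF hs])
    have "norm (?D u) \<le> norm u * K1"
    proof (rule norm_infsum_le[OF hs has_sum_cmult_right[OF s[of 1, folded K1_def]]])
      fix i
      have "\<bar>\<kappa> i \<bullet> u\<bar> \<le> norm (\<kappa> i) * norm u" by (rule Cauchy_Schwarz_ineq2)
      also have "\<dots> \<le> norm u * (1 + norm (\<kappa> i))" by (simp add: algebra_simps)
      finally have "\<bar>\<kappa> i \<bullet> u\<bar> * norm (c i) \<le> norm u * (1 + norm (\<kappa> i)) * norm (c i)"
        by (rule mult_right_mono) simp
      then show "norm (\<i> * of_real (\<kappa> i \<bullet> u) * c i * cis (\<kappa> i \<bullet> x)) \<le> norm u * (norm (c i) * (1 + norm (\<kappa> i)) ^ 1)"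
        by (simp add: norm_mult mult_ac)
    qed
    then show "norm (?D u) \<le> norm u * K1" .
  qed
  show ?thesis
  proof (rule has_derivativeI_sandwich[where e = 1 and H = "\<lambda>y. K * norm (y - x)"])
    show "bounded_linear ?D" by (rule bl)
    have "((\<lambda>y. K * norm (y - x)) \<longlongrightarrow> K * norm (x - x)) (at x)" by (intro tendsto_intros)
    then show "((\<lambda>y. K * norm (y - x)) \<longlongrightarrow> 0) (at x)" by simp
    fix y assume "y \<noteq> x"
    have "((\<lambda>i. c i * cis (\<kappa> i \<bullet> y) - c i * cis (\<kappa> i \<bullet> x) - \<i> * of_real (\<kappa> i \<bullet> (y - x)) * c i * cis (\<kappa> i \<bullet> x))
        has_sum (expsum c \<kappa> y - expsum c \<kappa> x - ?D (y - x))) UNIV"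
      by (intro has_sum_subtract rapid_expsum_has_sum[OF r] hs)
    moreover have "((\<lambda>i. (norm (y - x))\<^sup>2 * (norm (c i) * (1 + norm (\<kappa> i)) ^ 2)) has_sum ((norm (y - x))\<^sup>2 * K)) UNIV"
      by (rule has_sum_cmult_right[OF s[of 2, folded K_def]])
    ultimately have "norm (expsum c \<kappa> y - expsum c \<kappa> x - ?D (y - x)) \<le> (norm (y - x))\<^sup>2 * K"
    proof (rule norm_infsum_le)
      fix i
      have "\<bar>\<kappa> i \<bullet> (y - x)\<bar> \<le> norm (\<kappa> i) * norm (y - x)" by (rule Cauchy_Schwarz_ineq2)
      also have "\<dots> \<le> (1 + norm (\<kappa> i)) * norm (y - x)" by (simp add: algebra_simps)
      finally have "(\<kappa> i \<bullet> (y - x))\<^sup>2 \<le> ((1 + norm (\<kappa> i)) * norm (y - x))\<^sup>2" by (rule power2_le_iff_abs_le[THEN iffD2, rotated]) simp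
      then have le: "norm (cis (\<kappa> i \<bullet> x + \<kappa> i \<bullet> (y - x)) - cis (\<kappa> i \<bullet> x) - \<i> * of_real (\<kappa> i \<bullet> (y - x)) * cis (\<kappa> i \<bullet> x))
          \<le> ((1 + norm (\<kappa> i)) * norm (y - x))\<^sup>2"
        by (rule order_trans[OF cis_quadratic_approximation])
      have "c i * cis (\<kappa> i \<bullet> y) - c i * cis (\<kappa> i \<bullet> x) - \<i> * of_real (\<kappa> i \<bullet> (y - x)) * c i * cis (\<kappa> i \<bullet> x)
         = c i * (cis (\<kappa> i \<bullet> x + \<kappa> i \<bullet> (y - x)) - cis (\<kappa> i \<bullet> x) - \<i> * of_real (\<kappa> i \<bullet> (y - x)) * cis (\<kappa> i \<bullet> x))"
        by (simp add: inner_diff_right algebra_simps)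
      then show "norm (c i * cis (\<kappa> i \<bullet> y) - c i * cis (\<kappa> i \<bullet> x) - \<i> * of_real (\<kappa> i \<bullet> (y - x)) * c i * cis (\<kappa> i \<bullet> x))
          \<le> (norm (y - x))\<^sup>2 * (norm (c i) * (1 + norm (\<kappa> i)) ^ 2)"
        using mult_left_mono[OF le norm_ge_zero[of "c i"]] by (simp add: norm_mult power_mult_distrib mult_ac)
    qed
    then show "norm (expsum c \<kappa> y - expsum c \<kappa> x - ?D (y - x)) / norm (y - x) \<le> K * norm (y - x)"
      using \<open>y \<noteq> x\<close> by (simp add: field_simps power2_eq_square)
  qed auto
qed

lemma smooth_expsum:
  assumes "rapid c \<kappa>"
  shows "smooth_on UNIV (expsum c \<kappa>)"
proof -
  have "Ck_on k UNIV (expsum c \<kappa>)" if "rapid c \<kappa>" for k c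
    using that
  proof (induction k arbitrary: c)
    case 0
    then show ?case
      using has_derivative_continuous[OF expsum_has_derivative[OF 0]] by (auto simp: continuous_on_eq_continuous_at)
  next
    case (Suc k)
    show ?case
      by (rule Ck_on_SucI[OF open_UNIV expsum_has_derivative[OF Suc.prems]])
         (rule Suc.IH[OF rapid_directional[OF Suc.prems]])
  qed
  then show ?thesis using assms by (simp add: smooth_on_def)
qed

section \<open>Products of absolutely convergent sums, and sums over lists\<close>

lemma summable_on_product:
  fixes F :: "'a \<Rightarrow> real" and G :: "'b \<Rightarrow> real"
  assumes F: "F summable_on UNIV" "\<And>x. F x \<ge> 0" and G: "G summable_on UNIV" "\<And>y. G y \<ge> 0"
  shows "(\<lambda>i. F (fst i) * G (snd i)) summable_on UNIV"
proof -
  have "(\<lambda>i. norm (F (fst i) * G (snd i))) summable_on UNIV \<times> UNIV"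
    unfolding Infinite_Sum.abs_summable_on_Sigma_iff
  proof (intro conjI ballI)
    show "(\<lambda>y. norm (F (fst (x, y)) * G (snd (x, y)))) summable_on UNIV" for x
      using summable_on_cmult_right[OF G(1), of "F x"] F G by simp
    have "(\<Sum>\<^sub>\<infinity>y. norm (F (fst (x, y)) * G (snd (x, y)))) = F x * (\<Sum>\<^sub>\<infinity>y. G y)" for x
      using infsum_cmult_right'[of "F x" G UNIV] F G by (simp add: abs_mult)
    moreover have "(\<Sum>\<^sub>\<infinity>y. G y) \<ge> 0" using G by (simp add: infsum_nonneg)
    ultimately show "(\<lambda>x. norm (\<Sum>\<^sub>\<infinity>y. norm (F (fst (x, y)) * G (snd (x, y))))) summable_on UNIV"
      using summable_on_cmult_left[OF F(1)] F by (simp add: abs_mult)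
  qed
  then show ?thesis using F G by simp
qed

lemma has_sum_product_complex:
  fixes f :: "'a \<Rightarrow> complex" and g :: "'b \<Rightarrow> complex"
  assumes f: "(f has_sum a) UNIV" "(\<lambda>x. norm (f x)) summable_on UNIV"
    and g: "(g has_sum b) UNIV" "(\<lambda>x. norm (g x)) summable_on UNIV"
  shows "((\<lambda>i. f (fst i) * g (snd i)) has_sum (a * b)) UNIV"
proof -
  have "(\<lambda>i. norm (f (fst i) * g (snd i))) summable_on UNIV"
    using summable_on_product[OF f(2) _ g(2)] by (simp add: norm_mult)
  then have s: "(\<lambda>i. f (fst i) * g (snd i)) summable_on UNIV \<times> UNIV"
    using abs_summable_summable[of "\<lambda>i. f (fst i) * g (snd i)" UNIV] by simp
  have "((\<lambda>i. f (fst i) * g (snd i)) has_sum (a * b)) (UNIV \<times> UNIV)"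
  proof (rule has_sum_SigmaI[OF _ _ s])
    show "((\<lambda>y. f (fst (x, y)) * g (snd (x, y))) has_sum f x * b) UNIV" for x
      using has_sum_cmult_right[OF g(1), of "f x"] by simp
    show "((\<lambda>x. f x * b) has_sum a * b) UNIV" by (rule has_sum_cmult_left[OF f(1)])
  qed
  then show ?thesis by simp
qed

lemma has_sum_remove:
  fixes f :: "'i \<Rightarrow> 'b::real_normed_vector"
  assumes "(f has_sum S) UNIV"
  shows "(f has_sum (S - f x)) (- {x})"
proof -
  have "(f has_sum (S - f x)) (UNIV - {x})"
    by (rule has_sum_Diff[OF assms]) (auto intro: has_sum_finiteI)
  then show ?thesis by (simp add: Compl_eq_Diff_UNIV)
qed

text \<open>Sums over the lists of at most \<open>n\<close> letters from a finite alphabet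
  \<open>B\<close> satisfy \<open>S (n + 1) = 1 + sum b B * S n\<close>, so they stay below the
  geometric series \<open>1 / (1 - q)\<close>. Every finite set of lists is contained in such a
  set.\<close>

lemma prod_list_sum_bound:
  fixes b :: "'i \<Rightarrow> real"
  assumes b: "\<And>x. b x \<ge> 0" and q: "(b has_sum q) UNIV" "q < 1" and F: "finite F"
  shows "(\<Sum>L\<in>F. prod_list (map b L)) \<le> 1 / (1 - q)"
proof -
  have q0: "q \<ge> 0" using has_sum_nonneg[OF q(1)] b by simp
  have pos: "prod_list (map b L) \<ge> 0" for L using b by (induction L) auto
  define B where "B = (\<Union>L\<in>F. set L)"
  define W where "W n = {L. set L \<subseteq> B \<and> length L \<le> n}" for n
  have fB: "finite B" using F by (auto simp: B_def)
  have fW: "finite (W n)" for n unfolding W_def by (rule finite_lists_length_le[OF fB])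
  have W: "(\<Sum>L\<in>W n. prod_list (map b L)) \<le> 1 / (1 - q)" for n
  proof (induction n)
    case 0
    have "W 0 = {[]}" by (auto simp: W_def)
    then show ?case using q q0 by simp
  next
    case (Suc n)
    have "W (Suc n) = insert [] ((\<lambda>(x, L). x # L) ` (B \<times> W n))"
    proof (intro set_eqI iffI)
      fix L assume "L \<in> W (Suc n)"
      then show "L \<in> insert [] ((\<lambda>(x, L). x # L) ` (B \<times> W n))"
        by (cases L) (auto simp: W_def)
    qed (auto simp: W_def)
    then have "(\<Sum>L\<in>W (Suc n). prod_list (map b L)) = (\<Sum>L\<in>insert [] ((\<lambda>(x, L). x # L) ` (B \<times> W n)). prod_list (map b L))"
      by simp
    also have "\<dots> = 1 + (\<Sum>L\<in>(\<lambda>(x, L). x # L) ` (B \<times> W n). prod_list (map b L))"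
      using fB fW by (subst sum.insert) auto
    also have "(\<Sum>L\<in>(\<lambda>(x, L). x # L) ` (B \<times> W n). prod_list (map b L)) = (\<Sum>(x, L)\<in>B \<times> W n. b x * prod_list (map b L))"
      by (subst sum.reindex) (auto simp: inj_on_def case_prod_unfold)
    also have "\<dots> = sum b B * (\<Sum>L\<in>W n. prod_list (map b L))"
      by (simp add: sum_product sum.cartesian_product)
    also have "\<dots> \<le> q * (1 / (1 - q))"
    proof (rule mult_mono)
      show "sum b B \<le> q" using finite_sum_le_has_sum[OF q(1) fB] b by simp
    qed (use Suc q0 pos in \<open>auto intro: sum_nonneg\<close>)
    finally have "(\<Sum>L\<in>W (Suc n). prod_list (map b L)) \<le> 1 + q * (1 / (1 - q))" by simp
    also have "\<dots> = 1 / (1 - q)" using q by (simp add: field_simps)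
    finally show ?case .
  qed
  obtain n where n: "\<forall>L\<in>F. length L \<le> n"
    using bdd_above_finite[OF finite_imageI[OF F, of length]] by (auto simp: bdd_above_def)
  have "(\<Sum>L\<in>F. prod_list (map b L)) \<le> (\<Sum>L\<in>W n. prod_list (map b L))"
    by (rule sum_mono2[OF fW]) (use n pos in \<open>auto simp: W_def B_def\<close>)
  then show ?thesis using W[of n] by linarith
qed

lemma prod_list_summable:
  fixes b :: "'i \<Rightarrow> real"
  assumes b: "\<And>x. b x \<ge> 0" and q: "(b has_sum q) UNIV" "q < 1"
  shows "(\<lambda>L. prod_list (map b L)) summable_on UNIV" "(\<Sum>\<^sub>\<infinity>L. prod_list (map b L)) \<le> 1 / (1 - q)"
proof -
  have pos: "prod_list (map b L) \<ge> 0" for L using b by (induction L) auto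
  show s: "(\<lambda>L. prod_list (map b L)) summable_on UNIV"
    by (rule nonneg_bdd_above_summable_on) (use pos prod_list_sum_bound[OF b q] in \<open>auto intro!: bdd_aboveI2\<close>)
  show "(\<Sum>\<^sub>\<infinity>L. prod_list (map b L)) \<le> 1 / (1 - q)"
    by (rule infsum_le_finite_sums[OF s]) (rule prod_list_sum_bound[OF b q])
qed

text \<open>The terms of the Neumann series of the operator that multiplies by the function with Fourier
  coefficients \<open>a\<close> and then applies the Fourier multiplier \<open>m\<close> are indexed by lists of frequencies.\<close>

fun lcoef :: "('i::monoid_add \<Rightarrow> complex) \<Rightarrow> ('i \<Rightarrow> complex) \<Rightarrow> 'i list \<Rightarrow> complex" where
  "lcoef a m [] = 1"
| "lcoef a m (l # L) = a l * m (l + sum_list L) * lcoef a m L"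

text \<open>A submultiplicative weight of the total frequency can be distributed over the letters of
  the list, so the coefficient is dominated by one factor per letter; the multiplier costs a factor
  \<open>M\<close> each time.\<close>

lemma lcoef_bound:
  fixes \<omega> :: "'i::monoid_add \<Rightarrow> real"
  assumes m: "\<And>x. norm (m x) \<le> M" and w: "\<And>x. \<omega> x \<ge> 0" "\<omega> 0 \<le> 1" "\<And>x y. \<omega> (x + y) \<le> \<omega> x * \<omega> y"
    and b: "\<And>x. M * norm (a x) * \<omega> x \<le> b x"
  shows "norm (lcoef a m L) * \<omega> (sum_list L) \<le> prod_list (map b L)"
proof (induction L)
  case Nil
  then show ?case using w by simp
next
  case (Cons l L)
  have M0: "M \<ge> 0" using order_trans[OF norm_ge_zero m] by blast
  have "norm (lcoef a m (l # L)) * \<omega> (sum_list (l # L)) =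
      norm (m (l + sum_list L)) * (norm (a l) * (norm (lcoef a m L) * \<omega> (l + sum_list L)))"
    by (simp add: norm_mult mult_ac)
  also have "\<dots> \<le> M * (norm (a l) * (norm (lcoef a m L) * (\<omega> l * \<omega> (sum_list L))))"
    by (intro mult_mono m mult_left_mono w) (use M0 w in auto)
  also have "\<dots> = (M * norm (a l) * \<omega> l) * (norm (lcoef a m L) * \<omega> (sum_list L))" by (simp add: mult_ac)
  also have "\<dots> \<le> b l * prod_list (map b L)"
    using M0 w b[of l] by (intro mult_mono Cons b) (auto intro: order_trans[OF _ b])
  finally show ?case by simp
qed

definition fsize :: "int \<times> int \<Rightarrow> real" where
  "fsize x = \<bar>of_int (fst x)\<bar> + \<bar>of_int (snd x)\<bar>"

lemma fsize_nonneg: "fsize x \<ge> 0" and fsize_add: "fsize (x + y) \<le> fsize x + fsize y" and fsize_0: "fsize 0 = 0"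
  unfolding fsize_def by auto

text \<open>As a function of \<open>\<delta>\<close> the left side is convex, and the right side is
  its chord over \<open>[0, 1]\<close>.\<close>

lemma power_convex_bound:
  fixes \<delta> p :: real
  assumes "0 \<le> \<delta>" "\<delta> \<le> 1" "p \<ge> 0"
  shows "(1 + \<delta> * p) ^ s \<le> 1 + \<delta> * ((1 + p) ^ s - 1)"
proof (induction s)
  case (Suc s)
  define X where "X = (1 + p) ^ s"
  have "(1 + \<delta> * p) ^ Suc s \<le> (1 + \<delta> * p) * (1 + \<delta> * (X - 1))"
    using Suc assms by (simp add: X_def mult_left_mono)
  also have "\<dots> = 1 + \<delta> * ((1 + p) * X - 1) - \<delta> * p * (1 - \<delta>) * (X - 1)"
    by (simp add: algebra_simps)
  also have "\<dots> \<le> 1 + \<delta> * ((1 + p) * X - 1)"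
    using assms by (simp add: X_def)
  finally show ?case by (simp add: X_def)
qed simp

text \<open>Only the unweighted sum is assumed small, while smoothness needs every power
  \<open>s\<close> of the weight. Shrinking the weight to
  \<open>(1 + \<delta> * fsize x) ^ s\<close> adds at most
  \<open>\<delta> * M * A \<le> 1 / 4\<close> to the sum over the letters, which stays below 1. The
  original weight exceeds the shrunk one by at most the factor
  \<open>1 / \<delta> ^ s\<close>.\<close>

lemma lcoef_weighted_summable:
  assumes a: "\<And>s. (\<lambda>x. norm (a x) * (1 + fsize x) ^ s) summable_on UNIV"
    and m: "\<And>x. norm (m x) \<le> M" and q: "M * (\<Sum>\<^sub>\<infinity>x. norm (a x)) \<le> 1 / 4"
  shows "(\<lambda>L. norm (lcoef a m L) * (1 + fsize (sum_list L)) ^ s) summable_on UNIV"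
proof -
  have M0: "M \<ge> 0" using order_trans[OF norm_ge_zero m] by blast
  define A where "A = (\<Sum>\<^sub>\<infinity>x. norm (a x) * (1 + fsize x) ^ s)"
  have A0: "A \<ge> 0" unfolding A_def by (intro infsum_nonneg) (auto simp: fsize_nonneg)
  define \<delta> where "\<delta> = min 1 (1 / (4 * (M * A + 1)))"
  have MA: "M * A + 1 > 0" using M0 A0 by (simp add: add_nonneg_pos)
  have d: "0 < \<delta>" "\<delta> \<le> 1" "\<delta> * (M * A) \<le> 1 / 4"
  proof -
    show "0 < \<delta>" "\<delta> \<le> 1" using MA by (auto simp: \<delta>_def)
    have "\<delta> * (M * A) \<le> 1 / (4 * (M * A + 1)) * (M * A)"
      using M0 A0 by (intro mult_right_mono) (auto simp: \<delta>_def)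
    also have "\<dots> \<le> 1 / 4" using MA M0 A0 by (simp add: field_simps)
    finally show "\<delta> * (M * A) \<le> 1 / 4" .
  qed
  define b where "b x = M * norm (a x) + \<delta> * M * (norm (a x) * (1 + fsize x) ^ s)" for x
  have "(b has_sum (M * (\<Sum>\<^sub>\<infinity>x. norm (a x)) + \<delta> * M * A)) UNIV"
    unfolding b_def A_def
    by (intro has_sum_add has_sum_cmult_right has_sum_infsum a) (use a[of 0] in simp)
  moreover have "M * (\<Sum>\<^sub>\<infinity>x. norm (a x)) + \<delta> * M * A < 1" using q d by (simp add: mult.assoc)
  moreover have b0: "b x \<ge> 0" for x using M0 d fsize_nonneg[of x] by (simp add: b_def)
  ultimately have P: "(\<lambda>L. prod_list (map b L)) summable_on UNIV" using prod_list_summable(1) by blast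
  have le: "norm (lcoef a m L) * (1 + \<delta> * fsize (sum_list L)) ^ s \<le> prod_list (map b L)" for L
  proof (rule lcoef_bound[OF m, where \<omega> = "\<lambda>x. (1 + \<delta> * fsize x) ^ s"])
    fix x y :: "int \<times> int"
    have n: "0 \<le> \<delta> * fsize x" for x using d fsize_nonneg[of x] by simp
    show "0 \<le> (1 + \<delta> * fsize x) ^ s" using n[of x] by simp
    show "(1 + \<delta> * fsize 0) ^ s \<le> 1" by (simp add: fsize_0)
    have "1 + \<delta> * fsize (x + y) \<le> 1 + \<delta> * (fsize x + fsize y)"
      using d fsize_add[of x y] by (simp add: mult_left_mono)
    also have "\<dots> \<le> (1 + \<delta> * fsize x) * (1 + \<delta> * fsize y)"
      using mult_nonneg_nonneg[OF n n, of x y] by (simp add: algebra_simps)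
    finally show "(1 + \<delta> * fsize (x + y)) ^ s \<le> (1 + \<delta> * fsize x) ^ s * (1 + \<delta> * fsize y) ^ s"
      unfolding power_mult_distrib[symmetric] using n[of "x + y"] by (intro power_mono) auto
    have "(1 + \<delta> * fsize x) ^ s \<le> 1 + \<delta> * ((1 + fsize x) ^ s - 1)"
      by (rule power_convex_bound) (use d fsize_nonneg in auto)
    also have "\<dots> \<le> 1 + \<delta> * (1 + fsize x) ^ s" using d by (simp add: algebra_simps)
    finally have "M * norm (a x) * (1 + \<delta> * fsize x) ^ s \<le> M * norm (a x) * (1 + \<delta> * (1 + fsize x) ^ s)"
      using M0 by (intro mult_left_mono) auto
    then show "M * norm (a x) * (1 + \<delta> * fsize x) ^ s \<le> b x" by (simp add: b_def algebra_simps)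
  qed
  have "(\<lambda>L. (1 / \<delta> ^ s) * prod_list (map b L)) summable_on UNIV" by (rule summable_on_cmult_right[OF P])
  then show ?thesis
  proof (rule summable_on_comparison_test)
    fix L
    let ?p = "fsize (sum_list L)"
    have "1 + ?p \<le> (1 + \<delta> * ?p) / \<delta>" using d by (simp add: field_simps)
    then have "(1 + ?p) ^ s \<le> ((1 + \<delta> * ?p) / \<delta>) ^ s" by (intro power_mono) (auto simp: fsize_nonneg)
    then have "norm (lcoef a m L) * (1 + ?p) ^ s \<le> norm (lcoef a m L) * ((1 + \<delta> * ?p) / \<delta>) ^ s"
      by (intro mult_left_mono) auto
    also have "\<dots> = (1 / \<delta> ^ s) * (norm (lcoef a m L) * (1 + \<delta> * ?p) ^ s)" by (simp add: power_divide)
    also have "\<dots> \<le> (1 / \<delta> ^ s) * prod_list (map b L)" using d by (intro mult_left_mono le) auto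
    finally show "norm (lcoef a m L) * (1 + ?p) ^ s \<le> (1 / \<delta> ^ s) * prod_list (map b L)" .
  qed (simp add: fsize_nonneg)
qed

definition frq :: "int \<times> int \<Rightarrow> real^2" where
  "frq x = vector [of_int (fst x), of_int (snd x)]"

lemma frq_nth: "frq x $ 1 = of_int (fst x)" "frq x $ 2 = of_int (snd x)"
  by (simp_all add: frq_def)

lemma axis_2_nth:
  "axis (1::2) (1::real) $ 1 = 1" "axis (1::2) (1::real) $ 2 = 0"
  "axis (2::2) (1::real) $ 1 = 0" "axis (2::2) (1::real) $ 2 = 1"
  by (simp_all add: axis_def)

lemma frq_add: "frq (x + y) = frq x + frq y"
  by (simp add: vec_eq_iff forall_2 frq_nth)

lemma norm_frq_le: "norm (frq x) \<le> fsize x"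
  using norm_le_l1_cart[of "frq x"] by (simp add: sum_2 frq_nth fsize_def)

lemma frq_inner: "frq x \<bullet> y = of_int (fst x) * y $ 1 + of_int (snd x) * y $ 2"
  by (simp add: inner_vec_def sum_2 frq_nth)

text \<open>Ansatz \<open>w = x1 + (\<tau>0 + c) x2 + v\<close> with \<open>v\<close> periodic. With
  \<open>\<Phi> = 1 + v_1\<close> for \<open>pd 1 w\<close>, and \<open>a\<close> for the
  exponential sum, the equation reads \<open>v_2 - \<tau>0 v_1 + c = a \<Phi>\<close>. At a nonzero
  frequency it determines \<open>v\<close> by division by \<open>\<i> * den\<close>; at frequency
  zero it determines \<open>c\<close>. Differentiating \<open>v\<close> in the first direction gives
  the fixed point equation \<open>\<Phi> = 1 + m (a \<Phi>)\<close>, with \<open>m\<close> acting as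
  a Fourier multiplier, and the Neumann series solves it.\<close>

lemma beltrami_periodic:
  fixes a :: "int \<times> int \<Rightarrow> complex" and \<tau>0 :: complex
  assumes \<tau>0: "Im \<tau>0 > 0" and a: "\<And>s. (\<lambda>x. norm (a x) * (1 + fsize x) ^ s) summable_on UNIV"
    and small: "(\<Sum>\<^sub>\<infinity>x. norm (a x)) \<le> Im \<tau>0 / 4"
  obtains w where "smooth_on UNIV w" "\<And>x. pd 2 w x = (\<tau>0 + expsum a frq x) * pd 1 w x" "\<And>x. pd 1 w x \<noteq> 0"
proof -
  define den where "den x = of_int (snd x) - \<tau>0 * of_int (fst x)" for x :: "int \<times> int"
  define m where "m x = (if x = 0 then 0 else of_int (fst x) / den x)" for x
  \<comment> \<open>A lower bound of \<open>den\<close> over the nonzero frequencies: if the first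
    component is nonzero, the imaginary part is at least \<open>Im \<tau>0\<close> in modulus;
    otherwise \<open>den\<close> is a nonzero integer.\<close>
  define C where "C = min 1 (Im \<tau>0)"
  have C: "C > 0" using \<tau>0 by (simp add: C_def)
  have den1: "norm (den x) \<ge> Im \<tau>0 * \<bar>of_int (fst x)\<bar>" for x
  proof -
    have "\<bar>Im (den x)\<bar> = Im \<tau>0 * \<bar>of_int (fst x)\<bar>" using \<tau>0 by (simp add: den_def abs_mult)
    then show ?thesis using abs_Im_le_cmod[of "den x"] by simp
  qed
  have den2: "norm (den x) \<ge> C" if "x \<noteq> 0" for x
  proof (cases "fst x = 0")
    case True
    then have "snd x \<noteq> 0" using that by (auto simp: prod_eq_iff)
    then have "\<bar>of_int (snd x) :: real\<bar> \<ge> 1" by linarith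
    then show ?thesis using True by (simp add: den_def C_def)
  next
    case False
    then have "\<bar>of_int (fst x) :: real\<bar> \<ge> 1" by linarith
    then have "Im \<tau>0 * \<bar>of_int (fst x)\<bar> \<ge> Im \<tau>0 * 1" using \<tau>0 by (intro mult_left_mono) auto
    then show ?thesis using den1[of x] by (simp add: C_def)
  qed
  have den0: "den x \<noteq> 0" if "x \<noteq> 0" for x using den2[OF that] C by auto
  have m: "norm (m x) \<le> 1 / Im \<tau>0" for x
  proof (cases "x = 0")
    case False
    have "\<bar>of_int (fst x)\<bar> / norm (den x) \<le> 1 / Im \<tau>0"
      using den1[of x] den0[OF False] \<tau>0 by (simp add: field_simps)
    then show ?thesis using False by (simp add: m_def norm_divide)
  qed (use \<tau>0 in \<open>simp add: m_def\<close>)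
  have q: "1 / Im \<tau>0 * (\<Sum>\<^sub>\<infinity>x. norm (a x)) \<le> 1 / 4" using small \<tau>0 by (simp add: field_simps)
  let ?lc = "lcoef a m"
  note ls = lcoef_weighted_summable[OF a m q]
  \<comment> \<open>An index pairs a frequency of \<open>a\<close> with a list from the series of
    \<open>\<Phi>\<close>; \<open>g\<close> collects the coefficients of their product.\<close>
  define idx where "idx i = fst i + sum_list (snd i)" for i :: "(int \<times> int) \<times> (int \<times> int) list"
  define g where "g i = a (fst i) * ?lc (snd i)" for i
  have gs: "(\<lambda>i. norm (g i) * (1 + norm (frq (idx i))) ^ s) summable_on UNIV" for s
  proof -
    have "(\<lambda>i. (norm (a (fst i)) * (1 + fsize (fst i)) ^ s) * (norm (?lc (snd i)) * (1 + fsize (sum_list (snd i))) ^ s)) summable_on UNIV"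
      by (rule summable_on_product[OF a _ ls]) (auto simp: fsize_nonneg)
    then show ?thesis
    proof (rule summable_on_comparison_test)
      fix i
      have "1 + norm (frq (idx i)) \<le> 1 + (fsize (fst i) + fsize (sum_list (snd i)))"
        using norm_frq_le[of "idx i"] fsize_add[of "fst i" "sum_list (snd i)"] by (simp add: idx_def)
      also have "\<dots> \<le> (1 + fsize (fst i)) * (1 + fsize (sum_list (snd i)))"
        using mult_nonneg_nonneg[OF fsize_nonneg fsize_nonneg, of "fst i" "sum_list (snd i)"] by (simp add: algebra_simps)
      finally have "(1 + norm (frq (idx i))) ^ s \<le> (1 + fsize (fst i)) ^ s * (1 + fsize (sum_list (snd i))) ^ s"
        unfolding power_mult_distrib[symmetric] by (intro power_mono) auto
      then have "norm (g i) * (1 + norm (frq (idx i))) ^ s \<le> norm (g i) * ((1 + fsize (fst i)) ^ s * (1 + fsize (sum_list (snd i))) ^ s)"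
        by (intro mult_left_mono) auto
      then show "norm (g i) * (1 + norm (frq (idx i))) ^ s \<le>
        (norm (a (fst i)) * (1 + fsize (fst i)) ^ s) * (norm (?lc (snd i)) * (1 + fsize (sum_list (snd i))) ^ s)"
        by (simp add: g_def norm_mult mult_ac)
    qed auto
  qed
  have rg: "rapid g (\<lambda>i. frq (idx i))" using gs by (simp add: rapid_def)
  define d where "d i = (if idx i = 0 then 0 else g i / (\<i> * den (idx i)))" for i
  have rd: "rapid d (\<lambda>i. frq (idx i))"
    unfolding rapid_def
  proof
    fix s
    have "(\<lambda>i. (1 / C) * (norm (g i) * (1 + norm (frq (idx i))) ^ s)) summable_on UNIV"
      by (rule summable_on_cmult_right[OF gs])
    then show "(\<lambda>i. norm (d i) * (1 + norm (frq (idx i))) ^ s) summable_on UNIV"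
    proof (rule summable_on_comparison_test)
      fix i
      have "norm (d i) \<le> (1 / C) * norm (g i)"
      proof (cases "idx i = 0")
        case False
        have "norm (g i) / norm (den (idx i)) \<le> norm (g i) / C"
          using den2[OF False] C by (intro divide_left_mono mult_pos_pos) auto
        then show ?thesis using False by (simp add: d_def norm_divide norm_mult)
      qed (use C in \<open>simp add: d_def\<close>)
      then show "norm (d i) * (1 + norm (frq (idx i))) ^ s \<le> (1 / C) * (norm (g i) * (1 + norm (frq (idx i))) ^ s)"
        unfolding mult.assoc[symmetric] by (intro mult_right_mono) auto
    qed auto
  qed
  define v where "v = expsum d (\<lambda>i. frq (idx i))"
  \<comment> \<open>The mean value of the product of \<open>\<Phi>\<close> with the exponential sum.
    Derivatives of a periodic \<open>v\<close> have mean zero, so the linear part of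
    \<open>w\<close> must absorb it.\<close>
  define c where "c = (\<Sum>\<^sub>\<infinity>i. if idx i = 0 then g i else 0)"
  define \<Phi> where "\<Phi> x = (\<Sum>\<^sub>\<infinity>L. ?lc L * cis (frq (sum_list L) \<bullet> x))" for x
  have lc0: "(\<lambda>L. norm (?lc L)) summable_on UNIV" using ls[where s = 0] by simp
  have \<Phi>: "((\<lambda>L. ?lc L * cis (frq (sum_list L) \<bullet> x)) has_sum \<Phi> x) UNIV" for x
    unfolding \<Phi>_def by (rule has_sum_infsum[OF abs_summable_summable]) (use lc0 in \<open>simp add: norm_mult\<close>)
  have ra: "rapid a frq"
    unfolding rapid_def
  proof
    fix s
    show "(\<lambda>i. norm (a i) * (1 + norm (frq i)) ^ s) summable_on UNIV"
      by (rule summable_on_comparison_test[OF a[of s]])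
         (auto intro!: mult_left_mono power_mono simp: norm_frq_le)
  qed
  have prod: "((\<lambda>i. g i * cis (frq (idx i) \<bullet> x)) has_sum (expsum a frq x * \<Phi> x)) UNIV" for x
  proof -
    have "((\<lambda>i. (a (fst i) * cis (frq (fst i) \<bullet> x)) * (?lc (snd i) * cis (frq (sum_list (snd i)) \<bullet> x))) has_sum (expsum a frq x * \<Phi> x)) UNIV"
      by (rule has_sum_product_complex[OF rapid_expsum_has_sum[OF ra] _ \<Phi>])
         (use rapid_norm_summable[OF ra] lc0 in \<open>simp_all add: norm_mult\<close>)
    moreover have "(a (fst i) * cis (frq (fst i) \<bullet> x)) * (?lc (snd i) * cis (frq (sum_list (snd i)) \<bullet> x)) = g i * cis (frq (idx i) \<bullet> x)" for i
      by (simp add: g_def idx_def frq_add inner_add_left cis_mult[symmetric] mult_ac)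
    ultimately show ?thesis by simp
  qed
  have tail: "((\<lambda>L. ?lc L * cis (frq (sum_list L) \<bullet> x)) has_sum (\<Phi> x - 1)) (- {[]})" for x
    using has_sum_remove[OF \<Phi>[of x], of "[]"] by (simp add: frq_inner)
  \<comment> \<open>Prepending the new frequency identifies the terms of the product with the
    nonempty lists; by the recursion of \<open>lcoef\<close> the multiplier \<open>m\<close> turns
    them into the series of \<open>\<Phi>\<close> without its first term 1.\<close>
  have bij: "bij_betw (\<lambda>i. fst i # snd i) UNIV (- {[]})"
    by (rule bij_betwI[where g = "\<lambda>L. (hd L, tl L)"]) auto
  have shifted: "((\<lambda>i. m (idx i) * g i * cis (frq (idx i) \<bullet> x)) has_sum (\<Phi> x - 1)) UNIV" for x
    using tail[of x] unfolding has_sum_reindex_bij_betw[OF bij, symmetric]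
    by (simp add: g_def idx_def mult_ac)
  have pdv: "frechet_derivative v (at x) (axis j 1) = expsum (\<lambda>i. \<i> * of_real (frq (idx i) $ j) * d i) (\<lambda>i. frq (idx i)) x" for x j
    unfolding v_def by (subst frechet_derivative_eq[OF expsum_has_derivative[OF rd]]) (simp add: inner_axis)
  have hd: "((\<lambda>i. \<i> * of_real (frq (idx i) $ j) * d i * cis (frq (idx i) \<bullet> x)) has_sum frechet_derivative v (at x) (axis j 1)) UNIV" for x j
    unfolding pdv using rapid_expsum_has_sum[OF rapid_directional[OF rd, of "axis j 1"], of x] by (simp add: inner_axis)
  have v1: "frechet_derivative v (at x) (axis 1 1) = \<Phi> x - 1" for x
  proof (rule has_sum_unique[OF hd])
    have "\<i> * of_real (frq (idx i) $ 1) * d i = m (idx i) * g i" for i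
      using den0[of "idx i"] by (simp add: d_def m_def frq_nth)
    then show "((\<lambda>i. \<i> * of_real (frq (idx i) $ 1) * d i * cis (frq (idx i) \<bullet> x)) has_sum (\<Phi> x - 1)) UNIV"
      using shifted by simp
  qed
  have c: "((\<lambda>i. if idx i = 0 then g i else 0) has_sum c) UNIV"
    unfolding c_def
  proof (rule has_sum_infsum[OF abs_summable_summable])
    have "(\<lambda>i. norm (g i)) summable_on UNIV" using rapid_norm_summable[OF rg] .
    then show "(\<lambda>i. norm (if idx i = 0 then g i else 0)) summable_on UNIV"
      by (rule summable_on_comparison_test) auto
  qed
  have v2: "frechet_derivative v (at x) (axis 2 1) - \<tau>0 * frechet_derivative v (at x) (axis 1 1) + c = expsum a frq x * \<Phi> x" for x
  proof (rule has_sum_unique[OF has_sum_add[OF has_sum_subtract[OF hd has_sum_cmult_right[OF hd]] c]])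
    have "\<i> * of_real (frq (idx i) $ 2) * d i * cis (frq (idx i) \<bullet> x) - \<tau>0 * (\<i> * of_real (frq (idx i) $ 1) * d i * cis (frq (idx i) \<bullet> x))
        + (if idx i = 0 then g i else 0) = g i * cis (frq (idx i) \<bullet> x)" for i
    proof (cases "idx i = 0")
      case False
      then have "\<i> * den (idx i) * d i = g i" using den0[OF False] by (simp add: d_def)
      then have "g i * cis (frq (idx i) \<bullet> x) = \<i> * den (idx i) * d i * cis (frq (idx i) \<bullet> x)" by simp
      also have "\<dots> = \<i> * of_real (frq (idx i) $ 2) * d i * cis (frq (idx i) \<bullet> x) - \<tau>0 * (\<i> * of_real (frq (idx i) $ 1) * d i * cis (frq (idx i) \<bullet> x))"
        by (simp add: den_def frq_nth algebra_simps)
      finally show ?thesis using False by simp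
    qed (simp add: d_def frq_inner)
    then show "((\<lambda>i. \<i> * of_real (frq (idx i) $ 2) * d i * cis (frq (idx i) \<bullet> x) - \<tau>0 * (\<i> * of_real (frq (idx i) $ 1) * d i * cis (frq (idx i) \<bullet> x))
        + (if idx i = 0 then g i else 0)) has_sum (expsum a frq x * \<Phi> x)) UNIV"
      using prod by simp
  qed
  define w where "w x = of_real (x $ 1) + (\<tau>0 + c) * of_real (x $ 2) + v x" for x :: "real^2"
  have sv: "smooth_on UNIV v" unfolding v_def by (rule smooth_expsum[OF rd])
  have sw: "smooth_on UNIV w"
    unfolding w_def
    by (intro smooth_on_add smooth_on_mult smooth_on_const sv open_UNIV
        smooth_on_linear_compose[OF open_UNIV bounded_linear_of_real] smooth_on_nth smooth_on_ident)
  have "(w has_derivative (\<lambda>h. of_real (h $ 1) + (\<tau>0 + c) * of_real (h $ 2) + frechet_derivative v (at x) h)) (at x)" for x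
    unfolding w_def
    by (intro has_derivative_add has_derivative_mult_right has_derivative_of_real smooth_on_has_derivative[OF sv UNIV_I]
        bounded_linear_imp_has_derivative bounded_linear_vec_nth)
  note fw = frechet_derivative_eq[OF this]
  have w1: "pd 1 w x = \<Phi> x" for x
    by (simp add: pd_def fw v1 axis_2_nth)
  have w2: "pd 2 w x = (\<tau>0 + expsum a frq x) * \<Phi> x" for x
  proof -
    have "pd 2 w x = (\<tau>0 + c) + frechet_derivative v (at x) (axis 2 1)"
      by (simp add: pd_def fw axis_2_nth)
    also have "\<dots> = \<tau>0 + \<tau>0 * (\<Phi> x - 1) + expsum a frq x * \<Phi> x"
      using v2[of x] by (simp add: v1 algebra_simps)
    finally show ?thesis by (simp add: algebra_simps)
  qed
  \<comment> \<open>The Neumann series without the empty list has absolute sum at most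
    \<open>4 / 3 - 1\<close>, so \<open>\<Phi>\<close> stays at distance less than 1 from 1.\<close>
  have nz: "\<Phi> x \<noteq> 0" for x
  proof -
    define b where "b y = 1 / Im \<tau>0 * norm (a y)" for y
    have b0: "b y \<ge> 0" for y using \<tau>0 by (simp add: b_def)
    have bs: "(b has_sum (1 / Im \<tau>0 * (\<Sum>\<^sub>\<infinity>x. norm (a x)))) UNIV"
      unfolding b_def by (intro has_sum_cmult_right has_sum_infsum) (use a[of 0] in simp)
    have q1: "1 / Im \<tau>0 * (\<Sum>\<^sub>\<infinity>x. norm (a x)) < 1" using q by linarith
    have "norm (?lc L) * 1 \<le> prod_list (map b L)" for L
      by (rule lcoef_bound[OF m, where \<omega> = "\<lambda>_. 1"]) (auto simp: b_def)
    then have "(\<Sum>\<^sub>\<infinity>L. norm (?lc L)) \<le> (\<Sum>\<^sub>\<infinity>L. prod_list (map b L))"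
      using q1 by (intro infsum_mono lc0 prod_list_summable(1)[OF b0 bs]) auto
    also have "\<dots> \<le> 1 / (1 - 1 / Im \<tau>0 * (\<Sum>\<^sub>\<infinity>x. norm (a x)))"
      using q1 by (intro prod_list_summable(2)[OF b0 bs]) auto
    also have "\<dots> \<le> 1 / (1 - 1 / 4)" using q q1 by (intro divide_left_mono mult_pos_pos) linarith+
    finally have S: "(\<Sum>\<^sub>\<infinity>L. norm (?lc L)) \<le> 4 / 3" by simp
    have "((\<lambda>L. norm (?lc L)) has_sum ((\<Sum>\<^sub>\<infinity>L. norm (?lc L)) - 1)) (- {[]})"
      using has_sum_remove[OF has_sum_infsum[OF lc0], of "[]"] by simp
    then have "norm (\<Phi> x - 1) \<le> (\<Sum>\<^sub>\<infinity>L. norm (?lc L)) - 1"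
      by (rule norm_infsum_le[OF tail]) (simp add: norm_mult)
    then have "norm (\<Phi> x - 1) < 1" using S by linarith
    then show ?thesis by auto
  qed
  show thesis
    by (rule that[OF sw]) (use w1 w2 nz in auto)
qed

lemma freq_weight_ge_fsize: "1 + fsize (k, l) \<le> freq_weight k l"
proof -
  have le: "\<bar>of_int j :: real\<bar> \<le> (of_int j)\<^sup>2" for j :: int
  proof (cases "j = 0")
    case False
    then have "1 \<le> \<bar>of_int j :: real\<bar>" by linarith
    then have "\<bar>of_int j :: real\<bar> * 1 \<le> \<bar>of_int j\<bar> * \<bar>of_int j\<bar>" by (intro mult_left_mono) auto
    then show ?thesis by (simp add: power2_eq_square)
  qed simp
  have "1 + fsize (k, l) \<le> 1 + (of_int k)\<^sup>2 + (of_int l)\<^sup>2 + (of_int k)\<^sup>2 * (of_int l :: real)\<^sup>2"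
    using le[of k] le[of l] by (simp add: fsize_def add_increasing2)
  then show ?thesis by (simp add: algebra_simps)
qed

text \<open>The coefficient is replaced by \<open>\<tau> x0\<close> plus the cut off difference,
  seen at scale \<open>e\<close> around \<open>x0\<close>. This perturbation is zero at
  \<open>e = 0\<close>, so some positive \<open>e\<close> meets the smallness condition of
  \<open>beltrami_periodic\<close>. Undoing the scaling gives a solution for \<open>\<tau>\<close>
  itself on the square where the cutoffs are 1.\<close>

lemma isothermal_function:
  fixes \<tau> :: "real^2 \<Rightarrow> complex"
  assumes D: "open D" "x0 \<in> D" and \<tau>: "smooth_on D \<tau>" "Im (\<tau> x0) > 0"
  obtains U w where "open U" "x0 \<in> U" "U \<subseteq> D" "smooth_on U w"
    "\<And>x. x \<in> U \<Longrightarrow> pd 2 w x = \<tau> x * pd 1 w x" "\<And>x. x \<in> U \<Longrightarrow> pd 1 w x \<noteq> 0"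
proof -
  obtain \<rho> where \<rho>: "\<rho> > 0" "ball x0 \<rho> \<subseteq> D" using D openE by blast
  \<comment> \<open>With both angles below 4 in modulus the displacement from \<open>x0\<close> is
    less than \<open>8 * r\<close>.\<close>
  define r where "r = \<rho> / 8"
  have r: "r > 0" using \<rho> by (simp add: r_def)
  define h where "h x = x0 + (snd (snd x) * fst x) *\<^sub>R axis 1 1 + (snd (snd x) * fst (snd x)) *\<^sub>R axis 2 1"
    for x :: "real \<times> real \<times> real"
  have hb: "h x \<in> D" if "x \<in> box3 r" for x
  proof -
    obtain s t e where x: "x = (s, t, e)" by (cases x)
    have b: "\<bar>s\<bar> < 4" "\<bar>t\<bar> < 4" "\<bar>e\<bar> < r" using that by (auto simp: box3_def x)
    have "norm ((e * s) *\<^sub>R axis 1 1 + (e * t) *\<^sub>R axis 2 1 :: real^2) \<le> \<bar>e\<bar> * \<bar>s\<bar> + \<bar>e\<bar> * \<bar>t\<bar>"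
      using norm_triangle_ineq[of "(e * s) *\<^sub>R axis 1 1 :: real^2" "(e * t) *\<^sub>R axis 2 1"] by (simp add: abs_mult norm_axis_1)
    also have "\<dots> \<le> \<bar>e\<bar> * 4 + \<bar>e\<bar> * 4" using b by (intro add_mono mult_left_mono) auto
    also have "\<dots> < \<rho>" using b by (simp add: r_def)
    finally have "dist x0 (h x) < \<rho>"
      using norm_minus_commute[of x0 "h x"] by (simp add: dist_norm h_def x add.assoc)
    then show ?thesis using \<rho>(2) by auto
  qed
  have sh: "smooth_on (box3 r) h"
    unfolding h_def
    by (intro smooth_on_add smooth_on_scaleR smooth_on_mult smooth_on_const open_box3
        smooth_on_linear_compose[OF open_box3 bounded_linear_fst] smooth_on_linear_compose[OF open_box3 bounded_linear_snd]
        smooth_on_ident)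
  define f where "f x = of_real (cutoff (fst x) * cutoff (fst (snd x))) * (\<tau> (h x) - \<tau> x0)" for x
  have nf: "nice r f"
    unfolding nice_def
  proof
    have c: "smooth_on (box3 r) (\<lambda>x. cutoff (p x))" if "bounded_linear p" for p
      by (rule smooth_on_compose[OF open_box3 open_UNIV subset_UNIV smooth_cutoff smooth_on_bounded_linear[OF open_box3 that]])
    show "smooth_on (box3 r) f"
      unfolding f_def
      by (intro smooth_on_mult smooth_on_diff smooth_on_const open_box3
          smooth_on_linear_compose[OF open_box3 bounded_linear_of_real] c bounded_linear_fst
          bounded_linear_fst_comp[OF bounded_linear_snd]
          smooth_on_compose[OF open_box3 D(1) _ \<tau>(1) sh]) (use hb in auto)
    show "\<forall>x\<in>box3 r. 2 < \<bar>fst x\<bar> \<or> 2 < \<bar>fst (snd x)\<bar> \<longrightarrow> f x = 0"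
      by (auto simp: f_def cutoff_eq_0)
  qed
  have z: "f (s, t, 0) = 0" for s t by (simp add: f_def h_def)
  have d: "Im (\<tau> x0) / 4 > 0" using \<tau> by simp
  obtain e where e: "0 < e" "e < r" and small: "(\<Sum>\<^sub>\<infinity>(k, l). norm (fc2 f e k l)) \<le> Im (\<tau> x0) / 4"
    using small_fourier_coefficients[OF nf r z d] by blast
  have e': "\<bar>e\<bar> < r" using e by simp
  define a where "a x = fc2 f e (fst x) (snd x)" for x
  have as: "(\<lambda>x. norm (a x) * (1 + fsize x) ^ s) summable_on UNIV" for s
  proof (rule summable_on_comparison_test[OF fc2_weighted_summable[OF nf e', of s]])
    fix x :: "int \<times> int"
    have "(1 + fsize x) ^ s \<le> freq_weight (fst x) (snd x) ^ s"
      using freq_weight_ge_fsize[of "fst x" "snd x"] fsize_nonneg[of x] by (intro power_mono) auto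
    then show "norm (a x) * (1 + fsize x) ^ s \<le> (case x of (k, l) \<Rightarrow> norm (fc2 f e k l) * freq_weight k l ^ s)"
      by (simp add: a_def case_prod_unfold mult_left_mono)
  qed (simp add: fsize_nonneg)
  have small': "(\<Sum>\<^sub>\<infinity>x. norm (a x)) \<le> Im (\<tau> x0) / 4"
    using small by (simp add: a_def case_prod_unfold)
  obtain w0 where w0: "smooth_on UNIV w0" "\<And>x. pd 2 w0 x = (\<tau> x0 + expsum a frq x) * pd 1 w0 x" "\<And>x. pd 1 w0 x \<noteq> 0"
    using beltrami_periodic[OF \<tau>(2) as small'] by blast
  \<comment> \<open>In the rescaled coordinates this is the open square of half side 1, on which
    both cutoffs equal 1.\<close>
  define U where "U = {x::real^2. \<bar>x $ 1 - x0 $ 1\<bar> < e \<and> \<bar>x $ 2 - x0 $ 2\<bar> < e}"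
  define w where "w x = w0 ((1 / e) *\<^sub>R (x - x0))" for x
  have U: "open U"
    unfolding U_def by (intro open_Collect_conj open_Collect_less continuous_intros)
  have hU: "h ((x $ 1 - x0 $ 1) / e, (x $ 2 - x0 $ 2) / e, e) = x" for x
    using e by (simp add: h_def vec_eq_iff forall_2 axis_2_nth)
  have bU: "\<bar>(x $ 1 - x0 $ 1) / e\<bar> < 1" "\<bar>(x $ 2 - x0 $ 2) / e\<bar> < 1" if "x \<in> U" for x
    using that e by (auto simp: U_def abs_divide)
  have tau: "\<tau> x0 + expsum a frq ((1 / e) *\<^sub>R (x - x0)) = \<tau> x" if x: "x \<in> U" for x
  proof -
    let ?s = "(x $ 1 - x0 $ 1) / e" and ?t = "(x $ 2 - x0 $ 2) / e"
    have st: "?s \<in> {-pi<..<pi}" "?t \<in> {-pi<..<pi}"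
      using bU[OF x] pi_gt3 unfolding greaterThanLessThan_iff abs_less_iff by linarith+
    have "((\<lambda>(k, l). fc2 f e k l * cis (of_int k * ?s + of_int l * ?t)) has_sum f (?s, ?t, e)) UNIV"
      by (rule fourier_inversion_2d[OF nf e' st])
    moreover have "rapid a frq"
      unfolding rapid_def
      by (intro allI summable_on_comparison_test[OF as]) (auto intro!: mult_left_mono power_mono simp: norm_frq_le)
    from rapid_expsum_has_sum[OF this]
    have "((\<lambda>i. a i * cis (frq i \<bullet> ((1 / e) *\<^sub>R (x - x0)))) has_sum expsum a frq ((1 / e) *\<^sub>R (x - x0))) UNIV" .
    moreover have "a i * cis (frq i \<bullet> ((1 / e) *\<^sub>R (x - x0))) = (case i of (k, l) \<Rightarrow> fc2 f e k l * cis (of_int k * ?s + of_int l * ?t))" for i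
      by (simp add: a_def frq_inner case_prod_unfold add_divide_distrib)
    ultimately have "expsum a frq ((1 / e) *\<^sub>R (x - x0)) = f (?s, ?t, e)"
      using has_sum_unique by (metis (no_types, lifting) has_sum_cong)
    also have "\<dots> = \<tau> x - \<tau> x0"
      using hU[of x] cutoff_eq_1[OF less_imp_le[OF bU(1)[OF x]]] cutoff_eq_1[OF less_imp_le[OF bU(2)[OF x]]]
      by (simp only: f_def fst_conv snd_conv) simp
    finally show ?thesis by simp
  qed
  have pw: "pd i w x = (1 / e) *\<^sub>R pd i w0 ((1 / e) *\<^sub>R (x - x0))" for i x
  proof -
    note d0 = smooth_on_has_derivative[OF w0(1) UNIV_I, of "(1 / e) *\<^sub>R (x - x0)"]
    have "(w has_derivative (\<lambda>h. frechet_derivative w0 (at ((1 / e) *\<^sub>R (x - x0))) ((1 / e) *\<^sub>R h))) (at x)"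
      unfolding w_def
      by (rule has_derivative_compose[of "\<lambda>x. (1 / e) *\<^sub>R (x - x0)", OF _ d0]) (auto intro!: derivative_eq_intros)
    from frechet_derivative_eq[OF this] show ?thesis
      unfolding pd_def using linear_cmul[OF has_derivative_linear[OF d0], of "1 / e" "axis i 1"] by simp
  qed
  show thesis
  proof (rule that[OF U])
    show "x0 \<in> U" using e by (simp add: U_def)
    show "U \<subseteq> D"
    proof
      fix x assume x: "x \<in> U"
      have "((x $ 1 - x0 $ 1) / e, (x $ 2 - x0 $ 2) / e, e) \<in> box3 r"
        using bU[OF x] e' unfolding box3_def by simp
      from hb[OF this] show "x \<in> D" unfolding hU .
    qed
    have "smooth_on UNIV (\<lambda>x. w0 ((1 / e) *\<^sub>R (x - x0)))"
      by (rule smooth_on_compose[OF open_UNIV open_UNIV subset_UNIV w0(1)])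
         (intro smooth_on_scaleR smooth_on_diff smooth_on_const smooth_on_ident open_UNIV)
    then show "smooth_on U w" using smooth_on_subset unfolding w_def by blast
    show "pd 2 w x = \<tau> x * pd 1 w x" if "x \<in> U" for x
      using w0(2)[of "(1 / e) *\<^sub>R (x - x0)"] tau[OF that] by (simp add: pw)
    show "pd 1 w x \<noteq> 0" if "x \<in> U" for x
      using w0(3) e by (simp add: pw)
  qed
qed

section \<open>Lorentz algebra\<close>

lemma bounded_bilinear_lor: "bounded_bilinear lor"
  unfolding bilinear_conv_bounded_bilinear[symmetric] bilinear_def
  by (auto intro!: linearI simp: lor_def algebra_simps)

lemmas lor_simps =
  bounded_bilinear.add_left[OF bounded_bilinear_lor] bounded_bilinear.add_right[OF bounded_bilinear_lor]
  bounded_bilinear.diff_left[OF bounded_bilinear_lor] bounded_bilinear.diff_right[OF bounded_bilinear_lor]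
  bounded_bilinear.minus_left[OF bounded_bilinear_lor] bounded_bilinear.minus_right[OF bounded_bilinear_lor]
  bounded_bilinear.scaleR_left[OF bounded_bilinear_lor] bounded_bilinear.scaleR_right[OF bounded_bilinear_lor]
  bounded_bilinear.zero_left[OF bounded_bilinear_lor] bounded_bilinear.zero_right[OF bounded_bilinear_lor]

lemmas lor_sum_left = bounded_bilinear.sum_left[OF bounded_bilinear_lor]
lemmas lor_sum_right = bounded_bilinear.sum_right[OF bounded_bilinear_lor]

lemma lor_commute: "lor x y = lor y x"
  by (simp add: lor_def mult.commute)

lemma lor_nondegenerate: "(\<And>y. lor x y = 0) \<Longrightarrow> x = 0"
proof -
  assume h: "\<And>y. lor x y = 0"
  have "x $ i = 0" for i
    using exhaust_4[of i] h[of "axis i 1"] by (auto simp: lor_def axis_def)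
  then show "x = 0" by (simp add: vec_eq_iff)
qed

lemma lor_axis:
  "lor x (axis 1 1) = - (x $ 1)" "lor x (axis 2 1) = x $ 2" "lor x (axis 3 1) = x $ 3" "lor x (axis 4 1) = x $ 4"
  by (simp_all add: lor_def axis_def)

lemma lor_zero_axis: "(\<And>i. lor x (axis i 1) = 0) \<Longrightarrow> x = 0"
proof -
  assume h: "\<And>i. lor x (axis i 1) = 0"
  show "x = 0" using h[of 1] h[of 2] h[of 3] h[of 4] by (simp add: lor_axis vec_eq_iff forall_4)
qed

lemma dot3_Cauchy_Schwarz:
  fixes a b c x y z :: real
  shows "(a * x + b * y + c * z)\<^sup>2 \<le> (a\<^sup>2 + b\<^sup>2 + c\<^sup>2) * (x\<^sup>2 + y\<^sup>2 + z\<^sup>2)"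
proof -
  have "(a\<^sup>2 + b\<^sup>2 + c\<^sup>2) * (x\<^sup>2 + y\<^sup>2 + z\<^sup>2) - (a * x + b * y + c * z)\<^sup>2
      = (a * y - b * x)\<^sup>2 + (a * z - c * x)\<^sup>2 + (b * z - c * y)\<^sup>2"
    by (simp add: power2_eq_square algebra_simps)
  also have "\<dots> \<ge> 0" by simp
  finally show ?thesis by simp
qed

lemma hyp3_first: "p \<in> hyp3 \<Longrightarrow> (p $ 1)\<^sup>2 = 1 + ((p $ 2)\<^sup>2 + (p $ 3)\<^sup>2 + (p $ 4)\<^sup>2)" "p \<in> hyp3 \<Longrightarrow> p $ 1 > 0"
  "p \<in> hyp3 \<Longrightarrow> lor p p = -1"
  by (auto simp: hyp3_def lor_def power2_eq_square)

text \<open>Cauchy-Schwarz for the space components: the product of the time components dominates.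
  The sign is what tells the two sheets of the hyperboloid apart in \<open>O13I\<close>.\<close>

lemma hyp3_lor_neg:
  assumes "p \<in> hyp3" "q \<in> hyp3"
  shows "lor p q < 0"
proof -
  let ?P = "(p $ 2)\<^sup>2 + (p $ 3)\<^sup>2 + (p $ 4)\<^sup>2" and ?Q = "(q $ 2)\<^sup>2 + (q $ 3)\<^sup>2 + (q $ 4)\<^sup>2"
  have "(p $ 2 * q $ 2 + p $ 3 * q $ 3 + p $ 4 * q $ 4)\<^sup>2 \<le> ?P * ?Q" by (rule dot3_Cauchy_Schwarz)
  also have "\<dots> < (1 + ?P) * (1 + ?Q)"
    by (simp add: algebra_simps add_pos_nonneg)
  also have "\<dots> = (p $ 1 * q $ 1)\<^sup>2" by (simp add: power_mult_distrib hyp3_first(1)[OF assms(1)] hyp3_first(1)[OF assms(2)])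
  finally have "p $ 2 * q $ 2 + p $ 3 * q $ 3 + p $ 4 * q $ 4 < p $ 1 * q $ 1"
    by (rule power2_less_imp_less) (simp add: hyp3_first(2)[OF assms(1)] hyp3_first(2)[OF assms(2)] less_imp_le)
  then show ?thesis by (simp add: lor_def)
qed

text \<open>Orthogonality to the timelike \<open>p\<close> expresses the time component of
  \<open>v\<close> through the others, and Cauchy-Schwarz bounds it. Hence the metric of an immersed
  surface is positive definite although \<open>lor\<close> is not.\<close>

lemma hyp3_tangent_spacelike:
  assumes p: "p \<in> hyp3" and v: "lor p v = 0" "v \<noteq> 0"
  shows "lor v v > 0"
proof -
  let ?P = "(p $ 2)\<^sup>2 + (p $ 3)\<^sup>2 + (p $ 4)\<^sup>2" and ?V = "(v $ 2)\<^sup>2 + (v $ 3)\<^sup>2 + (v $ 4)\<^sup>2"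
  have eq: "p $ 1 * v $ 1 = p $ 2 * v $ 2 + p $ 3 * v $ 3 + p $ 4 * v $ 4" using v by (simp add: lor_def)
  have "?V \<noteq> 0"
  proof
    assume "?V = 0"
    then have "v $ 2 = 0" "v $ 3 = 0" "v $ 4 = 0" by (auto simp: add_nonneg_eq_0_iff)
    then show False using eq v(2) hyp3_first(2)[OF p] by (auto simp: vec_eq_iff forall_4)
  qed
  then have V: "?V > 0" by (simp add: order_less_le)
  have P1: "1 + ?P > 0" by (simp add: add_pos_nonneg)
  have "(1 + ?P) * (v $ 1)\<^sup>2 = (p $ 1 * v $ 1)\<^sup>2" by (simp add: power_mult_distrib hyp3_first(1)[OF p])
  also have "\<dots> \<le> ?P * ?V" unfolding eq by (rule dot3_Cauchy_Schwarz)
  also have "\<dots> < (1 + ?P) * ?V" using V by (simp add: distrib_right)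
  finally have "(v $ 1)\<^sup>2 < ?V" using P1 by (simp only: mult_less_cancel_left_pos)
  then show ?thesis by (simp add: lor_def power2_eq_square)
qed

lemma bounded_bilinear_mat: "bounded_bilinear ((**) :: real^4^4 \<Rightarrow> real^4^4 \<Rightarrow> real^4^4)"
  unfolding bilinear_conv_bounded_bilinear[symmetric] bilinear_def
  by (auto intro!: linearI simp: matrix_matrix_mult_def vec_eq_iff sum.distrib sum_distrib_left algebra_simps)

lemma bounded_bilinear_matvec: "bounded_bilinear ((*v) :: real^4^4 \<Rightarrow> real^4 \<Rightarrow> real^4)"
  unfolding bilinear_conv_bounded_bilinear[symmetric] bilinear_def
  by (auto intro!: linearI simp: matrix_vector_mult_def vec_eq_iff sum.distrib sum_distrib_left algebra_simps)

lemmas matvec_simps =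
  bounded_bilinear.add_left[OF bounded_bilinear_matvec] bounded_bilinear.add_right[OF bounded_bilinear_matvec]
  bounded_bilinear.diff_left[OF bounded_bilinear_matvec] bounded_bilinear.diff_right[OF bounded_bilinear_matvec]
  bounded_bilinear.scaleR_left[OF bounded_bilinear_matvec] bounded_bilinear.scaleR_right[OF bounded_bilinear_matvec]
  bounded_bilinear.zero_left[OF bounded_bilinear_matvec] bounded_bilinear.zero_right[OF bounded_bilinear_matvec]

lemma trace_scaleR: "trace (c *\<^sub>R M) = c * trace M" for M :: "real^'n^'n" by (simp add: trace_def sum_distrib_left)

lemma bounded_bilinear_lie_ip: "bounded_bilinear lie_ip"
proof -
  note m = bounded_bilinear.add_left[OF bounded_bilinear_mat] bounded_bilinear.add_right[OF bounded_bilinear_mat]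
        bounded_bilinear.scaleR_left[OF bounded_bilinear_mat] bounded_bilinear.scaleR_right[OF bounded_bilinear_mat]
  have 1: "lie_ip (x + y) z = lie_ip x z + lie_ip y z" for x y z
    unfolding lie_ip_def m trace_add by simp
  have 2: "lie_ip z (x + y) = lie_ip z x + lie_ip z y" for x y z
    unfolding lie_ip_def m trace_add by simp
  have 3: "lie_ip (c *\<^sub>R x) z = c *\<^sub>R lie_ip x z" for c x z
    unfolding lie_ip_def m trace_scaleR by simp
  have 4: "lie_ip z (c *\<^sub>R x) = c *\<^sub>R lie_ip z x" for c x z
    unfolding lie_ip_def m trace_scaleR by simp
  show ?thesis
    unfolding bilinear_conv_bounded_bilinear[symmetric] bilinear_def
    by (intro conjI allI linearI 1 2 3 4)
qed

lemmas lie_ip_simps =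
  bounded_bilinear.add_left[OF bounded_bilinear_lie_ip] bounded_bilinear.add_right[OF bounded_bilinear_lie_ip]
  bounded_bilinear.diff_left[OF bounded_bilinear_lie_ip] bounded_bilinear.diff_right[OF bounded_bilinear_lie_ip]
  bounded_bilinear.scaleR_left[OF bounded_bilinear_lie_ip] bounded_bilinear.scaleR_right[OF bounded_bilinear_lie_ip]
  bounded_bilinear.zero_left[OF bounded_bilinear_lie_ip] bounded_bilinear.zero_right[OF bounded_bilinear_lie_ip]

lemma lie_ip_commute: "lie_ip u v = lie_ip v u"
  unfolding lie_ip_def by (subst trace_mul_sym) (rule refl)

text \<open>The bivector of \<open>p\<close> and \<open>u\<close> turned into an endomorphism; the
  sign in the first column lowers an index with the Lorentz form, so that the result lies in the Lie
  algebra.\<close>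

definition wedge :: "real^4 \<Rightarrow> real^4 \<Rightarrow> real^4^4" where
  "wedge p u = (\<chi> i j. p $ i * (if j = 1 then - u $ j else u $ j) - u $ i * (if j = 1 then - p $ j else p $ j))"

lemma wedge_mult: "wedge p u *v v = lor u v *\<^sub>R p - lor p v *\<^sub>R u"
  by (simp add: wedge_def matrix_vector_mult_def vec_eq_iff sum_4 lor_def algebra_simps)

lemma bounded_bilinear_wedge: "bounded_bilinear wedge"
  unfolding bilinear_conv_bounded_bilinear[symmetric] bilinear_def
  by (auto intro!: linearI simp: wedge_def vec_eq_iff algebra_simps)

lemma lie_ip_wedge: "lie_ip E (wedge p u) = (lor u (E *v p) - lor p (E *v u)) / 2"
  by (simp add: lie_ip_def trace_def matrix_matrix_mult_def matrix_vector_mult_def wedge_def sum_4 lor_def algebra_simps)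

definition skew :: "(real^4^4) set" where
  "skew = {E. \<forall>x y. lor (E *v x) y = - lor x (E *v y)}"

lemma skewD: "E \<in> skew \<Longrightarrow> lor (E *v x) y = - lor x (E *v y)"
  by (simp add: skew_def)

lemma wedge_skew: "wedge p u \<in> skew"
  by (simp add: skew_def wedge_mult lor_simps lor_commute algebra_simps)

text \<open>Pairing with bivectors reads \<open>E\<close> off as a bilinear form. This gives
  nondegeneracy of \<open>lie_ip\<close> on \<open>skew\<close> and reduces later inner products to
  the Lorentz space.\<close>

lemma skew_lie_ip_wedge:
  assumes "E \<in> skew"
  shows "lie_ip E (wedge p u) = lor (E *v p) u"
  using skewD[OF assms, of p u] by (simp add: lie_ip_wedge lor_commute)

lemma subspace_skew: "subspace skew"
  by (auto simp: subspace_def skew_def matvec_simps lor_simps)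

lemma skew_eq_0:
  assumes "E \<in> skew" "\<And>i j. lor (E *v axis i 1) (axis j 1) = 0"
  shows "E = 0"
proof -
  have "E *v axis i 1 = 0" for i by (rule lor_zero_axis[OF assms(2)])
  then have "E $ i $ j = 0" for i j using matrix_vector_mult_basis[of E j] by (simp add: column_def vec_eq_iff)
  then show ?thesis by (simp add: vec_eq_iff)
qed

lemma skew_lie_ip_nondegenerate:
  assumes "E \<in> skew" "\<And>X. X \<in> skew \<Longrightarrow> lie_ip E X = 0"
  shows "E = 0"
  by (rule skew_eq_0[OF assms(1)]) (use assms(2)[OF wedge_skew] skew_lie_ip_wedge[OF assms(1)] in metis)

lemma O13D: "A \<in> O13 \<Longrightarrow> lor (A *v x) (A *v y) = lor x y" "A \<in> O13 \<Longrightarrow> x \<in> hyp3 \<Longrightarrow> A *v x \<in> hyp3"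
  by (auto simp: O13_def)

lemma e1_hyp3: "axis 1 1 \<in> hyp3"
  by (simp add: hyp3_def lor_def axis_def)

text \<open>An isometry preserves the sheets or exchanges them. If the image \<open>?y\<close> of
  some point were on the lower sheet, \<open>- ?y\<close> and \<open>?q\<close> would be on the
  upper one with a positive product, against \<open>hyp3_lor_neg\<close>.\<close>

lemma O13I:
  assumes l: "\<And>x y. lor (A *v x) (A *v y) = lor x y" and e: "(A *v axis 1 1) $ 1 > 0"
  shows "A \<in> O13"
proof -
  let ?q = "A *v axis 1 1"
  have q: "?q \<in> hyp3" using l[of "axis 1 1" "axis 1 1"] e by (simp add: hyp3_def lor_def axis_def)
  have "A *v x \<in> hyp3" if x: "x \<in> hyp3" for x
  proof -
    let ?y = "A *v x"
    have yy: "lor ?y ?y = -1" using l hyp3_first(3)[OF x] by simp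
    have yq: "lor ?y ?q < 0" using l hyp3_lor_neg[OF x e1_hyp3] by simp
    have "?y $ 1 > 0"
    proof (rule ccontr)
      assume "\<not> ?thesis"
      moreover have "?y $ 1 \<noteq> 0"
      proof
        assume "?y $ 1 = 0"
        then have "lor ?y ?y \<ge> 0" by (simp add: lor_def)
        then show False using yy by simp
      qed
      ultimately have "(- ?y) $ 1 > 0" by simp
      then have "- ?y \<in> hyp3" using yy by (simp add: hyp3_def lor_simps)
      from hyp3_lor_neg[OF this q] show False using yq by (simp add: lor_simps)
    qed
    then show ?thesis using yy by (simp add: hyp3_def)
  qed
  then show ?thesis using l by (auto simp: O13_def)
qed

lemma O13_mult: "A \<in> O13 \<Longrightarrow> B \<in> O13 \<Longrightarrow> A ** B \<in> O13"
  by (auto simp: O13_def matrix_vector_mul_assoc[symmetric] image_subset_iff)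

lemma O13_1: "mat 1 \<in> O13"
  by (auto simp: O13_def)

lemma O13_inverse:
  assumes "A \<in> O13"
  shows "A ** matrix_inv A = mat 1" "matrix_inv A ** A = mat 1"
proof -
  have "inj ((*v) A)"
  proof (rule injI)
    fix x y assume "A *v x = A *v y"
    then have "lor (x - y) z = 0" for z
      using O13D(1)[OF assms, of x z] O13D(1)[OF assms, of y z] by (simp add: lor_simps)
    then show "x = y" using lor_nondegenerate[of "x - y"] by simp
  qed
  then have "invertible A" by (simp add: invertible_left_inverse matrix_left_invertible_injective)
  then have "\<exists>B. A ** B = mat 1 \<and> B ** A = mat 1" by (simp add: invertible_def)
  from someI_ex[OF this] show "A ** matrix_inv A = mat 1" "matrix_inv A ** A = mat 1"
    by (simp_all add: matrix_inv_def)
qed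

section \<open>The Lie algebra of the isometry group\<close>

lemma tangent_spaceI: "c 0 = x \<Longrightarrow> (\<And>t. c t \<in> S) \<Longrightarrow> (c has_vector_derivative v) (at 0) \<Longrightarrow> v \<in> tangent_space S x"
  unfolding tangent_space_def by blast

lemma tangent_spaceE:
  assumes "v \<in> tangent_space S x"
  obtains c where "c 0 = x" "\<And>t. c t \<in> S" "(c has_vector_derivative v) (at 0)"
  using assms unfolding tangent_space_def by blast

lemma tangent_space_O13_skew:
  assumes v: "v \<in> tangent_space O13 x"
  shows "lor (v *v a) (x *v b) + lor (x *v a) (v *v b) = 0"
proof -
  obtain c where c: "c 0 = x" "\<And>t. c t \<in> O13" "(c has_vector_derivative v) (at 0)"
    using tangent_spaceE[OF v] by blast
  have d: "((\<lambda>t. c t *v a) has_vector_derivative v *v a) (at 0)" for a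
    by (rule bounded_linear.has_vector_derivative[OF bounded_bilinear.bounded_linear_left[OF bounded_bilinear_matvec] c(3)])
  have "((\<lambda>t. lor (c t *v a) (c t *v b)) has_vector_derivative lor (c 0 *v a) (v *v b) + lor (v *v a) (c 0 *v b)) (at 0)"
    by (rule bounded_bilinear.has_vector_derivative[OF bounded_bilinear_lor d d])
  moreover have "((\<lambda>t. lor (c t *v a) (c t *v b)) has_vector_derivative 0) (at 0)"
    using O13D(1)[OF c(2)] by simp
  ultimately have "lor (c 0 *v a) (v *v b) + lor (v *v a) (c 0 *v b) = 0"
    by (rule vector_derivative_unique_at)
  then show ?thesis by (simp add: c(1) add.commute)
qed

text \<open>The pointwise product of two curves through the identity stays in the group and has the
  sum of the velocities.\<close>

lemma o13_add: "X \<in> o13 \<Longrightarrow> Y \<in> o13 \<Longrightarrow> X + Y \<in> o13"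
proof -
  assume X: "X \<in> o13" and Y: "Y \<in> o13"
  obtain c where c: "c 0 = mat 1" "\<And>t. c t \<in> O13" "(c has_vector_derivative X) (at 0)"
    using tangent_spaceE[OF X[unfolded o13_def]] by blast
  obtain d where d: "d 0 = mat 1" "\<And>t. d t \<in> O13" "(d has_vector_derivative Y) (at 0)"
    using tangent_spaceE[OF Y[unfolded o13_def]] by blast
  have "((\<lambda>t. c t ** d t) has_vector_derivative (c 0 ** Y + X ** d 0)) (at 0)"
    by (rule bounded_bilinear.has_vector_derivative[OF bounded_bilinear_mat c(3) d(3)])
  then show "X + Y \<in> o13"
    unfolding o13_def using c d
    by (intro tangent_spaceI[where c = "\<lambda>t. c t ** d t"]) (auto intro: O13_mult simp: add.commute)
qed

lemma o13_scaleR: "X \<in> o13 \<Longrightarrow> a *\<^sub>R X \<in> o13"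
proof -
  assume X: "X \<in> o13"
  obtain c where c: "c 0 = mat 1" "\<And>t. c t \<in> O13" "(c has_vector_derivative X) (at 0)"
    using tangent_spaceE[OF X[unfolded o13_def]] by blast
  have "((c \<circ> (\<lambda>t. a * t)) has_vector_derivative a *\<^sub>R X) (at 0)"
    by (rule vector_diff_chain_at) (use c(3) in \<open>auto intro!: derivative_eq_intros\<close>)
  then show "a *\<^sub>R X \<in> o13"
    unfolding o13_def using c by (intro tangent_spaceI[where c = "c \<circ> (\<lambda>t. a * t)"]) auto
qed

lemma lor_plane:
  assumes "lor p u = 0"
  shows "lor (x + (\<alpha> *\<^sub>R p + \<beta> *\<^sub>R u)) (y + (\<alpha>' *\<^sub>R p + \<beta>' *\<^sub>R u)) =
    lor x y + \<alpha>' * lor x p + \<beta>' * lor x u + \<alpha> * lor y p + \<beta> * lor y u + \<alpha> * \<alpha>' * lor p p + \<beta> * \<beta>' * lor u u"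
  using assms lor_commute[of p u] lor_commute[of p y] lor_commute[of u y]
  by (simp add: lor_simps distrib_left)

text \<open>The curve is \<open>exp (t W)\<close> for \<open>W = wedge ?p ?u\<close>:
  \<open>W ** W\<close> is the identity on the plane of the two axes and zero on its complement, so
  the exponential series sums to hyperbolic functions.\<close>

lemma boost_in_o13:
  assumes j: "j \<noteq> 1"
  shows "wedge (axis 1 1) (axis j 1) \<in> o13"
proof -
  let ?p = "axis 1 1 :: real^4" and ?u = "axis j 1 :: real^4"
  have pu: "lor ?p ?p = -1" "lor ?u ?u = 1" "lor ?p ?u = 0" "lor ?u ?p = 0"
    using exhaust_4[of j] j by (auto simp: lor_def axis_def)
  define \<alpha> where "\<alpha> t v = lor v ?u * sinh t - lor v ?p * (cosh t - 1)" for t v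
  define \<beta> where "\<beta> t v = lor v ?u * (cosh t - 1) - lor v ?p * sinh t" for t v
  define c where "c t = mat 1 + sinh t *\<^sub>R wedge ?p ?u + (cosh t - 1) *\<^sub>R (wedge ?p ?u ** wedge ?p ?u)" for t :: real
  have cB: "c t *v v = v + (\<alpha> t v *\<^sub>R ?p + \<beta> t v *\<^sub>R ?u)" for t v
    using lor_commute[of ?p v] lor_commute[of ?u v]
    by (simp add: c_def \<alpha>_def \<beta>_def matvec_simps matrix_vector_mul_assoc[symmetric] wedge_mult lor_simps pu algebra_simps)
  have ch: "cosh t * cosh t = 1 + sinh t * sinh t" for t :: real
    using cosh_square_eq[of t] by (simp add: power2_eq_square)
  have "c t \<in> O13" for t
  proof (rule O13I)
    fix x y
    define a b a' b' where "a = lor x ?p" "b = lor x ?u" "a' = lor y ?p" "b' = lor y ?u"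
    show "lor (c t *v x) (c t *v y) = lor x y"
      unfolding cB lor_plane[OF pu(3)] \<alpha>_def \<beta>_def pu a_b_a'_b'_def[symmetric] using ch[of t] by algebra
  next
    have "?p $ 1 = 1" "?u $ 1 = 0" using j by (simp_all add: axis_def)
    then have "(c t *v ?p) $ 1 = cosh t" by (simp add: cB \<alpha>_def \<beta>_def pu)
    then show "0 < (c t *v ?p) $ 1" by simp
  qed
  moreover have "(c has_vector_derivative wedge ?p ?u) (at 0)"
    unfolding c_def has_vector_derivative_def
    by (auto intro!: derivative_eq_intros)
  ultimately show ?thesis
    unfolding o13_def by (intro tangent_spaceI[of c]) (auto simp: c_def)
qed

text \<open>Again the exponential curve, now with \<open>W ** W\<close> minus the identity on the
  plane, hence trigonometric functions. The curves lie in \<open>O3\<close> and serve later as test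
  directions along the fibres of \<open>proj\<close>.\<close>

lemma rotation_curve:
  assumes i: "i \<noteq> 1" and j: "j \<noteq> 1" and ij: "i \<noteq> (j :: 4)"
  obtains c where "c (0::real) = mat 1" "\<And>t. c t \<in> O3" "(c has_vector_derivative wedge (axis i 1) (axis j 1)) (at 0)"
proof -
  let ?p = "axis i 1 :: real^4" and ?u = "axis j 1 :: real^4"
  have pu: "lor ?p ?p = 1" "lor ?u ?u = 1" "lor ?p ?u = 0" "lor ?u ?p = 0"
    using exhaust_4[of j] exhaust_4[of i] i j ij by (auto simp: lor_def axis_def)
  define \<alpha> where "\<alpha> t v = lor v ?u * sin t + lor v ?p * (cos t - 1)" for t v
  define \<beta> where "\<beta> t v = lor v ?u * (cos t - 1) - lor v ?p * sin t" for t v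
  define c where "c t = mat 1 + sin t *\<^sub>R wedge ?p ?u + (1 - cos t) *\<^sub>R (wedge ?p ?u ** wedge ?p ?u)" for t :: real
  have cB: "c t *v v = v + (\<alpha> t v *\<^sub>R ?p + \<beta> t v *\<^sub>R ?u)" for t v
    using lor_commute[of ?p v] lor_commute[of ?u v]
    by (simp add: c_def \<alpha>_def \<beta>_def matvec_simps matrix_vector_mul_assoc[symmetric] wedge_mult lor_simps pu algebra_simps)
  have cs: "cos t * cos t = 1 - sin t * sin t" for t :: real
    using sin_cos_squared_add[of t] by (simp add: power2_eq_square)
  have e1: "lor (axis 1 1) ?p = 0" "lor (axis 1 1) ?u = 0" using i j by (simp_all add: lor_def axis_def)
  have ce: "c t *v axis 1 1 = axis 1 1" for t by (simp add: cB \<alpha>_def \<beta>_def e1)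
  have "c t \<in> O13" for t
  proof (rule O13I)
    fix x y
    define a b a' b' where "a = lor x ?p" "b = lor x ?u" "a' = lor y ?p" "b' = lor y ?u"
    show "lor (c t *v x) (c t *v y) = lor x y"
      unfolding cB lor_plane[OF pu(3)] \<alpha>_def \<beta>_def pu a_b_a'_b'_def[symmetric] using cs[of t] by algebra
  next
    show "0 < (c t *v axis 1 1) $ 1" unfolding ce by (simp add: axis_def)
  qed
  then have "c t \<in> O3" for t using ce by (simp add: O3_def)
  moreover have "(c has_vector_derivative wedge ?p ?u) (at 0)"
    unfolding c_def has_vector_derivative_def
    by (auto intro!: derivative_eq_intros)
  ultimately show thesis by (intro that[of c]) (auto simp: c_def)
qed

lemma rotation_in_o13: "i \<noteq> 1 \<Longrightarrow> j \<noteq> 1 \<Longrightarrow> i \<noteq> j \<Longrightarrow> wedge (axis i 1) (axis j 1) \<in> o13"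
  using rotation_curve[of i j] unfolding o13_def
  by (metis (no_types, lifting) O3_def mem_Collect_eq tangent_spaceI)

definition skew_of :: "real \<times> real \<times> real \<times> real \<times> real \<times> real \<Rightarrow> real^4^4" where
  "skew_of = (\<lambda>(a, b, c, d, e, f). a *\<^sub>R wedge (axis 1 1) (axis 2 1) + b *\<^sub>R wedge (axis 1 1) (axis 3 1)
     + c *\<^sub>R wedge (axis 1 1) (axis 4 1) + d *\<^sub>R wedge (axis 2 1) (axis 3 1) + e *\<^sub>R wedge (axis 2 1) (axis 4 1)
     + f *\<^sub>R wedge (axis 3 1) (axis 4 1))"

lemma skew_eq_skew_of:
  assumes "E \<in> skew"
  shows "E = skew_of (E$1$2, E$1$3, E$1$4, E$2$3, E$2$4, E$3$4)"
proof -
  have col: "E *v axis j 1 = (\<chi> i. E $ i $ j)" for j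
    by (simp add: vec_eq_iff matrix_vector_mult_basis column_def)
  have h: "lor (\<chi> k. E $ k $ i) (axis j 1) = - lor (\<chi> k. E $ k $ j) (axis i 1)" for i j
    using skewD[OF assms, of "axis i 1" "axis j 1"] by (simp add: col lor_commute)
  show ?thesis
    using h[of 1 1] h[of 2 2] h[of 3 3] h[of 4 4] h[of 1 2] h[of 1 3] h[of 1 4] h[of 2 3] h[of 2 4] h[of 3 4]
    by (simp add: skew_of_def wedge_def vec_eq_iff forall_4 axis_def lor_axis[unfolded axis_def])
qed

lemma skew_of_in_o13: "skew_of x \<in> o13"
  unfolding skew_of_def case_prod_unfold
  by (intro o13_add o13_scaleR boost_in_o13 rotation_in_o13) auto

text \<open>Differentiating the invariance of \<open>lor\<close> gives one inclusion. For the other,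
  boosts and rotations span \<open>skew\<close>, and each of them is the velocity of an explicit
  curve.\<close>

lemma o13_eq_skew: "o13 = skew"
proof (intro set_eqI iffI)
  fix E assume "E \<in> o13"
  then show "E \<in> skew"
    using tangent_space_O13_skew[of E "mat 1"] unfolding o13_def skew_def by (simp add: add_eq_0_iff)
next
  fix E assume "E \<in> skew"
  then show "E \<in> o13" using skew_eq_skew_of skew_of_in_o13 by metis
qed

lemma dim_skew: "dim skew = 6"
proof -
  have lin: "linear skew_of"
    by (rule linearI) (auto simp: skew_of_def algebra_simps)
  have "inj skew_of"
    unfolding linear_injective_0[OF lin]
    by (auto simp: skew_of_def wedge_def vec_eq_iff forall_4 axis_def zero_prod_def)
  moreover have "range skew_of = skew"
    using skew_of_in_o13 skew_eq_skew_of unfolding o13_eq_skew by blast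
  ultimately show ?thesis
    using dim_image_eq[OF lin, of UNIV] by (simp add: inj_on_def)
qed

text \<open>Transitivity of the group, by the Lorentz reflection in \<open>p - axis 1 1\<close>,
  which carries one point to the other. That vector is spacelike unless it is zero, and then the
  identity serves.\<close>

lemma exists_O13_over:
  assumes p: "p \<in> hyp3"
  obtains x where "x \<in> O13" "proj x = p"
proof (cases "p = axis 1 1")
  case True
  then show ?thesis using that[OF O13_1] by (simp add: proj_def)
next
  case False
  let ?e = "axis 1 1 :: real^4"
  define d where "d = p - ?e"
  define R where "R v = v - (2 * lor v d / lor d d) *\<^sub>R d" for v
  have lin: "linear R"
    by (rule linearI) (auto simp: R_def lor_simps algebra_simps add_divide_distrib)
  have pe: "lor p p = -1" "lor ?e ?e = -1" "lor ?e p = - p $ 1" "lor p ?e = - p $ 1"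
    using hyp3_first(3)[OF p] by (simp_all add: lor_def axis_def)
  have dd: "lor d d = 2 * (p $ 1 - 1)" by (simp add: d_def lor_simps pe)
  have "p $ 1 \<noteq> 1"
  proof
    assume 1: "p $ 1 = 1"
    then have "(p $ 2)\<^sup>2 + (p $ 3)\<^sup>2 + (p $ 4)\<^sup>2 = 0" using hyp3_first(1)[OF p] by simp
    then have "p $ 2 = 0" "p $ 3 = 0" "p $ 4 = 0" by (auto simp: add_nonneg_eq_0_iff)
    then show False using False 1 by (auto simp: vec_eq_iff forall_4 axis_def)
  qed
  then have dn: "lor d d \<noteq> 0" by (simp add: dd)
  have Re: "R ?e = p"
  proof -
    have "lor ?e d = - (p $ 1 - 1)" by (simp add: d_def lor_simps pe)
    then have "2 * lor ?e d = - lor d d" by (simp add: dd)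
    then have "2 * lor ?e d / lor d d = -1" using dn by simp
    then show ?thesis by (simp add: R_def d_def)
  qed
  have Rl: "lor (R x) (R y) = lor x y" for x y
  proof -
    define i where "i = 1 / lor d d"
    have i: "i * lor d d = 1" using dn by (simp add: i_def)
    have "R v = v - (2 * lor v d * i) *\<^sub>R d" for v by (simp add: R_def i_def)
    then have "lor (R x) (R y) = lor x y - (2 * lor y d * i) * lor x d - (2 * lor x d * i) * lor y d
        + (2 * lor x d * i) * ((2 * lor y d * i) * lor d d)"
      using lor_commute[of d y] by (simp add: lor_simps right_diff_distrib)
    then show ?thesis using i by algebra
  qed
  have mR: "matrix R *v v = R v" for v
    using matrix_vector_mul(2)[OF lin] by metis
  show ?thesis
  proof (rule that[of "matrix R"])
    show "matrix R \<in> O13" by (rule O13I) (simp_all add: mR Rl Re hyp3_first(2)[OF p])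
    show "proj (matrix R) = p" by (simp add: proj_def mR Re)
  qed
qed

text \<open>With \<open>h = wedge p u ** x\<close> the map \<open>ell_inv x\<close> sends \<open>u\<close> to \<open>h\<close>, since \<open>proj\<close> is injective on
  horizontal vectors.\<close>

lemma Gam_eq_wedge:
  assumes p: "p \<in> hyp3" and u: "lor p u = 0"
  shows "Gam p u = wedge p u"
proof -
  define x where "x = (SOME x. x \<in> O13 \<and> proj x = p)"
  have "\<exists>x. x \<in> O13 \<and> proj x = p" using exists_O13_over[OF p] by metis
  then have x: "x \<in> O13" "proj x = p" unfolding x_def by (metis (mono_tags, lifting) someI_ex)+
  note inv = O13_inverse[OF x(1)]
  let ?K = "wedge p u" and ?h = "wedge p u ** x" and ?e = "axis 1 1 :: real^4"
  have xe: "x *v ?e = p" using x(2) by (simp add: proj_def)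
  have blp: "bounded_linear proj"
    unfolding proj_def[abs_def] by (rule bounded_bilinear.bounded_linear_left[OF bounded_bilinear_matvec])
  have dproj: "frechet_derivative proj (at x) = proj"
    by (rule frechet_derivative_eq[OF bounded_linear_imp_has_derivative[OF blp]])
  have K: "?K \<in> o13" unfolding o13_eq_skew by (rule wedge_skew)
  obtain c where c: "c 0 = mat 1" "\<And>t. c t \<in> O13" "(c has_vector_derivative ?K) (at 0)"
    using tangent_spaceE[OF K[unfolded o13_def]] by blast
  have "((\<lambda>t. c t ** x) has_vector_derivative ?h) (at 0)"
    by (rule bounded_linear.has_vector_derivative[OF bounded_bilinear.bounded_linear_left[OF bounded_bilinear_mat] c(3)])
  then have ht: "?h \<in> tangent_space O13 x"
    by (intro tangent_spaceI[where c = "\<lambda>t. c t ** x"]) (use c O13_mult x in auto)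
  \<comment> \<open>Along a fibre the image of \<open>axis 1 1\<close> is constant, so a vertical
    vector annihilates it.\<close>
  have fibre: "v \<in> tangent_space O13 x \<and> v *v ?e = 0" if "v \<in> tangent_space ((\<lambda>k. x ** k) ` O3) x" for v
  proof -
    obtain d where d: "d 0 = x" "\<And>t. d t \<in> (\<lambda>k. x ** k) ` O3" "(d has_vector_derivative v) (at 0)"
      using tangent_spaceE[OF \<open>v \<in> tangent_space ((\<lambda>k. x ** k) ` O3) x\<close>] by blast
    have "d t \<in> O13 \<and> d t *v ?e = p" for t
      using d(2)[of t] O13_mult[OF x(1)] xe by (auto simp: O3_def matrix_vector_mul_assoc[symmetric])
    then have 1: "v \<in> tangent_space O13 x" and 2: "\<And>t. d t *v ?e = p" using d by (auto intro: tangent_spaceI)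
    have "((\<lambda>t. d t *v ?e) has_vector_derivative v *v ?e) (at 0)"
      by (rule bounded_linear.has_vector_derivative[OF bounded_bilinear.bounded_linear_left[OF bounded_bilinear_matvec] d(3)])
    moreover have "((\<lambda>t. d t *v ?e) has_vector_derivative 0) (at 0)" using 2 by simp
    ultimately show ?thesis using 1 vector_derivative_unique_at by blast
  qed
  have hh: "?h \<in> horizontal x"
    unfolding horizontal_def
  proof (intro CollectI conjI ballI ht)
    fix v assume "v \<in> tangent_space ((\<lambda>k. x ** k) ` O3) x"
    from fibre[OF this] have v: "v \<in> tangent_space O13 x" "v *v ?e = 0" by auto
    let ?E = "v ** matrix_inv x"
    have Ex: "?E *v (x *v a) = v *v a" for a
      by (simp add: matrix_vector_mul_assoc matrix_mul_assoc[symmetric] inv)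
    have "group_metric x ?h v = lie_ip (matrix_inv x ** (?K ** x)) (matrix_inv x ** v)" by (simp add: group_metric_def)
    also have "\<dots> = trace (matrix_inv x ** (?K ** v)) / 2"
    proof -
      have "(matrix_inv x ** (?K ** x)) ** (matrix_inv x ** v) = matrix_inv x ** (?K ** ((x ** matrix_inv x) ** v))"
        by (simp only: matrix_mul_assoc)
      then show ?thesis by (simp add: lie_ip_def inv)
    qed
    also have "\<dots> = lie_ip ?E ?K"
      using trace_mul_sym[of "matrix_inv x" "?K ** v"] trace_mul_sym[of ?K ?E] by (simp add: lie_ip_def matrix_mul_assoc)
    also have "\<dots> = (lor u (?E *v p) - lor p (?E *v u)) / 2" by (rule lie_ip_wedge)
    also have "?E *v p = 0" using Ex[of ?e] xe v by simp
    also have "lor p (?E *v u) = 0"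
    proof -
      have "x *v (matrix_inv x *v u) = u" by (simp add: matrix_vector_mul_assoc inv)
      then have "?E *v u = v *v (matrix_inv x *v u)" using Ex by metis
      then show ?thesis
        using tangent_space_O13_skew[OF v(1), of ?e "matrix_inv x *v u"] v(2) xe by (simp add: lor_simps)
    qed
    finally show "group_metric x ?h v = 0" by (simp add: lor_simps)
  qed
  \<comment> \<open>The difference of two horizontal vectors with equal projection, translated back
    to the identity, is skew, annihilates \<open>axis 1 1\<close> and is orthogonal to the
    rotations; these conditions leave only zero.\<close>
  have inj: "inj_on proj (horizontal x)"
  proof (rule inj_onI)
    fix a b assume ab: "a \<in> horizontal x" "b \<in> horizontal x" "proj a = proj b"
    let ?z = "matrix_inv x ** (a - b)"
    have xz: "x *v (?z *v w) = (a - b) *v w" for w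
      by (simp add: matrix_vector_mul_assoc matrix_mul_assoc inv)
    have tan: "lor ((a - b) *v w) (x *v w') + lor (x *v w) ((a - b) *v w') = 0" for w w'
      using tangent_space_O13_skew[of a x w w'] tangent_space_O13_skew[of b x w w'] ab
      by (simp add: horizontal_def matvec_simps lor_simps)
    have sk: "?z \<in> skew"
      unfolding skew_def
    proof (intro CollectI allI)
      fix w w'
      show "lor (?z *v w) w' = - lor w (?z *v w')"
        using tan[of w w'] O13D(1)[OF x(1), of "?z *v w" w'] O13D(1)[OF x(1), of w "?z *v w'"] by (simp add: xz)
    qed
    have ze: "?z *v ?e = 0"
    proof -
      have "(a - b) *v ?e = 0" using ab(3) by (simp add: proj_def matvec_simps)
      moreover have "?z *v ?e = matrix_inv x *v ((a - b) *v ?e)" by (simp add: matrix_vector_mul_assoc)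
      ultimately show ?thesis by (simp add: matvec_simps)
    qed
    have rot: "lor (?z *v axis i 1) (axis j 1) = 0" if ij: "i \<noteq> 1" "j \<noteq> 1" "i \<noteq> j" for i j
    proof -
      let ?W = "wedge (axis i 1) (axis j 1)"
      obtain k where k: "k (0::real) = mat 1" "\<And>t. k t \<in> O3" "(k has_vector_derivative ?W) (at 0)"
        using rotation_curve[OF ij] by blast
      have "((\<lambda>t. x ** k t) has_vector_derivative x ** ?W) (at 0)"
        by (rule bounded_linear.has_vector_derivative[OF bounded_bilinear.bounded_linear_right[OF bounded_bilinear_mat] k(3)])
      then have "x ** ?W \<in> tangent_space ((\<lambda>k. x ** k) ` O3) x"
        by (intro tangent_spaceI[where c = "\<lambda>t. x ** k t"]) (use k in auto)
      then have "group_metric x a (x ** ?W) = 0" "group_metric x b (x ** ?W) = 0"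
        using ab by (auto simp: horizontal_def)
      moreover have "matrix_inv x ** (x ** ?W) = ?W" by (simp add: matrix_mul_assoc inv)
      ultimately have "lie_ip ?z ?W = 0"
        by (simp add: group_metric_def bounded_bilinear.diff_right[OF bounded_bilinear_mat] lie_ip_simps)
      then show ?thesis using skew_lie_ip_wedge[OF sk] by simp
    qed
    have "?z = 0"
    proof (rule skew_eq_0[OF sk])
      fix i j :: 4
      consider "i = 1" | "j = 1" | "i = j" | "i \<noteq> 1" "j \<noteq> 1" "i \<noteq> j" by blast
      then show "lor (?z *v axis i 1) (axis j 1) = 0"
      proof cases
        case 2
        then show ?thesis using skewD[OF sk, of "axis i 1" ?e] ze by (simp add: lor_simps)
      next
        case 3
        then show ?thesis using skewD[OF sk, of "axis i 1" "axis i 1"] by (simp add: lor_commute)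
      qed (use rot ze in \<open>auto simp: lor_simps\<close>)
    qed
    moreover have "x ** ?z = a - b" by (simp add: matrix_mul_assoc inv)
    ultimately show "a = b" by (simp add: bounded_bilinear.zero_right[OF bounded_bilinear_mat])
  qed
  have "proj ?h = u"
    using u hyp3_first(3)[OF p] by (simp add: proj_def matrix_vector_mul_assoc[symmetric] xe wedge_mult lor_commute)
  then have "ell_inv x u = ?h"
    unfolding ell_inv_def dproj using hh inj by (intro inv_into_f_eq)
  moreover have "frechet_derivative (\<lambda>z. z ** matrix_inv x) (at x) = (\<lambda>z. z ** matrix_inv x)"
    by (rule frechet_derivative_eq[OF bounded_linear_imp_has_derivative[OF bounded_bilinear.bounded_linear_left[OF bounded_bilinear_mat]]])
  moreover have "?h ** matrix_inv x = ?K" by (simp add: matrix_mul_assoc[symmetric] inv)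
  ultimately show ?thesis by (simp add: Gam_def x_def[symmetric] Let_def)
qed

section \<open>The tension field of a map into the pseudo-sphere\<close>

lemma smooth_on_pd: "smooth_on S f \<Longrightarrow> smooth_on S (pd i f)"
  unfolding pd_def[abs_def] by (rule smooth_on_frechet_derivative)

lemma pd_cong:
  assumes "open S" "x \<in> S" "\<And>y. y \<in> S \<Longrightarrow> f y = g y"
  shows "pd i f x = pd i g x"
  unfolding pd_def by (rule fun_cong[OF frechet_cong_open[OF assms]])

lemma pd_commute:
  fixes f :: "real^'n \<Rightarrow> 'b::euclidean_space"
  assumes "open S" "x \<in> S" "smooth_on S f"
  shows "pd i (pd j f) x = pd j (pd i f) x"
  unfolding pd_def[abs_def] by (rule symmetric_second_derivative[OF assms])

lemma pd_const: "pd i (\<lambda>_. c) x = 0"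
  by (simp add: pd_def)

lemma pd_bilinear:
  assumes B: "bounded_bilinear B" and "f differentiable (at x)" "g differentiable (at x)"
  shows "pd i (\<lambda>y. B (f y) (g y)) x = B (f x) (pd i g x) + B (pd i f x) (g x)"
  unfolding pd_def
  using bounded_bilinear.FDERIV[OF B assms(2,3)[unfolded frechet_derivative_works]]
  by (simp add: frechet_derivative_eq)

lemma pd_linear:
  assumes "bounded_linear L" "f differentiable (at x)"
  shows "pd i (\<lambda>y. L (f y)) x = L (pd i f x)"
  unfolding pd_def by (rule frechet_derivative_bounded_linear[OF assms])

lemma pd_add:
  assumes "f differentiable (at x)" "g differentiable (at x)"
  shows "pd i (\<lambda>y. f y + g y) x = pd i f x + pd i g x"
  unfolding pd_def using has_derivative_add[OF assms[unfolded frechet_derivative_works]]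
  by (simp add: frechet_derivative_eq)

lemma pd_sum:
  assumes "\<And>k. k \<in> I \<Longrightarrow> f k differentiable (at x)"
  shows "pd i (\<lambda>y. \<Sum>k\<in>I. f k y) x = (\<Sum>k\<in>I. pd i (f k) x)"
proof -
  have "((\<lambda>y. \<Sum>k\<in>I. f k y) has_derivative (\<lambda>h. \<Sum>k\<in>I. frechet_derivative (f k) (at x) h)) (at x)"
    by (rule has_derivative_sum) (use assms frechet_derivative_works in blast)
  from frechet_derivative_eq[OF this] show ?thesis by (simp add: pd_def)
qed

lemma frechet_pd_expansion:
  fixes f :: "real^'n \<Rightarrow> 'b::real_normed_vector"
  assumes "f differentiable (at x)"
  shows "frechet_derivative f (at x) v = (\<Sum>i\<in>UNIV. v $ i *\<^sub>R pd i f x)"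
proof -
  have "linear (frechet_derivative f (at x))" using assms linear_frechet_derivative by blast
  from linear_sum[OF this, of "\<lambda>i. v $ i *\<^sub>R axis i 1" UNIV]
  show ?thesis
    using basis_expansion[of v] by (simp add: pd_def linear_cmul[OF \<open>linear _\<close>] scalar_mult_eq_scaleR)
qed

lemma pd_compose:
  fixes u :: "real^'m \<Rightarrow> real^'n"
  assumes "u differentiable (at x)" "\<psi> differentiable (at (u x))"
  shows "pd i (\<lambda>y. \<psi> (u y)) x = (\<Sum>a\<in>UNIV. pd i u x $ a *\<^sub>R pd a \<psi> (u x))"
proof -
  have "((\<lambda>y. \<psi> (u y)) has_derivative (\<lambda>v. frechet_derivative \<psi> (at (u x)) (frechet_derivative u (at x) v))) (at x)"
    by (rule has_derivative_compose[OF assms[unfolded frechet_derivative_works]])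
  then show ?thesis
    unfolding pd_def[of i "\<lambda>y. \<psi> (u y)"]
    by (simp add: frechet_derivative_eq frechet_pd_expansion[OF assms(2)] pd_def[of i u])
qed

lemma invertible_matrix_inv:
  assumes "invertible A"
  shows "A ** matrix_inv A = mat 1" "matrix_inv A ** A = mat 1"
  using assms someI_ex[of "\<lambda>B. A ** B = mat 1 \<and> B ** A = mat 1"]
  by (simp_all add: invertible_def matrix_inv_def)

text \<open>The Koszul formula: by symmetry of second derivatives, the derivatives of the metric
  coefficients combine to twice the product of \<open>pd i (pd j \<Phi>)\<close> with a coordinate
  vector. Contraction with the metric cancels the inverse inside \<open>christoffel\<close>.\<close>

lemma christoffel_lower:
  fixes \<Phi> :: "real^'n \<Rightarrow> 'b::euclidean_space"
  assumes B: "bounded_bilinear B" "\<And>x y. B x y = B y x" and S: "open S" "x \<in> S" and \<Phi>: "smooth_on S \<Phi>"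
    and inv: "invertible (induced_metric B \<Phi> x)"
  shows "(\<Sum>k\<in>UNIV. christoffel (induced_metric B \<Phi>) x k i j * B (pd k \<Phi> x) (pd d \<Phi> x)) = B (pd i (pd j \<Phi>) x) (pd d \<Phi> x)"
proof -
  let ?g = "induced_metric B \<Phi>"
  note diff = smooth_on_differentiable[OF smooth_on_pd[OF \<Phi>] S(2)]
  have dg: "pd i (\<lambda>y. ?g y $ j $ l) x = B (pd j \<Phi> x) (pd i (pd l \<Phi>) x) + B (pd i (pd j \<Phi>) x) (pd l \<Phi> x)" for i j l
    unfolding induced_metric_def using pd_bilinear[OF B(1) diff diff] by simp
  have c: "christoffel ?g x k i j = (\<Sum>l\<in>UNIV. matrix_inv (?g x) $ k $ l * B (pd i (pd j \<Phi>) x) (pd l \<Phi> x))" for k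
  proof -
    have "pd i (\<lambda>y. ?g y $ j $ l) x + pd j (\<lambda>y. ?g y $ i $ l) x - pd l (\<lambda>y. ?g y $ i $ j) x
        = 2 * B (pd i (pd j \<Phi>) x) (pd l \<Phi> x)" for l
      unfolding dg using pd_commute[OF S \<Phi>, of i j] pd_commute[OF S \<Phi>, of l j] pd_commute[OF S \<Phi>, of i l]
        B(2)[of "pd j \<Phi> x"] B(2)[of "pd i \<Phi> x"] by simp
    then show ?thesis by (simp add: christoffel_def sum_divide_distrib sum_distrib_left)
  qed
  have "(\<Sum>k\<in>UNIV. christoffel ?g x k i j * B (pd k \<Phi> x) (pd d \<Phi> x))
      = (\<Sum>k\<in>UNIV. \<Sum>l\<in>UNIV. B (pd i (pd j \<Phi>) x) (pd l \<Phi> x) * (?g x $ d $ k * matrix_inv (?g x) $ k $ l))"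
    unfolding c by (simp add: sum_distrib_left sum_distrib_right induced_metric_def B(2)[of "pd d \<Phi> x"] mult_ac)
  also have "\<dots> = (\<Sum>l\<in>UNIV. B (pd i (pd j \<Phi>) x) (pd l \<Phi> x) * (?g x ** matrix_inv (?g x)) $ d $ l)"
    by (subst sum.swap) (simp add: matrix_matrix_mult_def sum_distrib_left)
  also have "\<dots> = B (pd i (pd j \<Phi>) x) (pd d \<Phi> x)"
    by (simp add: invertible_matrix_inv[OF inv] mat_def if_distrib cong: if_cong)
  finally show ?thesis .
qed

text \<open>The Laplace-Beltrami operator of \<open>g\<close> applied to a map into a vector space,
  i.e. the tension field for a flat target.\<close>

definition second_form_trace :: "(real^'m::finite \<Rightarrow> real^'m^'m) \<Rightarrow> (real^'m \<Rightarrow> 'b::real_normed_vector) \<Rightarrow> real^'m \<Rightarrow> 'b" where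
  "second_form_trace g N x = (\<Sum>i\<in>UNIV. \<Sum>j\<in>UNIV. matrix_inv (g x) $ i $ j *\<^sub>R
     (pd i (pd j N) x - (\<Sum>k\<in>UNIV. christoffel g x k i j *\<^sub>R pd k N x)))"

text \<open>Lowering the index with the target metric replaces its Christoffel symbols by second
  derivatives of \<open>\<psi>\<close>, which the chain rule combines with those of \<open>u\<close>
  into the second derivatives of \<open>N\<close>. So the tension field is the tangential part of
  the Laplacian of \<open>N\<close> in the ambient space, for an indefinite \<open>B\<close> as
  well.\<close>

lemma tension_lower:
  fixes u :: "real^'m \<Rightarrow> real^'n" and \<psi> :: "real^'n \<Rightarrow> 'b::euclidean_space"
  assumes B: "bounded_bilinear B" "\<And>x y. B x y = B y x"
    and W: "open W" "smooth_on W \<psi>" and V: "open V" "x \<in> V" and u: "smooth_on V u" "u ` V \<subseteq> W"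
    and N: "\<And>y. y \<in> V \<Longrightarrow> N y = \<psi> (u y)"
    and inv: "invertible (induced_metric B \<psi> (u x))"
  shows "(\<Sum>c\<in>UNIV. tension g (induced_metric B \<psi>) u x $ c * B (pd c \<psi> (u x)) (pd d \<psi> (u x)))
       = B (second_form_trace g N x) (pd d \<psi> (u x))"
proof -
  let ?h = "induced_metric B \<psi>" and ?\<psi>d = "pd d \<psi> (u x)"
  have uW: "u y \<in> W" if "y \<in> V" for y using u(2) that by auto
  note du = smooth_on_differentiable[OF u(1)]
  note dpu = smooth_on_differentiable[OF smooth_on_pd[OF u(1)] V(2)]
  have uc: "pd j (\<lambda>y. u y $ c) y = pd j u y $ c" if "y \<in> V" for j c y
    by (rule pd_linear[OF bounded_linear_vec_nth du[OF that]])
  have ucc: "pd i (pd j (\<lambda>y. u y $ c)) x = pd i (pd j u) x $ c" for i j c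
  proof -
    have "pd i (pd j (\<lambda>y. u y $ c)) x = pd i (\<lambda>y. pd j u y $ c) x"
      by (rule pd_cong[OF V]) (rule uc)
    also have "\<dots> = pd i (pd j u) x $ c" by (rule pd_linear[OF bounded_linear_vec_nth dpu])
    finally show ?thesis .
  qed
  have N1: "pd j N y = (\<Sum>c\<in>UNIV. pd j u y $ c *\<^sub>R pd c \<psi> (u y))" if y: "y \<in> V" for j y
  proof -
    have "pd j N y = pd j (\<lambda>y. \<psi> (u y)) y" by (rule pd_cong[OF V(1) y N])
    then show ?thesis
      using pd_compose[OF du[OF y] smooth_on_differentiable[OF W(2) uW[OF y]]] by simp
  qed
  have N2: "pd i (pd j N) x = (\<Sum>c\<in>UNIV. pd i (pd j u) x $ c *\<^sub>R pd c \<psi> (u x))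
      + (\<Sum>c\<in>UNIV. \<Sum>a\<in>UNIV. (pd i u x $ a * pd j u x $ c) *\<^sub>R pd a (pd c \<psi>) (u x))" for i j
  proof -
    have s1: "smooth_on V (\<lambda>y. pd j u y $ c)" for c by (rule smooth_on_nth[OF V(1) smooth_on_pd[OF u(1)]])
    have s2: "smooth_on V (\<lambda>y. pd c \<psi> (u y))" for c
      by (rule smooth_on_compose[OF V(1) W(1) u(2) smooth_on_pd[OF W(2)] u(1)])
    note d1 = smooth_on_differentiable[OF s1 V(2)] and d2 = smooth_on_differentiable[OF s2 V(2)]
    have "pd i (pd j N) x = pd i (\<lambda>y. \<Sum>c\<in>UNIV. pd j u y $ c *\<^sub>R pd c \<psi> (u y)) x"
      by (rule pd_cong[OF V]) (rule N1)
    also have "\<dots> = (\<Sum>c\<in>UNIV. pd i (\<lambda>y. pd j u y $ c *\<^sub>R pd c \<psi> (u y)) x)"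
      by (rule pd_sum) (rule smooth_on_differentiable[OF smooth_on_scaleR[OF V(1) s1 s2] V(2)])
    also have "\<dots> = (\<Sum>c\<in>UNIV. pd j u x $ c *\<^sub>R pd i (\<lambda>y. pd c \<psi> (u y)) x + pd i (\<lambda>y. pd j u y $ c) x *\<^sub>R pd c \<psi> (u x))"
      by (intro sum.cong refl pd_bilinear[OF bounded_bilinear_scaleR d1 d2])
    also have "\<dots> = (\<Sum>c\<in>UNIV. pd j u x $ c *\<^sub>R (\<Sum>a\<in>UNIV. pd i u x $ a *\<^sub>R pd a (pd c \<psi>) (u x)) + pd i (pd j u) x $ c *\<^sub>R pd c \<psi> (u x))"
      by (intro sum.cong refl arg_cong2[of _ _ _ _ "(+)"] arg_cong2[of _ _ _ _ "(*\<^sub>R)"] pd_linear[OF bounded_linear_vec_nth dpu]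
          pd_compose[OF du[OF V(2)] smooth_on_differentiable[OF smooth_on_pd[OF W(2)] uW[OF V(2)]]])
    finally show ?thesis by (simp add: sum.distrib scaleR_sum_right mult.commute add.commute)
  qed
  define q where "q i j c = pd i (pd j u) x $ c - (\<Sum>k\<in>UNIV. christoffel g x k i j * pd k u x $ c)
      + (\<Sum>a\<in>UNIV. \<Sum>b\<in>UNIV. christoffel ?h (u x) c a b * pd i u x $ a * pd j u x $ b)" for i j c
  have t: "tension g ?h u x $ c = (\<Sum>i\<in>UNIV. \<Sum>j\<in>UNIV. matrix_inv (g x) $ i $ j * q i j c)" for c
    unfolding tension_def q_def by (simp add: uc[OF V(2)] ucc)
  note Bs = bounded_bilinear.add_left[OF B(1)] bounded_bilinear.diff_left[OF B(1)]
    bounded_bilinear.sum_left[OF B(1)] bounded_bilinear.scaleR_left[OF B(1)]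
  have ij: "(\<Sum>c\<in>UNIV. q i j c * B (pd c \<psi> (u x)) ?\<psi>d)
      = B (pd i (pd j N) x - (\<Sum>k\<in>UNIV. christoffel g x k i j *\<^sub>R pd k N x)) ?\<psi>d" for i j
  proof -
    let ?b = "\<lambda>c. B (pd c \<psi> (u x)) ?\<psi>d"
    have 1: "(\<Sum>c\<in>UNIV. (\<Sum>k\<in>UNIV. christoffel g x k i j * pd k u x $ c) * ?b c)
        = (\<Sum>k\<in>UNIV. christoffel g x k i j * (\<Sum>c\<in>UNIV. pd k u x $ c * ?b c))"
      by (simp only: sum_distrib_left sum_distrib_right mult.assoc) (rule sum.swap)
    have 2: "(\<Sum>c\<in>UNIV. (\<Sum>a\<in>UNIV. \<Sum>b\<in>UNIV. christoffel ?h (u x) c a b * pd i u x $ a * pd j u x $ b) * ?b c)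
        = (\<Sum>c\<in>UNIV. \<Sum>a\<in>UNIV. (pd i u x $ a * pd j u x $ c) * B (pd a (pd c \<psi>) (u x)) ?\<psi>d)"
    proof -
      have "(\<Sum>c\<in>UNIV. (\<Sum>a\<in>UNIV. \<Sum>b\<in>UNIV. christoffel ?h (u x) c a b * pd i u x $ a * pd j u x $ b) * ?b c)
        = (\<Sum>c\<in>UNIV. \<Sum>a\<in>UNIV. \<Sum>b\<in>UNIV. (pd i u x $ a * pd j u x $ b) * (christoffel ?h (u x) c a b * ?b c))"
        unfolding sum_distrib_right by (intro sum.cong refl) (simp only: mult_ac)
      also have "\<dots> = (\<Sum>a\<in>UNIV. \<Sum>c\<in>UNIV. \<Sum>b\<in>UNIV. (pd i u x $ a * pd j u x $ b) * (christoffel ?h (u x) c a b * ?b c))"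
        by (rule sum.swap)
      also have "\<dots> = (\<Sum>a\<in>UNIV. \<Sum>b\<in>UNIV. \<Sum>c\<in>UNIV. (pd i u x $ a * pd j u x $ b) * (christoffel ?h (u x) c a b * ?b c))"
        by (intro sum.cong refl sum.swap)
      also have "\<dots> = (\<Sum>a\<in>UNIV. \<Sum>b\<in>UNIV. (pd i u x $ a * pd j u x $ b) * B (pd a (pd b \<psi>) (u x)) ?\<psi>d)"
        by (simp only: sum_distrib_left[symmetric] christoffel_lower[OF B W(1) uW[OF V(2)] W(2) inv])
      also have "\<dots> = (\<Sum>b\<in>UNIV. \<Sum>a\<in>UNIV. (pd i u x $ a * pd j u x $ b) * B (pd a (pd b \<psi>) (u x)) ?\<psi>d)"
        by (rule sum.swap)
      finally show ?thesis .
    qed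
    have "(\<Sum>c\<in>UNIV. q i j c * ?b c) = (\<Sum>c\<in>UNIV. pd i (pd j u) x $ c * ?b c)
        - (\<Sum>c\<in>UNIV. (\<Sum>k\<in>UNIV. christoffel g x k i j * pd k u x $ c) * ?b c)
        + (\<Sum>c\<in>UNIV. (\<Sum>a\<in>UNIV. \<Sum>b\<in>UNIV. christoffel ?h (u x) c a b * pd i u x $ a * pd j u x $ b) * ?b c)"
      unfolding q_def by (simp only: distrib_right left_diff_distrib sum.distrib sum_subtractf)
    also have "\<dots> = B (pd i (pd j N) x - (\<Sum>k\<in>UNIV. christoffel g x k i j *\<^sub>R pd k N x)) ?\<psi>d"
      unfolding 1 2 N2 N1[OF V(2)] by (simp add: Bs)
    finally show ?thesis .
  qed
  have "(\<Sum>c\<in>UNIV. tension g ?h u x $ c * B (pd c \<psi> (u x)) ?\<psi>d)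
     = (\<Sum>c\<in>UNIV. \<Sum>i\<in>UNIV. \<Sum>j\<in>UNIV. matrix_inv (g x) $ i $ j * (q i j c * B (pd c \<psi> (u x)) ?\<psi>d))"
    unfolding t by (simp add: sum_distrib_right mult.assoc)
  also have "\<dots> = (\<Sum>i\<in>UNIV. \<Sum>c\<in>UNIV. \<Sum>j\<in>UNIV. matrix_inv (g x) $ i $ j * (q i j c * B (pd c \<psi> (u x)) ?\<psi>d))"
    by (rule sum.swap)
  also have "\<dots> = (\<Sum>i\<in>UNIV. \<Sum>j\<in>UNIV. \<Sum>c\<in>UNIV. matrix_inv (g x) $ i $ j * (q i j c * B (pd c \<psi> (u x)) ?\<psi>d))"
    by (intro sum.cong refl sum.swap)
  also have "\<dots> = (\<Sum>i\<in>UNIV. \<Sum>j\<in>UNIV. matrix_inv (g x) $ i $ j * (\<Sum>c\<in>UNIV. q i j c * B (pd c \<psi> (u x)) ?\<psi>d))"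
    by (simp only: sum_distrib_left)
  also have "\<dots> = B (second_form_trace g N x) ?\<psi>d"
    unfolding ij second_form_trace_def by (simp only: Bs real_scaleR_def)
  finally show ?thesis .
qed

section \<open>Charts of the pseudo-sphere\<close>

lemma S5_iff: "E \<in> S5 \<longleftrightarrow> E \<in> skew \<and> lie_ip E E = 1"
  by (simp add: S5_def o13_eq_skew)

lemma S5_parametrizationD:
  assumes "S5_parametrization W \<psi>"
  shows "open W" "smooth_on W \<psi>" "y \<in> W \<Longrightarrow> \<psi> y \<in> skew" "y \<in> W \<Longrightarrow> lie_ip (\<psi> y) (\<psi> y) = 1"
    "y \<in> W \<Longrightarrow> inj (frechet_derivative \<psi> (at y))"
  using assms by (auto simp: S5_parametrization_def S5_iff image_subset_iff)

lemma S5_parametrization_tangent: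
  assumes p: "S5_parametrization W \<psi>" and y: "y \<in> W"
  shows "frechet_derivative \<psi> (at y) v \<in> skew" "lie_ip (frechet_derivative \<psi> (at y) v) (\<psi> y) = 0"
proof -
  note P = S5_parametrizationD[OF p]
  note d = smooth_on_differentiable[OF P(2) y]
  note bl = bounded_bilinear.bounded_linear_left[OF bounded_bilinear_matvec]
  have L: "bounded_linear (\<lambda>E. lor (E *v a) b + lor a (E *v b))" for a b
    by (intro bounded_linear_add
        bounded_linear_compose[OF bounded_bilinear.bounded_linear_left[OF bounded_bilinear_lor] bl]
        bounded_linear_compose[OF bounded_bilinear.bounded_linear_right[OF bounded_bilinear_lor] bl])
  have "lor (frechet_derivative \<psi> (at y) v *v a) b + lor a (frechet_derivative \<psi> (at y) v *v b) = 0" for a b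
  proof -
    have "frechet_derivative (\<lambda>y. lor (\<psi> y *v a) b + lor a (\<psi> y *v b)) (at y) = frechet_derivative (\<lambda>_. 0) (at y)"
      by (rule frechet_cong_open[OF P(1) y]) (use skewD[OF P(3)] in simp)
    then show ?thesis using frechet_derivative_bounded_linear[OF L d, of a b v] by simp
  qed
  then show "frechet_derivative \<psi> (at y) v \<in> skew" by (simp add: skew_def add_eq_0_iff)
  have "frechet_derivative (\<lambda>y. lie_ip (\<psi> y) (\<psi> y)) (at y) = frechet_derivative (\<lambda>_. 1) (at y)"
    by (rule frechet_cong_open[OF P(1) y]) (use P(4) in simp)
  moreover have "frechet_derivative (\<lambda>y. lie_ip (\<psi> y) (\<psi> y)) (at y) v
      = lie_ip (\<psi> y) (frechet_derivative \<psi> (at y) v) + lie_ip (frechet_derivative \<psi> (at y) v) (\<psi> y)"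
    using bounded_bilinear.FDERIV[OF bounded_bilinear_lie_ip d[unfolded frechet_derivative_works] d[unfolded frechet_derivative_works]]
    by (simp add: frechet_derivative_eq)
  ultimately show "lie_ip (frechet_derivative \<psi> (at y) v) (\<psi> y) = 0"
    using lie_ip_commute[of "\<psi> y" "frechet_derivative \<psi> (at y) v"] by simp
qed

text \<open>Dimension count: the image of the derivative has dimension 5, and
  \<open>\<psi> y\<close> lies outside it, having norm 1 and being orthogonal to it. Together they
  fill the six-dimensional \<open>skew\<close>.\<close>

lemma S5_parametrization_span:
  assumes p: "S5_parametrization W \<psi>" and y: "y \<in> W" and E: "E \<in> skew" "lie_ip E (\<psi> y) = 0"
  obtains v where "E = frechet_derivative \<psi> (at y) v"
proof -
  note P = S5_parametrizationD[OF p]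
  let ?d = "frechet_derivative \<psi> (at y)"
  have lin: "linear ?d" by (rule linear_frechet_derivative[OF smooth_on_differentiable[OF P(2) y]])
  let ?R = "range ?d"
  have sR: "subspace ?R" by (rule linear_subspace_image[OF lin subspace_UNIV])
  have dimR: "dim ?R = 5"
    using dim_image_eq[OF lin, of UNIV] P(5)[OF y] by simp
  have nR: "\<psi> y \<notin> ?R" using S5_parametrization_tangent(2)[OF p y] P(4)[OF y] by auto
  have "dim (insert (\<psi> y) ?R) = 6"
    using nR dimR by (simp add: dim_insert span_eq_iff[THEN iffD2, OF sR])
  moreover have "insert (\<psi> y) ?R \<subseteq> skew" using S5_parametrization_tangent(1)[OF p y] P(3)[OF y] by auto
  ultimately have "span (insert (\<psi> y) ?R) = skew"
    using subspace_skew dim_skew by (intro subspace_dim_equal) (auto simp: span_minimal)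
  then have "E \<in> span (insert (\<psi> y) ?R)" using E by simp
  then obtain k where "E - k *\<^sub>R \<psi> y \<in> span ?R" by (auto simp: span_insert)
  then obtain v where v: "E - k *\<^sub>R \<psi> y = ?d v" using span_eq_iff[THEN iffD2, OF sR] by auto
  have "lie_ip (E - k *\<^sub>R \<psi> y) (\<psi> y) = 0" unfolding v by (rule S5_parametrization_tangent(2)[OF p y])
  then have "k = 0" using E P(4)[OF y] by (simp add: lie_ip_simps)
  then show thesis using v that by simp
qed

text \<open>As \<open>lie_ip\<close> is indefinite, nondegeneracy is not automatic. A tangent vector
  orthogonal to all tangent vectors is also orthogonal to the position, hence to all of
  \<open>skew\<close>, where \<open>lie_ip\<close> is nondegenerate.\<close>

lemma S5_parametrization_invertible:
  assumes p: "S5_parametrization W \<psi>" and y: "y \<in> W"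
  shows "invertible (induced_metric lie_ip \<psi> y)"
proof -
  note P = S5_parametrizationD[OF p]
  note d = smooth_on_differentiable[OF P(2) y]
  let ?d = "frechet_derivative \<psi> (at y)"
  have "inj ((*v) (induced_metric lie_ip \<psi> y))"
  proof (subst linear_injective_0[OF matrix_vector_mul_linear], intro allI impI)
    fix v assume v: "induced_metric lie_ip \<psi> y *v v = 0"
    have 1: "lie_ip (pd i \<psi> y) (?d v) = 0" for i
    proof -
      have "lie_ip (pd i \<psi> y) (?d v) = (induced_metric lie_ip \<psi> y *v v) $ i"
        unfolding frechet_pd_expansion[OF d]
        by (simp add: bounded_bilinear.sum_right[OF bounded_bilinear_lie_ip] lie_ip_simps matrix_vector_mult_def
            induced_metric_def mult.commute)
      then show ?thesis using v by simp
    qed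
    have "?d v = 0"
    proof (rule skew_lie_ip_nondegenerate[OF S5_parametrization_tangent(1)[OF p y]])
      fix X assume X: "X \<in> skew"
      let ?k = "lie_ip X (\<psi> y)"
      have X': "X - ?k *\<^sub>R \<psi> y \<in> skew"
        using X P(3)[OF y] subspace_skew by (simp add: subspace_diff subspace_scale)
      obtain w where w: "X - ?k *\<^sub>R \<psi> y = ?d w"
        by (rule S5_parametrization_span[OF p y X']) (auto simp: lie_ip_simps P(4)[OF y])
      have "lie_ip (?d w) (?d v) = 0"
        unfolding frechet_pd_expansion[OF d, of w]
        by (simp add: bounded_bilinear.sum_left[OF bounded_bilinear_lie_ip] lie_ip_simps 1)
      then have "lie_ip (?d v) (X - ?k *\<^sub>R \<psi> y) = 0" unfolding w by (simp only: lie_ip_commute[of "?d v"])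
      then show "lie_ip (?d v) X = 0"
        by (simp add: lie_ip_simps S5_parametrization_tangent(2)[OF p y])
    qed
    then show "v = 0"
      using P(5)[OF y] linear_injective_0[OF linear_frechet_derivative[OF d]] by blast
  qed
  then show ?thesis by (simp add: invertible_left_inverse matrix_left_invertible_injective)
qed

text \<open>The coordinate vectors of the chart span the orthogonal complement of \<open>N x\<close>
  in \<open>skew\<close>, and the target metric is invertible. The tension thus vanishes under a
  condition in which the chart no longer occurs.\<close>

lemma tension_eq_0_iff:
  fixes u :: "real^'m \<Rightarrow> real^5"
  assumes p: "S5_parametrization W \<psi>" and V: "open V" "x \<in> V" and u: "smooth_on V u" "u ` V \<subseteq> W"
    and N: "\<And>y. y \<in> V \<Longrightarrow> N y = \<psi> (u y)"
  shows "tension g (induced_metric lie_ip \<psi>) u x = 0 \<longleftrightarrow>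
    (\<forall>E\<in>skew. lie_ip E (N x) = 0 \<longrightarrow> lie_ip (second_form_trace g N x) E = 0)"
proof -
  note P = S5_parametrizationD[OF p]
  have ux: "u x \<in> W" using u V by auto
  note inv = S5_parametrization_invertible[OF p ux]
  let ?h = "induced_metric lie_ip \<psi> (u x)" and ?t = "tension g (induced_metric lie_ip \<psi>) u x"
  have low: "lie_ip (second_form_trace g N x) (pd d \<psi> (u x)) = (?t v* ?h) $ d" for d
    using tension_lower[OF bounded_bilinear_lie_ip lie_ip_commute P(1,2) V u N inv, of g d]
    by (simp add: vector_matrix_mult_def induced_metric_def mult.commute)
  have "?t = 0 \<longleftrightarrow> ?t v* ?h = 0"
  proof
    assume "?t v* ?h = 0"
    then have "(?t v* ?h) v* matrix_inv ?h = 0" by simp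
    then show "?t = 0" by (simp add: vector_matrix_mul_assoc invertible_matrix_inv[OF inv])
  qed simp
  also have "\<dots> \<longleftrightarrow> (\<forall>d. lie_ip (second_form_trace g N x) (pd d \<psi> (u x)) = 0)"
    by (simp add: low vec_eq_iff)
  also have "\<dots> \<longleftrightarrow> (\<forall>E\<in>skew. lie_ip E (N x) = 0 \<longrightarrow> lie_ip (second_form_trace g N x) E = 0)"
  proof
    assume z: "\<forall>d. lie_ip (second_form_trace g N x) (pd d \<psi> (u x)) = 0"
    show "\<forall>E\<in>skew. lie_ip E (N x) = 0 \<longrightarrow> lie_ip (second_form_trace g N x) E = 0"
    proof (intro ballI impI)
      fix E assume E: "E \<in> skew" "lie_ip E (N x) = 0"
      obtain v where v: "E = frechet_derivative \<psi> (at (u x)) v"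
        using S5_parametrization_span[OF p ux E(1)] E(2) N[OF V(2)] by metis
      show "lie_ip (second_form_trace g N x) E = 0"
        unfolding v frechet_pd_expansion[OF smooth_on_differentiable[OF P(2) ux]]
        by (simp add: bounded_bilinear.sum_right[OF bounded_bilinear_lie_ip] lie_ip_simps z)
    qed
  next
    assume "\<forall>E\<in>skew. lie_ip E (N x) = 0 \<longrightarrow> lie_ip (second_form_trace g N x) E = 0"
    then show "\<forall>d. lie_ip (second_form_trace g N x) (pd d \<psi> (u x)) = 0"
      using S5_parametrization_tangent[OF p ux] N[OF V(2)] unfolding pd_def by metis
  qed
  finally show ?thesis .
qed

lemma S5_complement_coordinates:
  assumes V0: "V0 \<in> S5"
  obtains L :: "real^5 \<Rightarrow> real^4^4" and L' where "linear L" "range L = {E \<in> skew. lie_ip E V0 = 0}" "linear L'" "\<And>y. L' (L y) = y"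
proof -
  have V: "V0 \<in> skew" "lie_ip V0 V0 = 1" using V0 by (auto simp: S5_iff)
  let ?K = "{E \<in> skew. lie_ip E V0 = 0}"
  have sK: "subspace ?K"
    using subspace_skew by (auto simp: subspace_def lie_ip_simps)
  have VK: "V0 \<notin> span ?K" using V by (simp add: span_eq_iff[THEN iffD2, OF sK])
  have "span (insert V0 ?K) = skew"
  proof
    show "span (insert V0 ?K) \<subseteq> skew" by (rule span_minimal[OF _ subspace_skew]) (use V in auto)
    show "skew \<subseteq> span (insert V0 ?K)"
    proof
      fix E assume E: "E \<in> skew"
      have "E - lie_ip E V0 *\<^sub>R V0 \<in> ?K"
        using E V subspace_skew by (simp add: subspace_diff subspace_scale lie_ip_simps)
      then show "E \<in> span (insert V0 ?K)" unfolding span_insert by (auto intro: span_base)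
    qed
  qed
  then have "dim (insert V0 ?K) = 6" using dim_span[of "insert V0 ?K"] dim_skew by simp
  then have "dim ?K = 5" using VK by (simp add: dim_insert)
  then have "dim (UNIV :: (real^5) set) = dim ?K" by simp
  from subspace_isomorphism[OF subspace_UNIV sK this]
  obtain L :: "real^5 \<Rightarrow> real^4^4" where L: "linear L" "range L = ?K" "inj L" by blast
  obtain L' where L': "linear L'" "L' \<circ> L = id" using linear_injective_left_inverse[OF L(1,3)] by blast
  show thesis by (rule that[OF L(1,2) L'(1)]) (use L'(2) in \<open>simp add: fun_eq_iff\<close>)
qed

text \<open>The chart writes the pseudo-sphere near \<open>V0\<close> as a graph over the orthogonal complement of
  \<open>V0\<close>, so that the coordinates of a point depend linearly on it.\<close>

lemma S5_parametrization_exists: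
  fixes N :: "real^'m \<Rightarrow> real^4^4"
  assumes D: "open D" "x0 \<in> D" and N: "smooth_on D N" "\<And>x. x \<in> D \<Longrightarrow> N x \<in> S5"
  obtains W \<psi> V u where "S5_parametrization W \<psi>" "open V" "x0 \<in> V" "V \<subseteq> D" "smooth_on V u" "u ` V \<subseteq> W"
    "\<And>x. x \<in> V \<Longrightarrow> N x = \<psi> (u x)"
proof -
  define V0 where "V0 = N x0"
  have V0S: "V0 \<in> S5" unfolding V0_def by (rule N(2)[OF D(2)])
  then have V0: "V0 \<in> skew" "lie_ip V0 V0 = 1" by (auto simp: S5_iff)
  obtain L :: "real^5 \<Rightarrow> real^4^4" and L' where L: "linear L" "range L = {E \<in> skew. lie_ip E V0 = 0}"
    and L': "linear L'" "\<And>y. L' (L y) = y" using S5_complement_coordinates[OF V0S] by blast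
  have bL: "bounded_linear L" "bounded_linear L'" using L L' by (simp_all add: linear_conv_bounded_linear)
  have Lk: "L y \<in> skew" "lie_ip (L y) V0 = 0" for y using L(2) by auto
  have Lk': "lie_ip V0 (L y) = 0" for y using Lk(2)[of y] lie_ip_commute[of V0 "L y"] by simp
  \<comment> \<open>The square of the coefficient of \<open>V0\<close> that norm 1 forces; its
    positivity defines the domain of the graph.\<close>
  define q where "q y = 1 - lie_ip (L y) (L y)" for y
  define W where "W = {y. q y > 0}"
  define \<psi> where "\<psi> y = sqrt (q y) *\<^sub>R V0 + L y" for y
  define Pr where "Pr E = E - lie_ip E V0 *\<^sub>R V0" for E
  have blPr: "bounded_linear Pr"
    unfolding Pr_def by (intro bounded_linear_sub bounded_linear_ident bounded_linear_scaleR_const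
        bounded_bilinear.bounded_linear_left[OF bounded_bilinear_lie_ip])
  have sq: "smooth_on UNIV q"
    unfolding q_def
    by (intro smooth_on_diff smooth_on_const open_UNIV smooth_on_bilinear[OF bounded_bilinear_lie_ip]
        smooth_on_bounded_linear[OF open_UNIV bL(1)])
  have W: "open W"
    unfolding W_def using smooth_on_continuous_on[OF sq] by (intro open_Collect_less continuous_on_const)
  have s\<psi>: "smooth_on W \<psi>"
    unfolding \<psi>_def
    by (intro smooth_on_add smooth_on_scaleR smooth_on_const W smooth_on_sqrt smooth_on_subset[OF sq subset_UNIV]
        smooth_on_bounded_linear[OF W bL(1)]) (simp add: W_def)
  have Pr\<psi>: "Pr (\<psi> y) = L y" for y
    by (simp add: Pr_def \<psi>_def lie_ip_simps V0 Lk)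
  have p: "S5_parametrization W \<psi>"
    unfolding S5_parametrization_def
  proof (intro conjI W s\<psi> ballI)
    have "\<psi> y \<in> S5" if "y \<in> W" for y
    proof -
      have "\<psi> y \<in> skew" unfolding \<psi>_def using V0 Lk subspace_skew by (simp add: subspace_add subspace_scale)
      moreover have "lie_ip (\<psi> y) (\<psi> y) = 1"
        using that by (simp add: \<psi>_def lie_ip_simps V0 Lk Lk' W_def) (simp add: q_def)
      ultimately show ?thesis by (simp add: S5_iff)
    qed
    then show "\<psi> ` W \<subseteq> S5" by auto
    show "inj_on \<psi> W" by (rule inj_onI) (metis Pr\<psi> L'(2))
    fix y assume y: "y \<in> W"
    note d = smooth_on_differentiable[OF s\<psi> y]
    show "inj (frechet_derivative \<psi> (at y))"
    proof (subst linear_injective_0[OF linear_frechet_derivative[OF d]], intro allI impI)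
      fix v assume v: "frechet_derivative \<psi> (at y) v = 0"
      have "frechet_derivative (\<lambda>y. Pr (\<psi> y)) (at y) v = Pr (frechet_derivative \<psi> (at y) v)"
        by (rule frechet_derivative_bounded_linear[OF blPr d])
      then have "L v = Pr 0"
        using v frechet_derivative_eq[OF bounded_linear_imp_has_derivative[OF bL(1)]] by (simp add: Pr\<psi>)
      then have "L v = L 0" by (simp add: Pr_def lie_ip_simps linear_0[OF L(1)])
      then show "v = 0" by (metis L'(2))
    qed
  qed
  \<comment> \<open>On this set the coefficient of \<open>V0\<close> is the positive square root, so
    the point lies on the sheet that \<open>\<psi>\<close> describes.\<close>
  define V where "V = {x \<in> D. lie_ip (N x) V0 > 0}"
  define u where "u x = L' (Pr (N x))" for x
  have V: "open V"
  proof -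
    have "continuous_on D (\<lambda>x. lie_ip (N x) V0)"
      by (rule smooth_on_continuous_on[OF smooth_on_bilinear[OF bounded_bilinear_lie_ip D(1) N(1) smooth_on_const]])
    then have "open (D \<inter> (\<lambda>x. lie_ip (N x) V0) -` {0<..})"
      by (rule continuous_open_preimage[OF _ D(1)]) simp
    then show ?thesis by (simp add: V_def vimage_def Int_def)
  qed
  have LU: "L (u x) = Pr (N x)" if "x \<in> D" for x
  proof -
    have "Pr (N x) \<in> {E \<in> skew. lie_ip E V0 = 0}"
      using N(2)[OF that] V0 subspace_skew unfolding Pr_def
      by (simp add: S5_iff subspace_diff subspace_scale lie_ip_simps)
    then obtain y where "Pr (N x) = L y" using L(2) by blast
    then show ?thesis by (simp add: u_def L'(2))
  qed
  have qu: "q (u x) = (lie_ip (N x) V0)\<^sup>2" if "x \<in> D" for x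
    using N(2)[OF that] V0 lie_ip_commute[of V0 "N x"]
    by (simp add: q_def LU[OF that] Pr_def lie_ip_simps S5_iff power2_eq_square)
  show thesis
  proof (rule that[OF p V])
    show "x0 \<in> V" using D V0 by (simp add: V_def V0_def)
    show "V \<subseteq> D" by (auto simp: V_def)
    show "smooth_on V u"
      unfolding u_def
      by (rule smooth_on_linear_compose[OF V bL(2) smooth_on_linear_compose[OF V blPr smooth_on_subset[OF N(1)]]])
         (auto simp: V_def)
    show "u ` V \<subseteq> W" by (auto simp: V_def W_def qu)
    show "N x = \<psi> (u x)" if "x \<in> V" for x
      using that by (simp add: \<psi>_def V_def qu LU) (simp add: Pr_def)
  qed
qed

section \<open>Local geometry of surfaces in hyperbolic space\<close>

lemma pd_lor:
  assumes "open D" "x \<in> D" "smooth_on D f" "smooth_on D g"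
  shows "pd i (\<lambda>y. lor (f y) (g y)) x = lor (f x) (pd i g x) + lor (pd i f x) (g x)"
  by (rule pd_bilinear[OF bounded_bilinear_lor smooth_on_differentiable[OF assms(3,2)] smooth_on_differentiable[OF assms(4,2)]])

lemma smooth_on_lor: "open D \<Longrightarrow> smooth_on D f \<Longrightarrow> smooth_on D g \<Longrightarrow> smooth_on D (\<lambda>y. lor (f y) (g y))"
  by (rule smooth_on_bilinear[OF bounded_bilinear_lor])

lemma pd_lor_const:
  assumes "open D" "x \<in> D" "smooth_on D f" "smooth_on D g" "\<And>y. y \<in> D \<Longrightarrow> lor (f y) (g y) = c"
  shows "lor (f x) (pd i g x) + lor (pd i f x) (g x) = 0"
proof -
  have "pd i (\<lambda>y. lor (f y) (g y)) x = pd i (\<lambda>_. c) x" by (rule pd_cong[OF assms(1,2,5)])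
  then show ?thesis using pd_lor[OF assms(1-4)] by (simp add: pd_const)
qed

lemma matrix_inv_2:
  fixes A :: "real^2^2"
  assumes "invertible A"
  defines "d \<equiv> A $ 1 $ 1 * A $ 2 $ 2 - A $ 1 $ 2 * A $ 2 $ 1"
  shows "d \<noteq> 0" "matrix_inv A $ 1 $ 1 = A $ 2 $ 2 / d" "matrix_inv A $ 1 $ 2 = - A $ 1 $ 2 / d"
    "matrix_inv A $ 2 $ 1 = - A $ 2 $ 1 / d" "matrix_inv A $ 2 $ 2 = A $ 1 $ 1 / d"
proof -
  show d: "d \<noteq> 0" using assms by (simp add: invertible_det_nz det_2)
  let ?B = "matrix_inv A"
  have e: "(\<Sum>k\<in>UNIV. ?B $ i $ k * A $ k $ j) = (if i = j then 1 else 0)" for i j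
    using invertible_matrix_inv(2)[OF assms(1)] by (simp add: matrix_matrix_mult_def mat_def vec_eq_iff)
  have e: "?B $ 1 $ 1 * A $ 1 $ 1 + ?B $ 1 $ 2 * A $ 2 $ 1 = 1" "?B $ 1 $ 1 * A $ 1 $ 2 + ?B $ 1 $ 2 * A $ 2 $ 2 = 0"
    "?B $ 2 $ 1 * A $ 1 $ 1 + ?B $ 2 $ 2 * A $ 2 $ 1 = 0" "?B $ 2 $ 1 * A $ 1 $ 2 + ?B $ 2 $ 2 * A $ 2 $ 2 = 1"
    using e[of 1 1] e[of 1 2] e[of 2 1] e[of 2 2] by (simp_all add: sum_2)
  have "?B $ 1 $ 1 * d = A $ 2 $ 2" unfolding d_def using e(1,2) by algebra
  then show "?B $ 1 $ 1 = A $ 2 $ 2 / d" using d by (simp add: field_simps)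
  have "?B $ 1 $ 2 * d = - A $ 1 $ 2" unfolding d_def using e(1,2) by algebra
  then show "?B $ 1 $ 2 = - A $ 1 $ 2 / d" using d by (simp add: field_simps)
  have "?B $ 2 $ 1 * d = - A $ 2 $ 1" unfolding d_def using e(3,4) by algebra
  then show "?B $ 2 $ 1 = - A $ 2 $ 1 / d" using d by (simp add: field_simps)
  have "?B $ 2 $ 2 * d = A $ 1 $ 1" unfolding d_def using e(3,4) by algebra
  then show "?B $ 2 $ 2 = A $ 1 $ 1 / d" using d by (simp add: field_simps)
qed

text \<open>The contraction of the Codazzi equation: \<open>M\<close> and \<open>K\<close> stand for the derivatives of the shape
  operator \<open>m\<close> and of the normal, \<open>C\<close> for the Christoffel symbols of the first kind, \<open>h\<close> for the
  inverse metric, and \<open>b\<close> for the second fundamental form.\<close>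

lemma contracted_Codazzi:
  fixes g h b m :: "2 \<Rightarrow> 2 \<Rightarrow> real" and C K M :: "2 \<Rightarrow> 2 \<Rightarrow> 2 \<Rightarrow> real"
  assumes hg: "\<And>i j. (\<Sum>k\<in>UNIV. h i k * g k j) = (if i = j then 1 else 0)"
    and sym: "\<And>i j. h i j = h j i" "\<And>i j. g i j = g j i" "\<And>i j. b i j = b j i" "\<And>i j k. C i j k = C j i k"
      "\<And>i j k. K i j k = K j i k"
    and m: "\<And>i k. m i k = (\<Sum>l\<in>UNIV. b i l * h l k)"
    and K: "\<And>l i j. K l i j = (\<Sum>k\<in>UNIV. M l i k * g k j + m i k * C l k j)"
    and cod: "\<And>i j l. K i j l + (\<Sum>r\<in>UNIV. m j r * C i l r) = K i l j + (\<Sum>r\<in>UNIV. m l r * C i j r)"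
  shows "(\<Sum>i\<in>UNIV. \<Sum>j\<in>UNIV. h i j * (K i j l - (\<Sum>s\<in>UNIV. m l s * C i j s))) = (\<Sum>k\<in>UNIV. M l k k)"
proof -
  have h21: "h 2 1 = h 1 2" and g21: "g 2 1 = g 1 2" and b21: "b 2 1 = b 1 2" using sym by auto
  have C1: "C 1 l k = C l 1 k" "C 2 l k = C l 2 k" for k using sym by auto
  have e: "h 1 1 * g 1 1 + h 1 2 * g 1 2 = 1" "h 1 1 * g 1 2 + h 1 2 * g 2 2 = 0"
    "h 1 2 * g 1 1 + h 2 2 * g 1 2 = 0" "h 1 2 * g 1 2 + h 2 2 * g 2 2 = 1"
    using hg[of 1 1] hg[of 1 2] hg[of 2 1] hg[of 2 2] by (simp_all add: sum_2 h21 g21)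
  \<comment> \<open>As a matrix product \<open>h m = h b h\<close> is symmetric; this cancels the
    Christoffel terms left over by the contraction.\<close>
  have P: "h 1 1 * m 1 2 + h 1 2 * m 2 2 = h 1 2 * m 1 1 + h 2 2 * m 2 1"
    by (simp add: m sum_2 h21 b21 algebra_simps)
  have "K i j l - (\<Sum>s\<in>UNIV. m l s * C i j s) = K l i j - (\<Sum>r\<in>UNIV. m j r * C i l r)" for i j
    using cod[of i j l] sym(5)[of i l j] by linarith
  then have "(\<Sum>i\<in>UNIV. \<Sum>j\<in>UNIV. h i j * (K i j l - (\<Sum>s\<in>UNIV. m l s * C i j s)))
      = (\<Sum>i\<in>UNIV. \<Sum>j\<in>UNIV. h i j * ((\<Sum>k\<in>UNIV. M l i k * g k j + m i k * C l k j) - (\<Sum>r\<in>UNIV. m j r * C i l r)))"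
    by (simp only: K)
  also have "\<dots> = M l 1 1 * (h 1 1 * g 1 1 + h 1 2 * g 1 2) + M l 1 2 * (h 1 1 * g 1 2 + h 1 2 * g 2 2)
     + M l 2 1 * (h 1 2 * g 1 1 + h 2 2 * g 1 2) + M l 2 2 * (h 1 2 * g 1 2 + h 2 2 * g 2 2)
     + (C l 2 1 - C l 1 2) * ((h 1 1 * m 1 2 + h 1 2 * m 2 2) - (h 1 2 * m 1 1 + h 2 2 * m 2 1))"
    by (simp add: sum_2 h21 g21 C1 algebra_simps)
  also have "\<dots> = (\<Sum>k\<in>UNIV. M l k k)" unfolding e P by (simp add: sum_2)
  finally show ?thesis .
qed

text \<open>An immersion with its unit normal over a coordinate domain. It is used both for the
  charts of the atlas and for conformal parametrizations read in real coordinates.\<close>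

locale surface_patch =
  fixes D :: "(real^2) set" and F n :: "real^2 \<Rightarrow> real^4"
  assumes open_D: "open D" and smooth_F: "smooth_on D F" and smooth_n: "smooth_on D n"
    and hyp: "x \<in> D \<Longrightarrow> F x \<in> hyp3"
    and nF: "x \<in> D \<Longrightarrow> lor (n x) (F x) = 0" and nn: "x \<in> D \<Longrightarrow> lor (n x) (n x) = 1"
    and ndF: "x \<in> D \<Longrightarrow> lor (n x) (pd i F x) = 0"
    and inj_dF: "x \<in> D \<Longrightarrow> inj (frechet_derivative F (at x))"
begin

abbreviation "g \<equiv> induced_metric lor F"
abbreviation "h x \<equiv> matrix_inv (g x)"
abbreviation "H \<equiv> mean_curvature F n"

lemmas pdF = smooth_on_pd[OF smooth_F] and pdn = smooth_on_pd[OF smooth_n]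
lemma g_nth: "g x $ i $ j = lor (pd i F x) (pd j F x)"
  by (simp add: induced_metric_def)

lemma FF: "x \<in> D \<Longrightarrow> lor (F x) (F x) = -1"
  using hyp hyp3_first(3) by blast

lemma FFi: "x \<in> D \<Longrightarrow> lor (F x) (pd i F x) = 0"
  using pd_lor_const[OF open_D _ smooth_F smooth_F FF, of x i] by (simp add: lor_commute)

lemma nni: "x \<in> D \<Longrightarrow> lor (n x) (pd i n x) = 0"
  using pd_lor_const[OF open_D _ smooth_n smooth_n nn, of x i] by (simp add: lor_commute)

lemma Fni: "x \<in> D \<Longrightarrow> lor (F x) (pd i n x) = 0"
  using pd_lor_const[OF open_D _ smooth_n smooth_F nF, of x i] ndF[of x i] lor_commute[of "F x" "pd i n x"] by simp

lemma commuted_products: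
  assumes "x \<in> D"
  shows "lor (pd i F x) (F x) = 0" "lor (pd i n x) (n x) = 0" "lor (pd i n x) (F x) = 0" "lor (pd i F x) (n x) = 0"
    "lor (F x) (n x) = 0"
  using FFi[OF assms] nni[OF assms] Fni[OF assms] ndF[OF assms] nF[OF assms] lor_commute by metis+

lemma FijF: "x \<in> D \<Longrightarrow> lor (pd i (pd j F) x) (F x) = - g x $ i $ j"
  using pd_lor_const[OF open_D _ smooth_F pdF FFi, of x i j] lor_commute[of "F x" "pd i (pd j F) x"]
  by (simp add: g_nth)

lemma Fijn: "x \<in> D \<Longrightarrow> lor (pd i (pd j F) x) (n x) = - lor (pd i n x) (pd j F x)"
  using pd_lor_const[OF open_D _ smooth_n pdF ndF, of x i j] lor_commute[of "n x" "pd i (pd j F) x"] by simp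

lemma nijF: "x \<in> D \<Longrightarrow> lor (pd i (pd j n) x) (F x) = - lor (pd j n x) (pd i F x)"
  using pd_lor_const[OF open_D _ smooth_F pdn Fni, of x i j] lor_commute[of "F x" "pd i (pd j n) x"]
    lor_commute[of "pd i F x"] by simp

lemma b_sym: "x \<in> D \<Longrightarrow> lor (pd i n x) (pd j F x) = lor (pd j n x) (pd i F x)"
  using Fijn[of x i j] Fijn[of x j i] pd_commute[OF open_D _ smooth_F, of x i j] by simp

lemma dF_spacelike:
  assumes x: "x \<in> D" and v: "v \<noteq> 0"
  shows "lor (frechet_derivative F (at x) v) (frechet_derivative F (at x) v) > 0"
proof (rule hyp3_tangent_spacelike[OF hyp[OF x]])
  note d = smooth_on_differentiable[OF smooth_F x]
  show "lor (F x) (frechet_derivative F (at x) v) = 0"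
    unfolding frechet_pd_expansion[OF d] by (simp add: lor_sum_right lor_simps FFi[OF x])
  show "frechet_derivative F (at x) v \<noteq> 0"
    using inj_dF[OF x] v linear_injective_0[OF linear_frechet_derivative[OF d]] by blast
qed

lemma invertible_g:
  assumes x: "x \<in> D"
  shows "invertible (g x)"
proof -
  have "inj ((*v) (g x))"
  proof (subst linear_injective_0[OF matrix_vector_mul_linear], intro allI impI)
    fix v assume v: "g x *v v = 0"
    let ?w = "frechet_derivative F (at x) v"
    have w: "?w = (\<Sum>i\<in>UNIV. v $ i *\<^sub>R pd i F x)" by (rule frechet_pd_expansion[OF smooth_on_differentiable[OF smooth_F x]])
    have 1: "lor (pd i F x) ?w = 0" for i
    proof -
      have "lor (pd i F x) ?w = (g x *v v) $ i"
        unfolding w by (simp add: lor_sum_right lor_simps matrix_vector_mult_def g_nth mult.commute)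
      then show ?thesis using v by simp
    qed
    have "lor ?w ?w = (\<Sum>i\<in>UNIV. v $ i * lor (pd i F x) ?w)"
      by (subst w) (simp add: lor_sum_left lor_simps)
    then have "lor ?w ?w = 0" using 1 by simp
    then show "v = 0" using dF_spacelike[OF x, of v] by fastforce
  qed
  then show ?thesis by (simp add: invertible_left_inverse matrix_left_invertible_injective)
qed

lemma g_sym: "g x $ i $ j = g x $ j $ i"
  by (simp add: g_nth lor_commute)

lemma h_sym:
  assumes x: "x \<in> D"
  shows "h x $ i $ j = h x $ j $ i"
  using exhaust_2[of i] exhaust_2[of j] matrix_inv_2[OF invertible_g[OF x]] g_sym[of x 1 2] by auto

lemma hg: "x \<in> D \<Longrightarrow> (\<Sum>k\<in>UNIV. h x $ i $ k * g x $ k $ j) = (if i = j then 1 else 0)"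
  using invertible_matrix_inv(2)[OF invertible_g] by (simp add: matrix_matrix_mult_def mat_def vec_eq_iff)

lemma smooth_h: "smooth_on D (\<lambda>x. h x $ i $ j)"
proof -
  have sg: "smooth_on D (\<lambda>x. g x $ i $ j)" for i j
    unfolding g_nth by (rule smooth_on_lor[OF open_D pdF pdF])
  let ?d = "\<lambda>x. g x $ 1 $ 1 * g x $ 2 $ 2 - g x $ 1 $ 2 * g x $ 2 $ 1"
  have sd: "smooth_on D ?d" by (intro smooth_on_diff smooth_on_mult open_D sg)
  have q: "smooth_on D (\<lambda>x. f x / ?d x)" if "smooth_on D f" for f
    by (rule smooth_on_divide[OF open_D that sd]) (rule matrix_inv_2(1)[OF invertible_g])
  note c = smooth_on_cong[OF open_D _ q]
  note mi = matrix_inv_2[OF invertible_g]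
  have "smooth_on D (\<lambda>x. h x $ 1 $ 1)" by (rule c[OF mi(2)[symmetric] sg])
  moreover have "smooth_on D (\<lambda>x. h x $ 1 $ 2)" by (rule c[OF mi(3)[symmetric] smooth_on_minus[OF open_D sg]])
  moreover have "smooth_on D (\<lambda>x. h x $ 2 $ 1)" by (rule c[OF mi(4)[symmetric] smooth_on_minus[OF open_D sg]])
  moreover have "smooth_on D (\<lambda>x. h x $ 2 $ 2)" by (rule c[OF mi(5)[symmetric] sg])
  ultimately show ?thesis using exhaust_2[of i] exhaust_2[of j] by auto
qed

text \<open>Position, normal and the two coordinate vectors form a basis of the Lorentz space.
  Vector identities below are therefore verified by their products with these four vectors.\<close>

lemma frame_zero:
  assumes x: "x \<in> D" and W: "lor W (F x) = 0" "lor W (n x) = 0" "\<And>i. lor W (pd i F x) = 0"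
  shows "W = 0"
proof -
  note d = smooth_on_differentiable[OF smooth_F x]
  define L :: "real^4 \<Rightarrow> real^4" where
    "L c = c $ 1 *\<^sub>R F x + c $ 2 *\<^sub>R n x + (c $ 3 *\<^sub>R pd 1 F x + c $ 4 *\<^sub>R pd 2 F x)" for c
  have lin: "linear L"
    by (rule linearI) (auto simp: L_def algebra_simps)
  have "inj L"
  proof (subst linear_injective_0[OF lin], intro allI impI)
    fix c assume c: "L c = 0"
    have "lor (L c) (F x) = - c $ 1" "lor (L c) (n x) = c $ 2"
      using FF[OF x] nF[OF x] nn[OF x] FFi[OF x] ndF[OF x] lor_commute[of "F x" "n x"]
        lor_commute[of "pd 1 F x"] lor_commute[of "pd 2 F x"]
      by (simp_all add: L_def lor_simps)
    then have 12: "c $ 1 = 0" "c $ 2 = 0" using c by (simp_all add: lor_simps)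
    define v :: "real^2" where "v = vector [c $ 3, c $ 4]"
    have "frechet_derivative F (at x) v = 0"
      using c 12 unfolding frechet_pd_expansion[OF d] by (simp add: L_def sum_2 v_def)
    then have "v = 0" using inj_dF[OF x] linear_injective_0[OF linear_frechet_derivative[OF d]] by blast
    then have "v $ 1 = 0" "v $ 2 = 0" by simp_all
    then show "c = 0" using 12 by (simp add: v_def vec_eq_iff forall_4)
  qed
  then have "surj L" using linear_injective_imp_surjective[OF lin] by blast
  have "lor W y = 0" for y
  proof -
    obtain c where "y = L c" using \<open>surj L\<close> by (metis surjD)
    then show ?thesis by (simp add: L_def lor_simps W)
  qed
  then show ?thesis by (rule lor_nondegenerate)
qed

text \<open>Mixed components of the derivative of the normal: the shape operator with the opposite
  of the usual sign.\<close>

definition m :: "2 \<Rightarrow> 2 \<Rightarrow> real^2 \<Rightarrow> real" where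
  "m j k x = (\<Sum>l\<in>UNIV. lor (pd j n x) (pd l F x) * h x $ l $ k)"

lemma smooth_m: "smooth_on D (m j k)"
  unfolding m_def[abs_def] by (intro smooth_on_sum smooth_on_mult open_D smooth_h smooth_on_lor pdn pdF)

lemma Weingarten:
  assumes x: "x \<in> D"
  shows "pd j n x = (\<Sum>k\<in>UNIV. m j k x *\<^sub>R pd k F x)"
proof -
  have "pd j n x - (\<Sum>k\<in>UNIV. m j k x *\<^sub>R pd k F x) = 0"
  proof (rule frame_zero[OF x])
    show "lor (pd j n x - (\<Sum>k\<in>UNIV. m j k x *\<^sub>R pd k F x)) (F x) = 0"
      by (simp add: lor_simps lor_sum_left commuted_products[OF x])
    show "lor (pd j n x - (\<Sum>k\<in>UNIV. m j k x *\<^sub>R pd k F x)) (n x) = 0"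
      by (simp add: lor_simps lor_sum_left commuted_products[OF x])
    fix l
    have "(\<Sum>k\<in>UNIV. m j k x * g x $ k $ l) = (\<Sum>r\<in>UNIV. lor (pd j n x) (pd r F x) * (\<Sum>k\<in>UNIV. h x $ r $ k * g x $ k $ l))"
      unfolding m_def sum_distrib_left sum_distrib_right by (subst sum.swap) (simp only: mult.assoc)
    also have "\<dots> = lor (pd j n x) (pd l F x)" unfolding hg[OF x] by (simp add: if_distrib cong: if_cong)
    finally show "lor (pd j n x - (\<Sum>k\<in>UNIV. m j k x *\<^sub>R pd k F x)) (pd l F x) = 0"
      by (simp add: lor_simps lor_sum_left g_nth)
  qed
  then show ?thesis by simp
qed

lemma H_eq_trace: "x \<in> D \<Longrightarrow> H x = - (m 1 1 x + m 2 2 x) / 2"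
  using h_sym[of x 2 1] b_sym[of x 2 1]
  by (simp add: mean_curvature_def m_def sum_2 Fijn algebra_simps)

lemma smooth_H: "smooth_on D H"
proof -
  have "smooth_on D (\<lambda>x. (- 1 / 2) * (m 1 1 x + m 2 2 x))"
    by (intro smooth_on_mult smooth_on_const smooth_on_add open_D smooth_m)
  then show ?thesis by (rule smooth_on_cong[OF open_D, rotated]) (simp add: H_eq_trace field_simps)
qed

lemma pd_H:
  assumes x: "x \<in> D"
  shows "(\<Sum>k\<in>UNIV. pd l (m k k) x) = - 2 * pd l H x"
proof -
  note dm = smooth_on_differentiable[OF smooth_m x]
  have "pd l H x = pd l (\<lambda>y. (- 1 / 2) *\<^sub>R (m 1 1 y + m 2 2 y)) x"
    by (rule pd_cong[OF open_D x]) (simp add: H_eq_trace field_simps)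
  also have "\<dots> = (- 1 / 2) *\<^sub>R pd l (\<lambda>y. m 1 1 y + m 2 2 y) x"
    by (rule pd_linear[OF bounded_linear_scaleR_right differentiable_add[OF dm dm]])
  also have "\<dots> = (- 1 / 2) *\<^sub>R (pd l (m 1 1) x + pd l (m 2 2) x)"
    using pd_add[OF dm dm] by simp
  finally show ?thesis by (simp add: sum_2 field_simps)
qed

lemma g_christoffel:
  assumes x: "x \<in> D"
  shows "(\<Sum>k\<in>UNIV. christoffel g x k i j * g x $ k $ d) = lor (pd i (pd j F) x) (pd d F x)"
  using christoffel_lower[OF bounded_bilinear_lor lor_commute open_D x smooth_F invertible_g[OF x], of i j d]
  by (simp add: g_nth)

lemma second_form_trace_lor:
  "lor (second_form_trace g N x) y = (\<Sum>i\<in>UNIV. \<Sum>j\<in>UNIV. h x $ i $ j *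
     (lor (pd i (pd j N) x) y - (\<Sum>k\<in>UNIV. christoffel g x k i j * lor (pd k N x) y)))"
  unfolding second_form_trace_def by (simp add: lor_sum_left lor_simps)

text \<open>The Laplacian of the position: its tangential part is cancelled by the Christoffel
  symbols, its normal part is twice the mean curvature, and its part along \<open>F\<close> comes
  from differentiating \<open>lor F F = -1\<close> twice.\<close>

lemma trace_F:
  assumes x: "x \<in> D"
  shows "second_form_trace g F x = 2 *\<^sub>R F x + (2 * H x) *\<^sub>R n x"
proof -
  have "second_form_trace g F x - (2 *\<^sub>R F x + (2 * H x) *\<^sub>R n x) = 0"
  proof (rule frame_zero[OF x])
    have "(\<Sum>i\<in>UNIV. \<Sum>j\<in>UNIV. h x $ i $ j * g x $ i $ j) = 2"
      using hg[OF x, of 1 1] hg[OF x, of 2 2] g_sym[of x 2 1] by (simp add: sum_2)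
    then have "lor (second_form_trace g F x) (F x) = -2"
      by (simp add: second_form_trace_lor FijF[OF x] sum_negf commuted_products[OF x])
    then show "lor (second_form_trace g F x - (2 *\<^sub>R F x + (2 * H x) *\<^sub>R n x)) (F x) = 0"
      by (simp add: lor_simps FF[OF x] nF[OF x])
    have "lor (second_form_trace g F x) (n x) = 2 * H x"
      by (simp add: second_form_trace_lor mean_curvature_def commuted_products[OF x])
    then show "lor (second_form_trace g F x - (2 *\<^sub>R F x + (2 * H x) *\<^sub>R n x)) (n x) = 0"
      by (simp add: lor_simps nn[OF x] commuted_products[OF x])
    fix l
    have "lor (second_form_trace g F x) (pd l F x) = 0"
      unfolding second_form_trace_lor g_nth[symmetric] g_christoffel[OF x] by simp
    then show "lor (second_form_trace g F x - (2 *\<^sub>R F x + (2 * H x) *\<^sub>R n x)) (pd l F x) = 0"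
      by (simp add: lor_simps FFi[OF x] ndF[OF x])
  qed
  then show ?thesis by simp
qed

lemma trace_n_F:
  assumes x: "x \<in> D"
  shows "lor (second_form_trace g n x) (F x) = 2 * H x"
  using h_sym[OF x, of 2 1] b_sym[OF x, of 2 1]
  by (simp add: second_form_trace_lor nijF[OF x] Fijn[OF x] mean_curvature_def sum_2 commuted_products[OF x])

text \<open>By the contracted Codazzi equation, the tangential part of the Laplacian of the normal
  is the differential of the trace of \<open>m\<close>.\<close>

lemma trace_n_pdF:
  assumes x: "x \<in> D"
  shows "lor (second_form_trace g n x) (pd l F x) = - 2 * pd l H x"
proof -
  let ?K = "\<lambda>i j k. lor (pd i (pd j n) x) (pd k F x)" and ?C = "\<lambda>i j k. lor (pd i (pd j F) x) (pd k F x)"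
  let ?M = "\<lambda>l i k. pd l (m i k) x"
  have nl: "lor (pd l n x) y = (\<Sum>s\<in>UNIV. m l s x * lor (pd s F x) y)" for l y
    unfolding Weingarten[OF x] by (simp add: lor_sum_left lor_simps)
  \<comment> \<open>Symmetry of the second fundamental form moves the derivative of the normal to
    the index \<open>l\<close>, so that \<open>g_christoffel\<close> can turn the symbols of the
    second kind into those of the first.\<close>
  have chr: "(\<Sum>k\<in>UNIV. christoffel g x k i j * lor (pd k n x) (pd l F x)) = (\<Sum>s\<in>UNIV. m l s x * ?C i j s)" for i j
  proof -
    have "(\<Sum>k\<in>UNIV. christoffel g x k i j * lor (pd k n x) (pd l F x))
        = (\<Sum>k\<in>UNIV. \<Sum>s\<in>UNIV. m l s x * (christoffel g x k i j * g x $ k $ s))"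
    proof (intro sum.cong refl)
      fix k
      have "lor (pd k n x) (pd l F x) = lor (pd l n x) (pd k F x)" by (rule b_sym[OF x])
      also have "\<dots> = (\<Sum>s\<in>UNIV. m l s x * lor (pd s F x) (pd k F x))" by (rule nl)
      also have "\<dots> = (\<Sum>s\<in>UNIV. m l s x * g x $ k $ s)" by (simp only: g_nth lor_commute)
      finally show "christoffel g x k i j * lor (pd k n x) (pd l F x) =
          (\<Sum>s\<in>UNIV. m l s x * (christoffel g x k i j * g x $ k $ s))"
        by (simp only: sum_distrib_left mult.left_commute)
    qed
    also have "\<dots> = (\<Sum>s\<in>UNIV. \<Sum>k\<in>UNIV. m l s x * (christoffel g x k i j * g x $ k $ s))"
      by (rule sum.swap)
    also have "\<dots> = (\<Sum>s\<in>UNIV. m l s x * ?C i j s)"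
      unfolding sum_distrib_left[symmetric] g_christoffel[OF x] ..
    finally show ?thesis .
  qed
  have K: "?K l i j = (\<Sum>k\<in>UNIV. ?M l i k * g x $ k $ j + m i k x * ?C l k j)" for l i j
  proof -
    note dm = smooth_on_differentiable[OF smooth_m x] and dF = smooth_on_differentiable[OF pdF x]
    have "pd l (pd i n) x = pd l (\<lambda>y. \<Sum>k\<in>UNIV. m i k y *\<^sub>R pd k F y) x"
      by (rule pd_cong[OF open_D x]) (rule Weingarten)
    also have "\<dots> = (\<Sum>k\<in>UNIV. pd l (\<lambda>y. m i k y *\<^sub>R pd k F y) x)"
      by (rule pd_sum) (rule smooth_on_differentiable[OF smooth_on_scaleR[OF open_D smooth_m pdF] x])
    also have "\<dots> = (\<Sum>k\<in>UNIV. m i k x *\<^sub>R pd l (pd k F) x + ?M l i k *\<^sub>R pd k F x)"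
      by (intro sum.cong refl pd_bilinear[OF bounded_bilinear_scaleR dm dF])
    finally show ?thesis by (simp add: lor_sum_left lor_simps g_nth add.commute)
  qed
  \<comment> \<open>The derivative along \<open>i\<close> of the symmetry of the second fundamental
    form in \<open>j\<close> and \<open>l\<close>; with the commuting second derivatives of
    \<open>n\<close> this becomes the Codazzi equation.\<close>
  have cod: "?K i j l + (\<Sum>r\<in>UNIV. m j r x * ?C i l r) = ?K i l j + (\<Sum>r\<in>UNIV. m l r x * ?C i j r)" for i j l
  proof -
    have "pd i (\<lambda>y. lor (pd j n y) (pd l F y)) x = pd i (\<lambda>y. lor (pd l n y) (pd j F y)) x"
      by (rule pd_cong[OF open_D x]) (rule b_sym)
    then have "lor (pd j n x) (pd i (pd l F) x) + ?K i j l = lor (pd l n x) (pd i (pd j F) x) + ?K i l j"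
      by (simp add: pd_lor[OF open_D x pdn pdF])
    moreover have "lor (pd j n x) (pd i (pd l F) x) = (\<Sum>r\<in>UNIV. m j r x * ?C i l r)" for i j l
      unfolding nl by (simp add: lor_commute)
    ultimately show ?thesis by simp
  qed
  have "lor (second_form_trace g n x) (pd l F x) = (\<Sum>i\<in>UNIV. \<Sum>j\<in>UNIV. h x $ i $ j * (?K i j l - (\<Sum>s\<in>UNIV. m l s x * ?C i j s)))"
    unfolding second_form_trace_lor chr ..
  also have "\<dots> = (\<Sum>k\<in>UNIV. ?M l k k)"
    by (rule contracted_Codazzi[where g = "\<lambda>i j. g x $ i $ j" and b = "\<lambda>i j. lor (pd i n x) (pd j F x)",
          OF hg[OF x] h_sym[OF x] g_sym b_sym[OF x] _ _ _ K cod])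
       (auto simp: m_def pd_commute[OF open_D x smooth_F] pd_commute[OF open_D x smooth_n])
  finally show ?thesis using pd_H[OF x] by simp
qed

section \<open>The Gauss map as a bivector field\<close>

abbreviation "N \<equiv> \<lambda>y. wedge (F y) (n y)"

lemma smooth_N: "smooth_on D N"
  by (rule smooth_on_bilinear[OF bounded_bilinear_wedge open_D smooth_F smooth_n])

lemma pd_N:
  assumes x: "x \<in> D"
  shows "pd k N x = wedge (F x) (pd k n x) + wedge (pd k F x) (n x)"
  by (rule pd_bilinear[OF bounded_bilinear_wedge smooth_on_differentiable[OF smooth_F x] smooth_on_differentiable[OF smooth_n x]])

lemma ppd_N:
  assumes x: "x \<in> D"
  shows "pd i (pd j N) x = (wedge (F x) (pd i (pd j n) x) + wedge (pd i F x) (pd j n x))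
     + (wedge (pd j F x) (pd i n x) + wedge (pd i (pd j F) x) (n x))"
proof -
  note bw = bounded_bilinear_wedge
  have "pd i (pd j N) x = pd i (\<lambda>y. wedge (F y) (pd j n y) + wedge (pd j F y) (n y)) x"
    by (rule pd_cong[OF open_D x]) (rule pd_N)
  also have "\<dots> = pd i (\<lambda>y. wedge (F y) (pd j n y)) x + pd i (\<lambda>y. wedge (pd j F y) (n y)) x"
    by (rule pd_add; rule smooth_on_differentiable[OF _ x]; rule smooth_on_bilinear[OF bw open_D];
        rule smooth_F smooth_n pdF pdn)
  also have "\<dots> = (wedge (F x) (pd i (pd j n) x) + wedge (pd i F x) (pd j n x))
     + (wedge (pd j F x) (pd i n x) + wedge (pd i (pd j F) x) (n x))"
    using pd_bilinear[OF bw smooth_on_differentiable[OF smooth_F x] smooth_on_differentiable[OF pdn x]]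
      pd_bilinear[OF bw smooth_on_differentiable[OF pdF x] smooth_on_differentiable[OF smooth_n x]]
    by simp
  finally show ?thesis .
qed

text \<open>The product rule leaves cross terms \<open>wedge (pd i F x) (pd j n x)\<close>
  contracted with the inverse metric. By Weingarten they pair the symmetric matrix
  \<open>h b h\<close> with an antisymmetric form, so they vanish.\<close>

lemma trace_N_lie_ip:
  assumes x: "x \<in> D" and E: "E \<in> skew"
  shows "lie_ip (second_form_trace g N x) E =
    lor (E *v second_form_trace g F x) (n x) + lor (E *v F x) (second_form_trace g n x)"
proof -
  let ?w = "\<lambda>x y. lor (E *v x) y"
  have w: "lie_ip (wedge x y) E = ?w x y" for x y
    using skew_lie_ip_wedge[OF E] lie_ip_commute by metis
  have bw: "bounded_bilinear ?w"
    by (rule bounded_bilinear.comp1[OF bounded_bilinear_lor bounded_bilinear.bounded_linear_right[OF bounded_bilinear_matvec]])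
  have skw: "?w x y = - ?w y x" for x y using skewD[OF E, of x y] by (simp add: lor_commute)
  have "(\<Sum>i\<in>UNIV. \<Sum>j\<in>UNIV. h x $ i $ j * ?w (pd i F x) (pd j n x)) = 0"
    "(\<Sum>i\<in>UNIV. \<Sum>j\<in>UNIV. h x $ i $ j * ?w (pd j F x) (pd i n x)) = 0"
  proof -
    note ws = bounded_bilinear.sum_right[OF bw] bounded_bilinear.scaleR_right[OF bw]
    have z: "?w y y = 0" for y using skw[of y y] by simp
    have s: "h x $ 2 $ 1 = h x $ 1 $ 2" "?w (pd 2 F x) (pd 1 F x) = - ?w (pd 1 F x) (pd 2 F x)"
      "lor (pd 2 n x) (pd 1 F x) = lor (pd 1 n x) (pd 2 F x)"
      by (rule h_sym[OF x], rule skw, rule b_sym[OF x])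
    show "(\<Sum>i\<in>UNIV. \<Sum>j\<in>UNIV. h x $ i $ j * ?w (pd i F x) (pd j n x)) = 0"
      "(\<Sum>i\<in>UNIV. \<Sum>j\<in>UNIV. h x $ i $ j * ?w (pd j F x) (pd i n x)) = 0"
      unfolding Weingarten[OF x] ws by (simp_all add: sum_2 z s m_def algebra_simps)
  qed
  note zero = this
  note bls = bounded_bilinear.sum_left[OF bounded_bilinear_lie_ip] lie_ip_simps
  note bws = bounded_bilinear.sum_left[OF bw] bounded_bilinear.sum_right[OF bw]
    bounded_bilinear.scaleR_left[OF bw] bounded_bilinear.scaleR_right[OF bw]
    bounded_bilinear.diff_left[OF bw] bounded_bilinear.diff_right[OF bw]
  have "lie_ip (second_form_trace g N x) E = (\<Sum>i\<in>UNIV. \<Sum>j\<in>UNIV. h x $ i $ j *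
      (lie_ip (pd i (pd j N) x) E - (\<Sum>k\<in>UNIV. christoffel g x k i j * lie_ip (pd k N x) E)))"
    unfolding second_form_trace_def by (simp add: bls)
  also have "\<dots> =
     (\<Sum>i\<in>UNIV. \<Sum>j\<in>UNIV. h x $ i $ j * (
        (?w (F x) (pd i (pd j n) x) - (\<Sum>k\<in>UNIV. christoffel g x k i j * ?w (F x) (pd k n x)))
        + (?w (pd i (pd j F) x) (n x) - (\<Sum>k\<in>UNIV. christoffel g x k i j * ?w (pd k F x) (n x)))
        + (?w (pd i F x) (pd j n x) + ?w (pd j F x) (pd i n x))))"
    by (intro sum.cong refl arg_cong2[of _ _ _ _ "(*)"])
       (simp add: bls w pd_N[OF x] ppd_N[OF x] distrib_left sum.distrib)
  also have "\<dots> = ?w (F x) (second_form_trace g n x) + ?w (second_form_trace g F x) (n x) + 0"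
  proof -
    have "(\<Sum>i\<in>UNIV. \<Sum>j\<in>UNIV. h x $ i $ j * ((p i j) + (q i j) + (r i j + s i j)))
      = (\<Sum>i\<in>UNIV. \<Sum>j\<in>UNIV. h x $ i $ j * p i j) + (\<Sum>i\<in>UNIV. \<Sum>j\<in>UNIV. h x $ i $ j * q i j)
       + ((\<Sum>i\<in>UNIV. \<Sum>j\<in>UNIV. h x $ i $ j * r i j) + (\<Sum>i\<in>UNIV. \<Sum>j\<in>UNIV. h x $ i $ j * s i j))" for p q r s
      by (simp add: distrib_left sum.distrib)
    then show ?thesis
      unfolding zero second_form_trace_def bws by (simp only: zero real_scaleR_def add_0)
  qed
  finally show ?thesis by simp
qed

text \<open>If the gradient of \<open>H\<close> vanishes, the Laplacian of \<open>n\<close> has no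
  tangential part, and that of \<open>N\<close> pairs with \<open>skew\<close> like a multiple of
  \<open>N\<close>. Conversely the tangent bivector \<open>wedge (F x) (pd l F x)\<close> isolates
  \<open>- 2 * pd l H x\<close>.\<close>

lemma trace_N_tangential_iff:
  assumes x: "x \<in> D"
  shows "(\<forall>E\<in>skew. lie_ip E (N x) = 0 \<longrightarrow> lie_ip (second_form_trace g N x) E = 0) \<longleftrightarrow> (\<forall>l. pd l H x = 0)"
proof
  assume z: "\<forall>l. pd l H x = 0"
  let ?B = "second_form_trace g n x"
  have "?B - (lor ?B (n x) *\<^sub>R n x - (2 * H x) *\<^sub>R F x) = 0"
    by (rule frame_zero[OF x])
       (simp_all add: lor_simps trace_n_F[OF x] nF[OF x] FF[OF x] nn[OF x] ndF[OF x] FFi[OF x]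
         commuted_products[OF x] trace_n_pdF[OF x] z)
  then have B: "?B = lor ?B (n x) *\<^sub>R n x - (2 * H x) *\<^sub>R F x" by simp
  show "\<forall>E\<in>skew. lie_ip E (N x) = 0 \<longrightarrow> lie_ip (second_form_trace g N x) E = 0"
  proof (intro ballI impI)
    fix E assume E: "E \<in> skew" "lie_ip E (N x) = 0"
    have a: "lor (E *v F x) (n x) = 0" using E(2) skew_lie_ip_wedge[OF E(1)] by simp
    have b: "lor (E *v y) y = 0" for y using skewD[OF E(1), of y y] by (simp add: lor_commute)
    show "lie_ip (second_form_trace g N x) E = 0"
      unfolding trace_N_lie_ip[OF x E(1)] trace_F[OF x] by (subst B) (simp add: matvec_simps lor_simps a b)
  qed
next
  assume t: "\<forall>E\<in>skew. lie_ip E (N x) = 0 \<longrightarrow> lie_ip (second_form_trace g N x) E = 0"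
  show "\<forall>l. pd l H x = 0"
  proof
    fix l
    let ?E = "wedge (F x) (pd l F x)"
    have c: "lor (pd l F x) (F x) = 0" "lor (pd l F x) (n x) = 0" "lor (F x) (n x) = 0"
      by (simp_all add: commuted_products[OF x])
    have EF: "?E *v F x = pd l F x" "?E *v n x = 0" by (simp_all add: wedge_mult c FF[OF x])
    have "lie_ip ?E (N x) = 0" by (simp add: skew_lie_ip_wedge[OF wedge_skew] EF c)
    then have "lie_ip (second_form_trace g N x) ?E = 0" using t wedge_skew by blast
    then show "pd l H x = 0"
      unfolding trace_N_lie_ip[OF x wedge_skew] trace_F[OF x]
      using trace_n_pdF[OF x, of l] lor_commute[of "pd l F x" "second_form_trace g n x"]
      by (simp add: matvec_simps lor_simps EF c)
  qed
qed

text \<open>Up to sign and constant factors, \<open>q\<close> and \<open>r\<close> are the real and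
  imaginary part of the Hopf differential. In conformal coordinates the Christoffel symbols of the
  first kind are, up to sign, half derivatives of the conformal factor, and the Codazzi equations
  become Cauchy-Riemann equations with the gradient of \<open>H\<close> as inhomogeneity.\<close>

lemma conformal_Codazzi:
  assumes conf: "\<And>y. y \<in> D \<Longrightarrow> g y $ 1 $ 1 = g y $ 2 $ 2" "\<And>y. y \<in> D \<Longrightarrow> g y $ 1 $ 2 = 0" and x: "x \<in> D"
  defines "q \<equiv> \<lambda>y. lor (pd 1 n y) (pd 1 F y) - lor (pd 2 n y) (pd 2 F y)" and "r \<equiv> \<lambda>y. lor (pd 1 n y) (pd 2 F y)"
  shows "pd 1 q x = - 2 * pd 2 r x - 2 * g x $ 1 $ 1 * pd 1 H x"
    "pd 2 q x = 2 * pd 1 r x + 2 * g x $ 1 $ 1 * pd 2 H x"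
proof -
  let ?b = "\<lambda>i j y. lor (pd i n y) (pd j F y)"
  let ?C = "\<lambda>i j k. lor (pd i (pd j F) x) (pd k F x)"
  have sb: "smooth_on D (?b i j)" for i j by (rule smooth_on_lor[OF open_D pdn pdF])
  note db = smooth_on_differentiable[OF sb x] and dH = smooth_on_differentiable[OF smooth_H x]
  define E where "E y = g y $ 1 $ 1" for y
  have sE: "smooth_on D E" unfolding E_def g_nth by (rule smooth_on_lor[OF open_D pdF pdF])
  note dE = smooth_on_differentiable[OF sE x]
  have E0: "E y \<noteq> 0" if "y \<in> D" for y
    using matrix_inv_2(1)[OF invertible_g[OF that]] conf[OF that] by (auto simp: E_def)
  have hh: "h y $ 1 $ 1 = 1 / E y" "h y $ 2 $ 2 = 1 / E y" "h y $ 1 $ 2 = 0" "h y $ 2 $ 1 = 0" if "y \<in> D" for y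
    using matrix_inv_2[OF invertible_g[OF that]] conf[OF that] g_sym[of y 2 1] E0[OF that] by (simp_all add: E_def)
  have mm: "m i k y = ?b i k y / E y" if "y \<in> D" for i k y
    using exhaust_2[of k] by (auto simp: m_def sum_2 hh[OF that])
  have sumb: "?b 1 1 y + ?b 2 2 y = - 2 * (E y * H y)" if "y \<in> D" for y
    using H_eq_trace[OF that] E0[OF that] by (simp add: mm[OF that] field_simps)
  have C: "?C i j k = ?C j i k" for i j k by (simp add: pd_commute[OF open_D x smooth_F, of i j])
  have pg: "pd l (\<lambda>y. g y $ i $ j) x = ?C l j i + ?C l i j" for l i j
    unfolding g_nth using pd_lor[OF open_D x pdF pdF] by (simp add: lor_commute)
  have p11: "pd l E x = 2 * ?C l 1 1" for l using pg[of l 1 1] by (simp add: E_def[abs_def])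
  have p22: "pd l E x = 2 * ?C l 2 2" for l
  proof -
    have "pd l E x = pd l (\<lambda>y. g y $ 2 $ 2) x" by (rule pd_cong[OF open_D x]) (simp add: E_def conf(1))
    then show ?thesis by (simp add: pg)
  qed
  have p12: "?C l 2 1 + ?C l 1 2 = 0" for l
  proof -
    have "pd l (\<lambda>y. g y $ 1 $ 2) x = pd l (\<lambda>_. 0) x" by (rule pd_cong[OF open_D x conf(2)])
    then show ?thesis by (simp add: pg pd_const)
  qed
  have nC: "lor (pd i n x) (pd j (pd l F) x) * E x = ?b i 1 x * ?C j l 1 + ?b i 2 x * ?C j l 2" for i j l
  proof -
    have "lor (pd i n x) y = m i 1 x * lor y (pd 1 F x) + m i 2 x * lor y (pd 2 F x)" for y
      unfolding Weingarten[OF x, of i] lor_commute[of y] by (simp add: lor_sum_left lor_simps sum_2)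
    from this[of "pd j (pd l F) x"] show ?thesis using E0[OF x] by (simp add: mm[OF x] distrib_right)
  qed
  have cod: "pd l (?b i j) x - pd i (?b l j) x = lor (pd i n x) (pd l (pd j F) x) - lor (pd l n x) (pd i (pd j F) x)" for i j l
    using pd_lor[OF open_D x pdn pdF] pd_commute[OF open_D x smooth_n, of i l] by simp
  have b21: "?b 2 1 y = ?b 1 2 y" if "y \<in> D" for y by (rule b_sym[OF that])
  have pb21: "pd l (?b 2 1) x = pd l (?b 1 2) x" for l by (rule pd_cong[OF open_D x b21])
  have C111: "?C 1 1 1 = pd 1 E x / 2" and C122: "?C 1 2 2 = pd 1 E x / 2" and C222: "?C 2 2 2 = pd 2 E x / 2"
    using p11[of 1] p22 by simp_all
  have C211: "?C 2 1 1 = pd 2 E x / 2" using p11[of 2] by simp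
  have C121: "?C 1 2 1 = pd 2 E x / 2" using C211 C[of 1 2 1] by simp
  have C212: "?C 2 1 2 = pd 1 E x / 2" using C122 C[of 2 1 2] by simp
  have C112: "?C 1 1 2 = - (pd 2 E x / 2)" using p12[of 1] C121 by simp
  have C221: "?C 2 2 1 = - (pd 1 E x / 2)" using p12[of 2] C212 by simp
  \<comment> \<open>The Christoffel terms collapse to the sum of the diagonal entries, which
    \<open>sumb\<close> expresses by the mean curvature.\<close>
  have "(pd 2 (?b 1 1) x - pd 1 (?b 1 2) x) * E x = pd 2 E x / 2 * (?b 1 1 x + ?b 2 2 x)"
    using cod[of 2 1 1] nC[of 1 2 1] nC[of 2 1 1]
    unfolding C211 C212 C112 C222 C121 C111 C122 b21[OF x] pb21 by algebra
  then have "(pd 2 (?b 1 1) x - pd 1 (?b 1 2) x) * E x = (- (pd 2 E x * H x)) * E x"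
    unfolding sumb[OF x] by (simp add: algebra_simps)
  then have 1: "pd 2 (?b 1 1) x - pd 1 (?b 1 2) x = - (pd 2 E x * H x)"
    using mult_right_cancel[OF E0[OF x]] by blast
  have "(pd 2 (?b 1 2) x - pd 1 (?b 2 2) x) * E x = - (pd 1 E x / 2 * (?b 1 1 x + ?b 2 2 x))"
    using cod[of 2 1 2] nC[of 1 2 2] nC[of 2 1 2]
    unfolding C211 C212 C221 C222 C121 C111 C122 b21[OF x] by algebra
  then have "(pd 2 (?b 1 2) x - pd 1 (?b 2 2) x) * E x = (pd 1 E x * H x) * E x"
    unfolding sumb[OF x] by (simp add: algebra_simps)
  then have 2: "pd 2 (?b 1 2) x - pd 1 (?b 2 2) x = pd 1 E x * H x"
    using mult_right_cancel[OF E0[OF x]] by blast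
  have 3: "pd l (?b 1 1) x + pd l (?b 2 2) x = - 2 * (pd l E x * H x + E x * pd l H x)" for l
  proof -
    have "pd l (\<lambda>y. ?b 1 1 y + ?b 2 2 y) x = pd l (\<lambda>y. (- 2) *\<^sub>R (E y * H y)) x"
      by (rule pd_cong[OF open_D x]) (simp add: sumb)
    also have "\<dots> = (- 2) *\<^sub>R pd l (\<lambda>y. E y * H y) x"
      by (rule pd_linear[OF bounded_linear_scaleR_right differentiable_mult[OF dE dH]])
    also have "pd l (\<lambda>y. E y * H y) x = E x * pd l H x + pd l E x * H x"
      by (rule pd_bilinear[OF bounded_bilinear_mult dE dH])
    finally show ?thesis using pd_add[OF db db] by simp
  qed
  have q: "pd l q x = pd l (?b 1 1) x - pd l (?b 2 2) x" for l
  proof -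
    have "pd l q x = pd l (\<lambda>y. ?b 1 1 y + - ?b 2 2 y) x" unfolding q_def by simp
    also have "\<dots> = pd l (?b 1 1) x + pd l (\<lambda>y. - ?b 2 2 y) x"
      by (rule pd_add[OF db differentiable_minus[OF db]])
    also have "pd l (\<lambda>y. - ?b 2 2 y) x = - pd l (?b 2 2) x"
      by (rule pd_linear[OF bounded_linear_minus[OF bounded_linear_ident] db])
    finally show ?thesis by simp
  qed
  have r: "pd l r x = pd l (?b 1 2) x" for l unfolding r_def ..
  show "pd 1 q x = - 2 * pd 2 r x - 2 * g x $ 1 $ 1 * pd 1 H x"
    using 2 3[of 1] unfolding q r E_def[symmetric] by (simp add: algebra_simps)
  show "pd 2 q x = 2 * pd 1 r x + 2 * g x $ 1 $ 1 * pd 2 H x"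
    using 1 3[of 2] unfolding q r E_def[symmetric] by (simp add: algebra_simps)
qed

end

context surface_patch
begin

lemma pdF_independent:
  assumes x: "x \<in> D" and c: "c1 *\<^sub>R pd 1 F x + c2 *\<^sub>R pd 2 F x = 0"
  shows "c1 = 0" "c2 = 0"
proof -
  note d = smooth_on_differentiable[OF smooth_F x]
  have "frechet_derivative F (at x) (vector [c1, c2]) = 0"
    unfolding frechet_pd_expansion[OF d] using c by (simp add: sum_2)
  then have "vector [c1, c2] = (0 :: real^2)"
    using inj_dF[OF x] linear_injective_0[OF linear_frechet_derivative[OF d]] by blast
  then show "c1 = 0" "c2 = 0" by (simp_all add: vec_eq_iff forall_2)
qed

end

section \<open>Invariance of the mean curvature under reparametrization\<close>

text \<open>The Weingarten matrices of the two parametrizations are conjugate under the Jacobian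
  \<open>J\<close>, which is invertible because \<open>F'\<close> is an immersion; so their traces
  agree.\<close>

lemma mean_curvature_compose:
  assumes S: "surface_patch D F n" and S': "surface_patch D' F' n'"
    and T: "open T" "x \<in> T" "T \<subseteq> D'" and \<theta>: "\<theta> ` T \<subseteq> D" "\<theta> differentiable (at x)"
    and F': "\<And>y. y \<in> T \<Longrightarrow> F' y = F (\<theta> y)" and n': "\<And>y. y \<in> T \<Longrightarrow> n' y = n (\<theta> y)"
  shows "mean_curvature F' n' x = mean_curvature F n (\<theta> x)"
proof -
  interpret a: surface_patch D F n by (rule S)
  interpret b: surface_patch D' F' n' by (rule S')
  have x: "x \<in> D'" "\<theta> x \<in> D" using T \<theta> by auto
  define J where "J j k = pd j \<theta> x $ k" for j k
  have pF: "pd j F' x = J j 1 *\<^sub>R pd 1 F (\<theta> x) + J j 2 *\<^sub>R pd 2 F (\<theta> x)" for j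
  proof -
    have "pd j F' x = pd j (\<lambda>y. F (\<theta> y)) x" by (rule pd_cong[OF T(1,2) F'])
    then show ?thesis
      using pd_compose[OF \<theta>(2) smooth_on_differentiable[OF a.smooth_F x(2)]] by (simp add: sum_2 J_def)
  qed
  have pn: "pd j n' x = J j 1 *\<^sub>R pd 1 n (\<theta> x) + J j 2 *\<^sub>R pd 2 n (\<theta> x)" for j
  proof -
    have "pd j n' x = pd j (\<lambda>y. n (\<theta> y)) x" by (rule pd_cong[OF T(1,2) n'])
    then show ?thesis
      using pd_compose[OF \<theta>(2) smooth_on_differentiable[OF a.smooth_n x(2)]] by (simp add: sum_2 J_def)
  qed
  let ?m = "\<lambda>j k. a.m j k (\<theta> x)" and ?m' = "\<lambda>j k. b.m j k x"
  have rel: "?m' j 1 * J 1 k + ?m' j 2 * J 2 k = J j 1 * ?m 1 k + J j 2 * ?m 2 k" for j k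
  proof -
    let ?c = "\<lambda>k. (?m' j 1 * J 1 k + ?m' j 2 * J 2 k) - (J j 1 * ?m 1 k + J j 2 * ?m 2 k)"
    have "pd j n' x = ?m' j 1 *\<^sub>R pd 1 F' x + ?m' j 2 *\<^sub>R pd 2 F' x"
      using b.Weingarten[OF x(1), of j] by (simp add: sum_2)
    moreover have "pd j n' x = J j 1 *\<^sub>R (?m 1 1 *\<^sub>R pd 1 F (\<theta> x) + ?m 1 2 *\<^sub>R pd 2 F (\<theta> x))
        + J j 2 *\<^sub>R (?m 2 1 *\<^sub>R pd 1 F (\<theta> x) + ?m 2 2 *\<^sub>R pd 2 F (\<theta> x))"
      using a.Weingarten[OF x(2)] by (simp add: pn sum_2)
    ultimately have "?c 1 *\<^sub>R pd 1 F (\<theta> x) + ?c 2 *\<^sub>R pd 2 F (\<theta> x) = 0"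
      by (simp add: pF algebra_simps)
    from a.pdF_independent[OF x(2) this] show ?thesis using exhaust_2[of k] by auto
  qed
  have det: "J 1 1 * J 2 2 - J 1 2 * J 2 1 \<noteq> 0"
  proof
    assume z: "J 1 1 * J 2 2 - J 1 2 * J 2 1 = 0"
    have "J 2 k *\<^sub>R pd 1 F' x + (- J 1 k) *\<^sub>R pd 2 F' x
      = (J 2 k * J 1 1 - J 1 k * J 2 1) *\<^sub>R pd 1 F (\<theta> x) + (J 2 k * J 1 2 - J 1 k * J 2 2) *\<^sub>R pd 2 F (\<theta> x)" for k
      by (simp add: pF algebra_simps)
    moreover have "J 2 k * J 1 1 - J 1 k * J 2 1 = 0" "J 2 k * J 1 2 - J 1 k * J 2 2 = 0" for k
      using z exhaust_2[of k] by (auto simp: mult.commute)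
    ultimately have "J 2 k *\<^sub>R pd 1 F' x + (- J 1 k) *\<^sub>R pd 2 F' x = 0" for k by simp
    from b.pdF_independent[OF x(1) this] have "J 1 k = 0" "J 2 k = 0" for k by auto
    then have "pd 1 F' x = 0" by (simp add: pF)
    then have "1 *\<^sub>R pd 1 F' x + 0 *\<^sub>R pd 2 F' x = 0" by simp
    from b.pdF_independent(1)[OF x(1) this] show False by simp
  qed
  have "(?m' 1 1 + ?m' 2 2) * (J 1 1 * J 2 2 - J 1 2 * J 2 1) = (?m 1 1 + ?m 2 2) * (J 1 1 * J 2 2 - J 1 2 * J 2 1)"
    using rel[of 1 1] rel[of 1 2] rel[of 2 1] rel[of 2 2] by algebra
  then have "?m' 1 1 + ?m' 2 2 = ?m 1 1 + ?m 2 2" using det mult_right_cancel by blast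
  then show ?thesis by (simp add: a.H_eq_trace[OF x(2)] b.H_eq_trace[OF x(1)])
qed

section \<open>Isothermal coordinates\<close>

definition toC :: "real^2 \<Rightarrow> complex" where "toC v = Complex (v $ 1) (v $ 2)"

definition ofC :: "complex \<Rightarrow> real^2" where "ofC z = vector [Re z, Im z]"

lemma toC_ofC [simp]: "toC (ofC z) = z" and ofC_toC [simp]: "ofC (toC v) = v"
  by (simp_all add: toC_def ofC_def vec_eq_iff forall_2 complex_eq_iff)

lemma bounded_linear_toC: "bounded_linear toC" and bounded_linear_ofC: "bounded_linear ofC"
  unfolding linear_conv_bounded_linear[symmetric]
  by (auto intro!: linearI simp: toC_def ofC_def complex_eq_iff vec_eq_iff forall_2)

lemma toC_axis: "toC (axis 1 1) = 1" "toC (axis 2 1) = \<i>"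
  by (simp_all add: toC_def axis_2_nth complex_eq_iff)

lemma ofC_axis: "ofC 1 = axis 1 1" "ofC \<i> = axis 2 1"
  using toC_axis ofC_toC by metis+

lemma continuous_toC: "continuous_on S toC" and continuous_ofC: "continuous_on T ofC"
  using bounded_linear_toC bounded_linear_ofC linear_continuous_on by blast+

lemma open_toC_vimage: "open U \<Longrightarrow> open (toC -` U)" and open_ofC_vimage: "open V \<Longrightarrow> open (ofC -` V)"
  using continuous_toC[of UNIV] continuous_ofC[of UNIV] by (auto intro: open_vimage)

lemma pd_toC:
  assumes "f differentiable (at (toC x))"
  shows "pd 1 (\<lambda>y. f (toC y)) x = frechet_derivative f (at (toC x)) 1"
    "pd 2 (\<lambda>y. f (toC y)) x = frechet_derivative f (at (toC x)) \<i>"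
proof -
  have "((\<lambda>y. f (toC y)) has_derivative (\<lambda>h. frechet_derivative f (at (toC x)) (toC h))) (at x)"
    by (rule has_derivative_compose[OF bounded_linear_imp_has_derivative[OF bounded_linear_toC]])
       (use assms frechet_derivative_works in blast)
  from frechet_derivative_eq[OF this]
  show "pd 1 (\<lambda>y. f (toC y)) x = frechet_derivative f (at (toC x)) 1"
    "pd 2 (\<lambda>y. f (toC y)) x = frechet_derivative f (at (toC x)) \<i>"
    by (simp_all add: pd_def toC_axis)
qed

text \<open>\<open>L\<close> is the real derivative of \<open>\<Phi>\<close>. Complex
  differentiability means \<open>L \<i> = \<i> * L 1\<close>, and the two equations are its real and
  imaginary parts.\<close>

lemma field_differentiable_iff_Cauchy_Riemann:
  assumes U: "open U" "x \<in> U" and \<Phi>: "\<And>y. y \<in> U \<Longrightarrow> \<Phi> (toC y) = Complex (u y) (v y)"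
    and u: "u differentiable (at x)" and v: "v differentiable (at x)"
  shows "\<Phi> field_differentiable (at (toC x)) \<longleftrightarrow> pd 1 u x = pd 2 v x \<and> pd 2 u x = - pd 1 v x"
proof -
  define L where "L h = Complex (frechet_derivative u (at x) (ofC h)) (frechet_derivative v (at x) (ofC h))" for h
  have L: "(\<Phi> has_derivative L) (at (toC x))"
  proof (rule has_derivative_transform_within_open)
    have o: "(ofC has_derivative ofC) (at (toC x))" by (rule bounded_linear_imp_has_derivative[OF bounded_linear_ofC])
    have "((\<lambda>z. u (ofC z)) has_derivative (\<lambda>h. frechet_derivative u (at x) (ofC h))) (at (toC x))"
      by (rule has_derivative_compose[OF o]) (use u[unfolded frechet_derivative_works] in simp)
    moreover have "((\<lambda>z. v (ofC z)) has_derivative (\<lambda>h. frechet_derivative v (at x) (ofC h))) (at (toC x))"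
      by (rule has_derivative_compose[OF o]) (use v[unfolded frechet_derivative_works] in simp)
    ultimately have "((\<lambda>z. of_real (u (ofC z)) + \<i> * of_real (v (ofC z))) has_derivative
        (\<lambda>h. of_real (frechet_derivative u (at x) (ofC h)) + \<i> * of_real (frechet_derivative v (at x) (ofC h)))) (at (toC x))"
      by (intro has_derivative_add has_derivative_mult_right has_derivative_of_real)
    then show "((\<lambda>z. Complex (u (ofC z)) (v (ofC z))) has_derivative L) (at (toC x))"
      by (simp add: L_def[abs_def] Complex_eq)
    show "open (ofC -` U)" by (rule open_ofC_vimage[OF U(1)])
    show "toC x \<in> ofC -` U" using U by simp
    show "Complex (u (ofC z)) (v (ofC z)) = \<Phi> z" if "z \<in> ofC -` U" for z
      using \<Phi>[of "ofC z"] that by simp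
  qed
  have L1: "L 1 = Complex (pd 1 u x) (pd 1 v x)" and Li: "L \<i> = Complex (pd 2 u x) (pd 2 v x)"
    by (simp_all add: L_def ofC_axis pd_def)
  have "\<Phi> field_differentiable (at (toC x)) \<longleftrightarrow> L \<i> = \<i> * L 1"
  proof
    assume "\<Phi> field_differentiable (at (toC x))"
    then obtain c where "(\<Phi> has_derivative (*) c) (at (toC x))"
      by (auto simp: field_differentiable_def has_field_derivative_def)
    then have "L = (*) c" using has_derivative_unique[OF L] by simp
    then show "L \<i> = \<i> * L 1" by simp
  next
    assume i: "L \<i> = \<i> * L 1"
    have lin: "linear L" using has_derivative_linear[OF L] .
    have "L h = L 1 * h" for h
    proof -
      have "h = Re h *\<^sub>R 1 + Im h *\<^sub>R \<i>" by (simp add: complex_eq_iff)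
      then have "L h = Re h *\<^sub>R L 1 + Im h *\<^sub>R L \<i>"
        using linear_add[OF lin] linear_cmul[OF lin] by metis
      also have "\<dots> = L 1 * (Re h *\<^sub>R 1 + Im h *\<^sub>R \<i>)" by (simp add: i algebra_simps scaleR_conv_of_real)
      finally show ?thesis using \<open>h = _\<close> by simp
    qed
    then have "L = (*) (L 1)" by (rule ext)
    then have "(\<Phi> has_derivative (*) (L 1)) (at (toC x))" using L by simp
    then show "\<Phi> field_differentiable (at (toC x))"
      unfolding field_differentiable_def has_field_derivative_def by blast
  qed
  also have "\<dots> \<longleftrightarrow> pd 1 u x = pd 2 v x \<and> pd 2 u x = - pd 1 v x"
    by (auto simp: L1 Li complex_eq_iff)
  finally show ?thesis .
qed

text \<open>By Cramer's rule the derivative of the inverse is a smooth function \<open>R\<close>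
  evaluated at \<open>\<gamma> y\<close>, so each order of differentiability of
  \<open>\<gamma>\<close> yields the next.\<close>

lemma smooth_inverse_2d:
  fixes f \<gamma> :: "real^2 \<Rightarrow> real^2"
  assumes U: "open U" "smooth_on U f" and V: "open V" "\<gamma> ` V \<subseteq> U" "continuous_on V \<gamma>"
    and d: "\<And>y. y \<in> V \<Longrightarrow> (\<gamma> has_derivative \<gamma>' y) (at y)"
    and inv: "\<And>y v. y \<in> V \<Longrightarrow> frechet_derivative f (at (\<gamma> y)) (\<gamma>' y v) = v"
    and det: "\<And>x. x \<in> U \<Longrightarrow> pd 1 f x $ 1 * pd 2 f x $ 2 - pd 1 f x $ 2 * pd 2 f x $ 1 \<noteq> 0"
  shows "smooth_on V \<gamma>"
proof -
  let ?d = "\<lambda>x. pd 1 f x $ 1 * pd 2 f x $ 2 - pd 1 f x $ 2 * pd 2 f x $ 1"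
  define R where "R v x = ((v $ 1 * pd 2 f x $ 2 - v $ 2 * pd 2 f x $ 1) / ?d x) *\<^sub>R axis 1 1
     + ((pd 1 f x $ 1 * v $ 2 - pd 1 f x $ 2 * v $ 1) / ?d x) *\<^sub>R (axis 2 1 :: real^2)" for v x :: "real^2"
  have sp: "smooth_on U (\<lambda>x. pd i f x $ j)" for i j by (rule smooth_on_nth[OF U(1) smooth_on_pd[OF U(2)]])
  have sR: "smooth_on U (R v)" for v
    unfolding R_def
    by (intro smooth_on_add smooth_on_scaleR smooth_on_divide smooth_on_diff smooth_on_mult smooth_on_const sp U(1) det)
  have gR: "\<gamma>' y v = R v (\<gamma> y)" if y: "y \<in> V" for y v
  proof -
    let ?x = "\<gamma> y" and ?a = "\<gamma>' y v $ 1" and ?b = "\<gamma>' y v $ 2"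
    have x: "?x \<in> U" using V y by auto
    have "v = ?a *\<^sub>R pd 1 f ?x + ?b *\<^sub>R pd 2 f ?x"
      using inv[OF y, of v] unfolding frechet_pd_expansion[OF smooth_on_differentiable[OF U(2) x]] by (simp add: sum_2)
    then have v: "v $ 1 = ?a * pd 1 f ?x $ 1 + ?b * pd 2 f ?x $ 1" "v $ 2 = ?a * pd 1 f ?x $ 2 + ?b * pd 2 f ?x $ 2"
      by (metis vector_add_component vector_scaleR_component real_scaleR_def)+
    have "v $ 1 * pd 2 f ?x $ 2 - v $ 2 * pd 2 f ?x $ 1 = ?a * ?d ?x"
      "pd 1 f ?x $ 1 * v $ 2 - pd 1 f ?x $ 2 * v $ 1 = ?b * ?d ?x"
      unfolding v by (simp_all add: algebra_simps)
    then have "R v ?x = ?a *\<^sub>R axis 1 1 + ?b *\<^sub>R axis 2 1" using det[OF x] by (simp add: R_def)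
    then show ?thesis by (simp add: vec_eq_iff forall_2 axis_2_nth)
  qed
  have "Ck_on k V \<gamma>" for k
  proof (induction k)
    case 0
    then show ?case using V by simp
  next
    case (Suc k)
    show ?case
    proof (rule Ck_on_SucI[OF V(1) d])
      fix v
      have "Ck_on k V (\<lambda>y. R v (\<gamma> y))"
        using Ck_on_compose[OF V(1) U(1) V(2) _ Suc] sR[of v] unfolding smooth_on_def by blast
      then show "Ck_on k V (\<lambda>y. \<gamma>' y v)" by (rule Ck_on_cong[OF V(1), rotated]) (simp add: gR)
    qed
  qed
  then show ?thesis by (simp add: smooth_on_def)
qed

lemma smooth_local_inverse_2d:
  fixes f :: "real^2 \<Rightarrow> real^2"
  assumes U: "open U" "x0 \<in> U" "smooth_on U f"
    and det: "\<And>x. x \<in> U \<Longrightarrow> pd 1 f x $ 1 * pd 2 f x $ 2 - pd 1 f x $ 2 * pd 2 f x $ 1 \<noteq> 0"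
  obtains U' V \<gamma> where "open U'" "U' \<subseteq> U" "x0 \<in> U'" "open V" "homeomorphism U' V f \<gamma>" "smooth_on V \<gamma>"
proof -
  let ?f' = "\<lambda>x. Blinfun (frechet_derivative f (at x))"
  have bl: "bounded_linear (frechet_derivative f (at x))" if "x \<in> U" for x
    using has_derivative_bounded_linear[OF smooth_on_has_derivative[OF U(3) that]] .
  have app: "blinfun_apply (?f' x) = frechet_derivative f (at x)" if "x \<in> U" for x
    using bounded_linear_Blinfun_apply[OF bl[OF that]] .
  have cont: "continuous_on U ?f'"
  proof (rule continuous_on_blinfun_componentwise)
    fix i :: "real^2" assume "i \<in> Basis"
    have "continuous_on U (\<lambda>x. frechet_derivative f (at x) i)"
      by (rule smooth_on_continuous_on[OF smooth_on_frechet_derivative[OF U(3)]])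
    then show "continuous_on U (\<lambda>x. blinfun_apply (?f' x) i)"
      by (rule continuous_on_eq) (simp add: app)
  qed
  have lin: "linear (frechet_derivative f (at x))" if "x \<in> U" for x
    using bl[OF that] bounded_linear.linear by blast
  have "inj (frechet_derivative f (at x0))"
  proof (subst linear_injective_0[OF lin[OF U(2)]], intro allI impI)
    fix v assume "frechet_derivative f (at x0) v = 0"
    then have "v $ 1 *\<^sub>R pd 1 f x0 + v $ 2 *\<^sub>R pd 2 f x0 = 0"
      unfolding frechet_pd_expansion[OF smooth_on_differentiable[OF U(3,2)]] by (simp add: sum_2)
    then have e: "v $ 1 * pd 1 f x0 $ 1 + v $ 2 * pd 2 f x0 $ 1 = 0" "v $ 1 * pd 1 f x0 $ 2 + v $ 2 * pd 2 f x0 $ 2 = 0"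
      by (metis vector_add_component vector_scaleR_component real_scaleR_def zero_index)+
    let ?d = "pd 1 f x0 $ 1 * pd 2 f x0 $ 2 - pd 1 f x0 $ 2 * pd 2 f x0 $ 1"
    have "v $ 1 * ?d = 0" "v $ 2 * ?d = 0" using e by algebra+
    then show "v = 0" using det[OF U(2)] by (simp add: vec_eq_iff forall_2)
  qed
  then obtain L where L: "linear L" "L \<circ> frechet_derivative f (at x0) = id"
    using linear_injective_left_inverse[OF lin[OF U(2)]] by blast
  have bL: "bounded_linear L" using L(1) by (simp add: linear_conv_bounded_linear)
  have inv: "Blinfun L o\<^sub>L ?f' x0 = id_blinfun"
    by (rule blinfun_eqI) (use L(2) in \<open>simp add: app[OF U(2)] bounded_linear_Blinfun_apply[OF bL] fun_eq_iff\<close>)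
  have der: "(f has_derivative blinfun_apply (?f' x)) (at x)" if "x \<in> U" for x
    unfolding app[OF that] by (rule smooth_on_has_derivative[OF U(3) that])
  obtain U' V \<gamma> \<gamma>' where r: "open U'" "U' \<subseteq> U" "x0 \<in> U'" "open V" "homeomorphism U' V f \<gamma>"
    "\<And>y. y \<in> V \<Longrightarrow> (\<gamma> has_derivative (\<gamma>' y)) (at y)"
    "\<And>y. y \<in> V \<Longrightarrow> \<gamma>' y = Hilbert_Choice.inv (blinfun_apply (?f' (\<gamma> y)))"
    "\<And>y. y \<in> V \<Longrightarrow> bij (blinfun_apply (?f' (\<gamma> y)))"
    using inverse_function_theorem[OF U(1) der cont U(2) inv] by metis
  have gV: "\<gamma> ` V = U'" using r(5) by (simp add: homeomorphism_def)
  have "smooth_on V \<gamma>"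
  proof (rule smooth_inverse_2d[OF U(1,3) r(4) _ _ r(6) _ det])
    show "\<gamma> ` V \<subseteq> U" using gV r(2) by simp
    show "continuous_on V \<gamma>" using r(5) by (simp add: homeomorphism_def)
    fix y v assume y: "y \<in> V"
    have "\<gamma> y \<in> U" using gV r(2) y by auto
    then show "frechet_derivative f (at (\<gamma> y)) (\<gamma>' y v) = v"
      using r(7,8)[OF y] by (simp add: app bij_is_surj surj_f_inv_f)
  qed
  then show thesis using that r(1-5) by blast
qed

context surface_patch
begin

lemma lor_dF:
  assumes x: "x \<in> D"
  shows "lor (frechet_derivative F (at x) v) (frechet_derivative F (at x) v') =
    g x $ 1 $ 1 * v $ 1 * v' $ 1 + g x $ 1 $ 2 * (v $ 1 * v' $ 2 + v $ 2 * v' $ 1) + g x $ 2 $ 2 * v $ 2 * v' $ 2"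
  unfolding frechet_pd_expansion[OF smooth_on_differentiable[OF smooth_F x]] g_nth
  using lor_commute[of "pd 2 F x" "pd 1 F x"]
  by (simp add: sum_2 lor_simps algebra_simps)

lemma g11_pos: "x \<in> D \<Longrightarrow> g x $ 1 $ 1 > 0"
  using dF_spacelike[of x "axis 1 1"] lor_dF[of x "axis 1 1" "axis 1 1"]
  by (simp add: axis_2_nth vec_eq_iff forall_2)

lemma det_g_pos:
  assumes x: "x \<in> D"
  shows "g x $ 1 $ 1 * g x $ 2 $ 2 - (g x $ 1 $ 2)\<^sup>2 > 0"
proof -
  define v :: "real^2" where "v = vector [- g x $ 1 $ 2, g x $ 1 $ 1]"
  have "v $ 2 > 0" using g11_pos[OF x] by (simp add: v_def)
  then have "v \<noteq> 0" by auto
  from dF_spacelike[OF x this] have "0 < g x $ 1 $ 1 * (g x $ 1 $ 1 * g x $ 2 $ 2 - (g x $ 1 $ 2)\<^sup>2)"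
    unfolding lor_dF[OF x] by (simp add: v_def algebra_simps power2_eq_square)
  then show ?thesis using g11_pos[OF x] by (simp add: zero_less_mult_iff)
qed

text \<open>The metric is \<open>g11 |dx + \<tau> dy|\<^sup>2\<close>.\<close>

definition \<tau> :: "real^2 \<Rightarrow> complex" where
  "\<tau> x = Complex (g x $ 1 $ 2 / g x $ 1 $ 1) (sqrt (g x $ 1 $ 1 * g x $ 2 $ 2 - (g x $ 1 $ 2)\<^sup>2) / g x $ 1 $ 1)"

lemma Im_\<tau>: "x \<in> D \<Longrightarrow> Im (\<tau> x) > 0"
  using g11_pos det_g_pos by (simp add: \<tau>_def)

lemma smooth_\<tau>: "smooth_on D \<tau>"
proof -
  have sg: "smooth_on D (\<lambda>x. g x $ i $ j)" for i j
    unfolding g_nth by (rule smooth_on_lor[OF open_D pdF pdF])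
  have "smooth_on D (\<lambda>x. of_real (g x $ 1 $ 2 / g x $ 1 $ 1)
     + \<i> * of_real (sqrt (g x $ 1 $ 1 * g x $ 2 $ 2 - g x $ 1 $ 2 * g x $ 1 $ 2) / g x $ 1 $ 1))"
    by (intro smooth_on_add smooth_on_mult smooth_on_const open_D smooth_on_linear_compose[OF open_D bounded_linear_of_real]
        smooth_on_divide smooth_on_sqrt smooth_on_diff sg)
       (use g11_pos det_g_pos in \<open>auto simp: power2_eq_square less_imp_neq[symmetric]\<close>)
  then show ?thesis by (simp add: \<tau>_def[abs_def] Complex_eq power2_eq_square)
qed

lemma lor_dF_\<tau>:
  assumes x: "x \<in> D"
  shows "lor (frechet_derivative F (at x) v) (frechet_derivative F (at x) v') =
    g x $ 1 $ 1 * Re ((of_real (v $ 1) + of_real (v $ 2) * \<tau> x) * cnj (of_real (v' $ 1) + of_real (v' $ 2) * \<tau> x))"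
proof -
  let ?E = "g x $ 1 $ 1" and ?G = "g x $ 2 $ 2" and ?F = "g x $ 1 $ 2"
  define W where "W = sqrt (?E * ?G - ?F\<^sup>2)"
  have W: "W * W = ?E * ?G - ?F\<^sup>2" using det_g_pos[OF x] by (simp add: W_def)
  have E: "?E > 0" by (rule g11_pos[OF x])
  have \<tau>: "Re (\<tau> x) * ?E = ?F" "Im (\<tau> x) * ?E = W" using E by (simp_all add: \<tau>_def W_def)
  let ?r = "Re (\<tau> x)" and ?i = "Im (\<tau> x)"
  have "?E * (?E * (?r * ?r + ?i * ?i)) = (?r * ?E) * (?r * ?E) + (?i * ?E) * (?i * ?E)" by (simp add: algebra_simps)
  also have "\<dots> = ?E * ?G" unfolding \<tau> W by (simp add: power2_eq_square)
  finally have "?E * (?E * (?r * ?r + ?i * ?i)) = ?E * ?G" .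
  then have N: "?E * (?r * ?r + ?i * ?i) = ?G" using E by simp
  have "Re ((of_real (v $ 1) + of_real (v $ 2) * \<tau> x) * cnj (of_real (v' $ 1) + of_real (v' $ 2) * \<tau> x))
      = v $ 1 * v' $ 1 + ?r * (v $ 1 * v' $ 2 + v $ 2 * v' $ 1) + (?r * ?r + ?i * ?i) * (v $ 2 * v' $ 2)"
    by (simp add: algebra_simps)
  moreover have "?E * (a + ?r * b + (?r * ?r + ?i * ?i) * c) = ?E * a + ?F * b + ?G * c" for a b c
  proof -
    have "?E * (a + ?r * b + (?r * ?r + ?i * ?i) * c) = ?E * a + (?r * ?E) * b + (?E * (?r * ?r + ?i * ?i)) * c"
      by (simp add: algebra_simps)
    then show ?thesis unfolding \<tau>(1) N .
  qed
  ultimately show ?thesis unfolding lor_dF[OF x] by (simp only: mult.assoc)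
qed

text \<open>A solution of the Beltrami equation satisfies
  \<open>dW = pd 1 W (dx + \<tau> dy)\<close>, so the metric is a positive multiple of
  \<open>|dW|^2\<close> and becomes conformal in the coordinates \<open>W\<close>. These are local
  coordinates because the Jacobian is \<open>Im \<tau> |pd 1 W|^2\<close>.\<close>

lemma isothermal_coordinates:
  assumes x0: "x0 \<in> D"
  obtains U V and \<gamma> :: "real^2 \<Rightarrow> real^2" and w where "open U" "x0 \<in> U" "U \<subseteq> D" "open V" "homeomorphism U V w \<gamma>" "smooth_on U w" "smooth_on V \<gamma>"
    "\<And>y. y \<in> V \<Longrightarrow> lor (pd 1 (\<lambda>y. F (\<gamma> y)) y) (pd 1 (\<lambda>y. F (\<gamma> y)) y) > 0"
    "\<And>y. y \<in> V \<Longrightarrow> lor (pd 1 (\<lambda>y. F (\<gamma> y)) y) (pd 1 (\<lambda>y. F (\<gamma> y)) y) = lor (pd 2 (\<lambda>y. F (\<gamma> y)) y) (pd 2 (\<lambda>y. F (\<gamma> y)) y)"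
    "\<And>y. y \<in> V \<Longrightarrow> lor (pd 1 (\<lambda>y. F (\<gamma> y)) y) (pd 2 (\<lambda>y. F (\<gamma> y)) y) = 0"
proof -
  obtain U1 W where U1: "open U1" "x0 \<in> U1" "U1 \<subseteq> D" and W: "smooth_on U1 W"
    and bel: "\<And>x. x \<in> U1 \<Longrightarrow> pd 2 W x = \<tau> x * pd 1 W x" and nz: "\<And>x. x \<in> U1 \<Longrightarrow> pd 1 W x \<noteq> 0"
    using isothermal_function[OF open_D x0 smooth_\<tau> Im_\<tau>[OF x0]] by blast
  define w where "w x = ofC (W x)" for x
  have sw: "smooth_on U1 w" unfolding w_def by (rule smooth_on_linear_compose[OF U1(1) bounded_linear_ofC W])
  have pw: "pd i w x = ofC (pd i W x)" if "x \<in> U1" for i x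
    unfolding w_def by (rule pd_linear[OF bounded_linear_ofC smooth_on_differentiable[OF W that]])
  have det: "pd 1 w x $ 1 * pd 2 w x $ 2 - pd 1 w x $ 2 * pd 2 w x $ 1 \<noteq> 0" if x: "x \<in> U1" for x
  proof -
    let ?a = "pd 1 W x"
    have "pd 1 w x $ 1 * pd 2 w x $ 2 - pd 1 w x $ 2 * pd 2 w x $ 1 = Im (\<tau> x) * ((Re ?a)\<^sup>2 + (Im ?a)\<^sup>2)"
      by (simp add: pw[OF x] bel[OF x] ofC_def algebra_simps power2_eq_square)
    moreover have "(Re ?a)\<^sup>2 + (Im ?a)\<^sup>2 \<noteq> 0" using nz[OF x] by (simp add: complex_eq_iff sum_power2_eq_zero_iff)
    ultimately show ?thesis using Im_\<tau>[of x] U1(3) x by auto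
  qed
  obtain U V \<gamma> where UV: "open U" "U \<subseteq> U1" "x0 \<in> U" "open V" and hom: "homeomorphism U V w \<gamma>" and s\<gamma>: "smooth_on V \<gamma>"
    using smooth_local_inverse_2d[OF U1(1,2) sw det] by blast
  have gV: "\<gamma> y \<in> U" "\<gamma> y \<in> U1" "\<gamma> y \<in> D" if "y \<in> V" for y
    using hom UV(2) U1(3) that by (auto simp: homeomorphism_def)
  have wg: "w (\<gamma> y) = y" if "y \<in> V" for y using hom that by (simp add: homeomorphism_def)
  have comp: "pd i (\<lambda>y. F (\<gamma> y)) y = frechet_derivative F (at (\<gamma> y)) (pd i \<gamma> y)"
    "pd i (\<lambda>y. W (\<gamma> y)) y = frechet_derivative W (at (\<gamma> y)) (pd i \<gamma> y)" if "y \<in> V" for i y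
    using pd_compose[OF smooth_on_differentiable[OF s\<gamma> that] smooth_on_differentiable[OF smooth_F gV(3)[OF that]]]
      pd_compose[OF smooth_on_differentiable[OF s\<gamma> that] smooth_on_differentiable[OF W gV(2)[OF that]]]
    by (simp_all add: frechet_pd_expansion[OF smooth_on_differentiable[OF smooth_F gV(3)[OF that]]]
        frechet_pd_expansion[OF smooth_on_differentiable[OF W gV(2)[OF that]]])
  \<comment> \<open>The form \<open>dx + \<tau> dy\<close> evaluated on the coordinate vectors of
    \<open>\<gamma>\<close>. Since \<open>\<gamma>\<close> inverts \<open>w\<close>, multiplying by
    \<open>pd 1 W\<close> gives 1 and \<open>\<i>\<close>, so the two values differ by a quarter
    turn.\<close>
  define c where "c i y = of_real (pd i \<gamma> y $ 1) + of_real (pd i \<gamma> y $ 2) * \<tau> (\<gamma> y)" for i y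
  have cW: "pd 1 W (\<gamma> y) * c i y = toC (axis i 1)" if y: "y \<in> V" for i y
  proof -
    have "pd i (\<lambda>y. W (\<gamma> y)) y = pd i toC y"
    proof (rule pd_cong[OF UV(4) y])
      show "W (\<gamma> y) = toC y" if "y \<in> V" for y using wg[OF that] by (metis toC_ofC w_def)
    qed
    also have "\<dots> = toC (axis i 1)"
      by (simp add: pd_def frechet_derivative_eq[OF bounded_linear_imp_has_derivative[OF bounded_linear_toC]])
    also have "pd i (\<lambda>y. W (\<gamma> y)) y = pd 1 W (\<gamma> y) * c i y"
      unfolding comp[OF y] frechet_pd_expansion[OF smooth_on_differentiable[OF W gV(2)[OF y]]]
      by (simp add: sum_2 c_def bel[OF gV(2)[OF y]] scaleR_conv_of_real algebra_simps)
    finally show ?thesis .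
  qed
  have c: "c 1 y \<noteq> 0" "c 2 y = \<i> * c 1 y" if y: "y \<in> V" for y
  proof -
    show "c 1 y \<noteq> 0" using cW[OF y, of 1] by (auto simp: toC_axis)
    have "pd 1 W (\<gamma> y) * c 2 y = pd 1 W (\<gamma> y) * (\<i> * c 1 y)"
      using cW[OF y, of 1] cW[OF y, of 2] by (simp add: toC_axis mult.left_commute)
    then show "c 2 y = \<i> * c 1 y" using nz[OF gV(2)[OF y]] by simp
  qed
  have met: "lor (pd i (\<lambda>y. F (\<gamma> y)) y) (pd j (\<lambda>y. F (\<gamma> y)) y) = g (\<gamma> y) $ 1 $ 1 * Re (c i y * cnj (c j y))" if y: "y \<in> V" for i j y
    unfolding comp[OF y] lor_dF_\<tau>[OF gV(3)[OF y]] c_def ..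
  have pos: "Re (c 1 y * cnj (c 1 y)) > 0" if "y \<in> V" for y
  proof -
    have "Re (c 1 y * cnj (c 1 y)) = (cmod (c 1 y))\<^sup>2" by (simp add: complex_mult_cnj cmod_power2)
    then show ?thesis using c(1)[OF that] by simp
  qed
  show thesis
  proof (rule that[OF UV(1,3) _ UV(4) hom smooth_on_subset[OF sw UV(2)] s\<gamma>])
    show "U \<subseteq> D" using UV U1 by auto
    fix y assume y: "y \<in> V"
    show "lor (pd 1 (\<lambda>y. F (\<gamma> y)) y) (pd 1 (\<lambda>y. F (\<gamma> y)) y) > 0"
      unfolding met[OF y] using pos[OF y] g11_pos[OF gV(3)[OF y]] by simp
    show "lor (pd 1 (\<lambda>y. F (\<gamma> y)) y) (pd 1 (\<lambda>y. F (\<gamma> y)) y) = lor (pd 2 (\<lambda>y. F (\<gamma> y)) y) (pd 2 (\<lambda>y. F (\<gamma> y)) y)"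
      unfolding met[OF y] c(2)[OF y] by simp
    show "lor (pd 1 (\<lambda>y. F (\<gamma> y)) y) (pd 2 (\<lambda>y. F (\<gamma> y)) y) = 0"
      unfolding met[OF y] c(2)[OF y] by simp
  qed
qed

end

section \<open>Immersed surfaces\<close>

locale immersed_surface =
  fixes M :: "'m topology" and A :: "((real^2) set \<times> (real^2 \<Rightarrow> 'm)) set" and f \<eta> :: "'m \<Rightarrow> real^4"
  assumes surf: "surface M A" and imm: "immersed_in_hyp3 M A f" and unf: "unit_normal_field M A f \<eta>"
begin

lemma chartD:
  assumes "(D, X) \<in> A"
  shows "open D" "openin M (X ` D)" "homeomorphic_map (top_of_set D) (subtopology M (X ` D)) X"
  using surf assms unfolding surface_def smooth_atlas_def by blast+

lemma transition_smooth:
  assumes "(D, X) \<in> A" "(E, Y) \<in> A"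
  shows "smooth_on {x \<in> D. X x \<in> Y ` E} (\<lambda>x. inv_into E Y (X x))"
  using surf assms unfolding surface_def smooth_atlas_def by fast

lemma charts_cover: "p \<in> topspace M \<Longrightarrow> \<exists>D X. (D, X) \<in> A \<and> p \<in> X ` D"
  using surf unfolding surface_def smooth_atlas_def by blast

lemma chart_topspace: "(D, X) \<in> A \<Longrightarrow> x \<in> D \<Longrightarrow> X x \<in> topspace M"
  using chartD(2) openin_subset by blast

lemma chart_continuous: "(D, X) \<in> A \<Longrightarrow> continuous_map (top_of_set D) M X"
  using chartD(3) homeomorphic_imp_continuous_map continuous_map_into_fulltopology by blast

lemma chart_inj: "(D, X) \<in> A \<Longrightarrow> inj_on X D"
  using homeomorphic_imp_injective_map[OF chartD(3)] by simp

lemma chart_vimage_open: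
  assumes "(D, X) \<in> A" "openin M S"
  shows "open {x \<in> D. X x \<in> S}"
  using openin_continuous_map_preimage[OF chart_continuous[OF assms(1)] assms(2)] chartD(1)[OF assms(1)]
  by (simp add: openin_open_eq)

lemma chart_image_open:
  assumes c: "(D, X) \<in> A" and T: "open T" "T \<subseteq> D"
  shows "openin M (X ` T)"
proof -
  have "openin (top_of_set D) T" using T chartD(1)[OF c] by (simp add: openin_open_eq)
  then have "openin (subtopology M (X ` D)) (X ` T)"
    using homeomorphic_imp_open_map[OF chartD(3)[OF c]] unfolding open_map_def by blast
  then show ?thesis using chartD(2)[OF c] openin_trans_full by blast
qed

lemma normal_orthogonal:
  assumes p: "p \<in> topspace M"
  shows "lor (\<eta> p) (f p) = 0"
proof -
  have "\<eta> p \<in> tangent_space hyp3 (f p)" using unf p unfolding unit_normal_field_def by blast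
  then obtain c where c: "c 0 = f p" "\<And>t. c t \<in> hyp3" "(c has_vector_derivative \<eta> p) (at 0)"
    by (rule tangent_spaceE) blast
  have "((\<lambda>t. lor (c t) (c t)) has_vector_derivative lor (c 0) (\<eta> p) + lor (\<eta> p) (c 0)) (at 0)"
    by (rule bounded_bilinear.has_vector_derivative[OF bounded_bilinear_lor c(3) c(3)])
  moreover have "((\<lambda>t. lor (c t) (c t)) has_vector_derivative 0) (at 0)"
    using hyp3_first(3)[OF c(2)] by simp
  ultimately have "lor (c 0) (\<eta> p) + lor (\<eta> p) (c 0) = 0" by (rule vector_derivative_unique_at)
  then show ?thesis using c(1) lor_commute[of "f p" "\<eta> p"] by simp
qed

lemma f_hyp3: "p \<in> topspace M \<Longrightarrow> f p \<in> hyp3"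
  using imm unfolding immersed_in_hyp3_def by blast

lemma chart_patch:
  assumes c: "(D, X) \<in> A"
  shows "surface_patch D (f \<circ> X) (\<eta> \<circ> X)"
proof
  show "open D" by (rule chartD(1)[OF c])
  show "smooth_on D (f \<circ> X)" using imm c unfolding immersed_in_hyp3_def by blast
  show "smooth_on D (\<eta> \<circ> X)" using unf c unfolding unit_normal_field_def by blast
  fix x assume x: "x \<in> D"
  note p = chart_topspace[OF c x]
  show "(f \<circ> X) x \<in> hyp3" using f_hyp3[OF p] by simp
  show "lor ((\<eta> \<circ> X) x) ((f \<circ> X) x) = 0" using normal_orthogonal[OF p] by simp
  show "lor ((\<eta> \<circ> X) x) ((\<eta> \<circ> X) x) = 1" using unf p unfolding unit_normal_field_def by simp
  have "\<forall>v. lor (\<eta> (X x)) (frechet_derivative (f \<circ> X) (at x) v) = 0"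
    using unf c x unfolding unit_normal_field_def by fast
  then show "lor ((\<eta> \<circ> X) x) (pd i (f \<circ> X) x) = 0" for i by (simp add: pd_def)
  show "inj (frechet_derivative (f \<circ> X) (at x))" using imm c x unfolding immersed_in_hyp3_def by fast
qed

lemma gauss_map_eq_wedge: "p \<in> topspace M \<Longrightarrow> gauss_map f \<eta> p = wedge (f p) (\<eta> p)"
  unfolding gauss_map_def
  by (rule Gam_eq_wedge[OF f_hyp3]) (simp_all add: lor_commute[of "f p"] normal_orthogonal)

lemma gauss_map_S5:
  assumes p: "p \<in> topspace M"
  shows "gauss_map f \<eta> p \<in> S5"
proof -
  have "lor (\<eta> p) (\<eta> p) = 1" using unf p unfolding unit_normal_field_def by simp
  then have "lor (wedge (f p) (\<eta> p) *v f p) (\<eta> p) = 1"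
    using normal_orthogonal[OF p] hyp3_first(3)[OF f_hyp3[OF p]] by (simp add: wedge_mult lor_simps)
  then show ?thesis
    by (simp add: gauss_map_eq_wedge[OF p] S5_iff wedge_skew skew_lie_ip_wedge[OF wedge_skew])
qed

abbreviation "H X \<equiv> mean_curvature (f \<circ> X) (\<eta> \<circ> X)"

text \<open>The common middle term of the equivalences: a local condition, so that connectedness
  enters only in the comparison with constancy of \<open>H\<close>.\<close>

definition stationary :: bool where
  "stationary \<longleftrightarrow> (\<forall>(D, X)\<in>A. \<forall>x\<in>D. \<forall>l. pd l (H X) x = 0)"

lemma stationaryD: "stationary \<Longrightarrow> (D, X) \<in> A \<Longrightarrow> x \<in> D \<Longrightarrow> pd l (H X) x = 0"
  unfolding stationary_def by blast

text \<open>Both conditions are linked at each point by \<open>tension_eq_0_iff\<close> and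
  \<open>trace_N_tangential_iff\<close>. Since \<open>harmonic_into_S5\<close> only speaks about
  given coordinate expressions, using it as a hypothesis requires a chart of the pseudo-sphere
  around the image point.\<close>

lemma harmonic_iff_stationary: "harmonic_into_S5 M A f (gauss_map f \<eta>) \<longleftrightarrow> stationary"
proof
  assume h: "harmonic_into_S5 M A f (gauss_map f \<eta>)"
  show stationary
    unfolding stationary_def
  proof safe
    fix D X x l assume c: "(D, X) \<in> A" and x: "x \<in> D"
    interpret p: surface_patch D "f \<circ> X" "\<eta> \<circ> X" by (rule chart_patch[OF c])
    have N: "gauss_map f \<eta> (X y) = p.N y" if "y \<in> D" for y
      using gauss_map_eq_wedge[OF chart_topspace[OF c that]] by simp
    have NS: "p.N y \<in> S5" if "y \<in> D" for y
      using gauss_map_S5[OF chart_topspace[OF c that]] N[OF that] by simp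
    obtain W \<psi> V u where s: "S5_parametrization W \<psi>" "open V" "x \<in> V" "V \<subseteq> D" "smooth_on V u" "u ` V \<subseteq> W"
      "\<And>y. y \<in> V \<Longrightarrow> p.N y = \<psi> (u y)"
      using S5_parametrization_exists[OF chartD(1)[OF c] x p.smooth_N NS] by blast
    have "\<forall>y\<in>V. gauss_map f \<eta> (X y) = \<psi> (u y)" using s(4,7) N by auto
    then have pre: "S5_parametrization W \<psi> \<and> open V \<and> V \<subseteq> D \<and> smooth_on V u \<and> u ` V \<subseteq> W \<and>
        (\<forall>y\<in>V. gauss_map f \<eta> (X y) = \<psi> (u y))"
      using s by simp
    have "\<forall>W \<psi> V u. S5_parametrization W \<psi> \<and> open V \<and> V \<subseteq> D \<and> smooth_on V u \<and> u ` V \<subseteq> W \<and>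
        (\<forall>y\<in>V. gauss_map f \<eta> (X y) = \<psi> (u y)) \<longrightarrow>
        (\<forall>x\<in>V. tension (induced_metric lor (f \<circ> X)) (induced_metric lie_ip \<psi>) u x = 0)"
      using bspec[OF conjunct2[OF h[unfolded harmonic_into_S5_def]] c] by (simp only: prod.case)
    from this[rule_format, OF pre s(3)]
    have "tension (induced_metric lor (f \<circ> X)) (induced_metric lie_ip \<psi>) u x = 0" .
    then show "pd l (H X) x = 0"
      using tension_eq_0_iff[OF s(1,2,3,5,6,7)] p.trace_N_tangential_iff[OF x] by blast
  qed
next
  assume st: stationary
  show "harmonic_into_S5 M A f (gauss_map f \<eta>)"
    unfolding harmonic_into_S5_def
  proof safe
    show "gauss_map f \<eta> p \<in> S5" if "p \<in> topspace M" for p by (rule gauss_map_S5[OF that])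
    fix D X W \<psi> V and u :: "real^2 \<Rightarrow> real^5" and x
    assume c: "(D, X) \<in> A" and s: "S5_parametrization W \<psi>" "open V" "V \<subseteq> D" "smooth_on V u" "u ` V \<subseteq> W"
      "\<forall>x\<in>V. gauss_map f \<eta> (X x) = \<psi> (u x)" and x: "x \<in> V"
    interpret p: surface_patch D "f \<circ> X" "\<eta> \<circ> X" by (rule chart_patch[OF c])
    have xD: "x \<in> D" using x s(3) by auto
    have N: "p.N y = \<psi> (u y)" if "y \<in> V" for y
      using gauss_map_eq_wedge[OF chart_topspace[OF c, of y]] that s(3,6) by auto
    show "tension (induced_metric lor (f \<circ> X)) (induced_metric lie_ip \<psi>) u x = 0"
      using tension_eq_0_iff[OF s(1,2) x s(4,5) N] p.trace_N_tangential_iff[OF xD] stationaryD[OF st c xD] by blast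
  qed
qed

lemma mean_curvature_overlap:
  assumes c: "(D, X) \<in> A" "(E, Y) \<in> A" and xy: "x \<in> D" "y \<in> E" "X x = Y y"
  shows "H X x = H Y y"
proof -
  let ?T = "{x \<in> D. X x \<in> Y ` E}" and ?\<theta> = "\<lambda>x. inv_into E Y (X x)"
  have T: "open ?T" by (rule chart_vimage_open[OF c(1) chartD(2)[OF c(2)]])
  have xT: "x \<in> ?T" using xy by auto
  have \<theta>: "?\<theta> x = y" using xy chart_inj[OF c(2)] by simp
  have Y\<theta>: "Y (?\<theta> z) = X z" "?\<theta> z \<in> E" if "z \<in> ?T" for z
    using that by (auto intro: f_inv_into_f inv_into_into)
  have "H X x = H Y (?\<theta> x)"
    by (rule mean_curvature_compose[OF chart_patch[OF c(2)] chart_patch[OF c(1)] T xT _ _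
          smooth_on_differentiable[OF transition_smooth[OF c] xT]])
       (auto simp: Y\<theta> intro: inv_into_into)
  then show ?thesis by (simp add: \<theta>)
qed

text \<open>Vanishing derivatives make \<open>H\<close> constant on coordinate balls, and
  connectedness of the surface makes the local constants agree.\<close>

lemma constant_mean_curvature_iff_stationary: "constant_mean_curvature A f \<eta> \<longleftrightarrow> stationary"
proof
  assume "constant_mean_curvature A f \<eta>"
  then obtain k where k: "\<And>D X x. (D, X) \<in> A \<Longrightarrow> x \<in> D \<Longrightarrow> H X x = k"
    unfolding constant_mean_curvature_def by blast
  show stationary
    unfolding stationary_def
  proof safe
    fix D X x l assume c: "(D, X) \<in> A" and x: "x \<in> D"
    have "pd l (H X) x = pd l (\<lambda>_. k) x" by (rule pd_cong[OF chartD(1)[OF c] x k[OF c]])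
    then show "pd l (H X) x = 0" by (simp add: pd_const)
  qed
next
  assume st: stationary
  \<comment> \<open>The mean curvature as a function on the surface itself: some chart through the
    point is chosen, and \<open>mean_curvature_overlap\<close> shows that the choice does not
    matter.\<close>
  define hM where "hM p = (SOME k. \<exists>D X x. (D, X) \<in> A \<and> x \<in> D \<and> X x = p \<and> k = H X x)" for p
  have hM: "hM (X x) = H X x" if c: "(D, X) \<in> A" "x \<in> D" for D X x
  proof -
    have "\<exists>k. \<exists>D' X' x'. (D', X') \<in> A \<and> x' \<in> D' \<and> X' x' = X x \<and> k = H X' x'" using c by blast
    then have "\<exists>D' X' x'. (D', X') \<in> A \<and> x' \<in> D' \<and> X' x' = X x \<and> hM (X x) = H X' x'"
      unfolding hM_def by (rule someI_ex)
    then obtain D' X' x' where c': "(D', X') \<in> A" "x' \<in> D'" "X' x' = X x" "hM (X x) = H X' x'" by blast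
    show ?thesis using mean_curvature_overlap[OF c'(1) c(1) c'(2) c(2) c'(3)] c'(4) by simp
  qed
  have loc: "\<exists>S. openin M S \<and> p \<in> S \<and> (\<forall>q\<in>S. hM q = hM p)" if p: "p \<in> topspace M" for p
  proof -
    obtain D X x where c: "(D, X) \<in> A" and x: "x \<in> D" and px: "p = X x" using charts_cover[OF p] by blast
    interpret s: surface_patch D "f \<circ> X" "\<eta> \<circ> X" by (rule chart_patch[OF c])
    obtain e where e: "e > 0" "ball x e \<subseteq> D" using s.open_D x openE by blast
    have "(H X has_derivative (\<lambda>h. 0)) (at y within ball x e)" if y: "y \<in> ball x e" for y
    proof -
      have yD: "y \<in> D" using e y by auto
      have "frechet_derivative (H X) (at y) = (\<lambda>h. 0)"
        using frechet_pd_expansion[OF smooth_on_differentiable[OF s.smooth_H yD]] stationaryD[OF st c yD]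
        by (simp add: fun_eq_iff)
      then show ?thesis
        using has_derivative_at_withinI[OF smooth_on_has_derivative[OF s.smooth_H yD]] by simp
    qed
    from has_derivative_zero_constant[OF convex_ball this]
    obtain k where k: "\<And>y. y \<in> ball x e \<Longrightarrow> H X y = k" by blast
    have "hM q = hM p" if q: "q \<in> X ` ball x e" for q
    proof -
      obtain y where y: "y \<in> ball x e" "q = X y" using q by blast
      have "H X y = H X x" using k[OF y(1)] k[of x] e by simp
      then show ?thesis using hM[OF c] e y x px by auto
    qed
    moreover have "p \<in> X ` ball x e" using px e(1) by simp
    ultimately show ?thesis using chart_image_open[OF c open_ball e(2)] by blast
  qed
  have "\<exists>k. \<forall>p\<in>topspace M. hM p = k"
  proof (cases "topspace M = {}")
    case False
    then obtain p0 where p0: "p0 \<in> topspace M" by blast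
    let ?S = "{p \<in> topspace M. hM p = hM p0}"
    \<comment> \<open>By local constancy every set described by the value of \<open>hM\<close> is
      open; a level set and its complement are both of this kind, hence clopen.\<close>
    have o: "openin M {p \<in> topspace M. P (hM p)}" for P
    proof (subst openin_subopen, intro ballI)
      fix p assume p: "p \<in> {p \<in> topspace M. P (hM p)}"
      then obtain S where S: "openin M S" "p \<in> S" "\<forall>q\<in>S. hM q = hM p" using loc by blast
      have "S \<subseteq> {p \<in> topspace M. P (hM p)}"
      proof
        fix q assume q: "q \<in> S"
        have "hM q = hM p" using S(3) q by blast
        moreover have "q \<in> topspace M" using openin_subset[OF S(1)] q by blast
        ultimately show "q \<in> {p \<in> topspace M. P (hM p)}" using p by simp
      qed
      then show "\<exists>T. openin M T \<and> p \<in> T \<and> T \<subseteq> {p \<in> topspace M. P (hM p)}"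
        using S(1,2) by blast
    qed
    have "closedin M ?S"
      unfolding closedin_def
    proof
      have "topspace M - ?S = {p \<in> topspace M. hM p \<noteq> hM p0}" by auto
      then show "openin M (topspace M - ?S)" using o[of "\<lambda>k. k \<noteq> hM p0"] by simp
    qed auto
    moreover have "openin M ?S" using o[of "\<lambda>k. k = hM p0"] by simp
    moreover have "connected_space M" using surf by (simp add: surface_def)
    ultimately have "?S = {} \<or> ?S = topspace M" unfolding connected_space_clopen_in by blast
    then have "?S = topspace M" using p0 by blast
    then show ?thesis by blast
  qed auto
  then obtain k where k: "\<forall>p\<in>topspace M. hM p = k" ..
  have "H X x = k" if cx: "(D, X) \<in> A" "x \<in> D" for D X x
    using hM[OF cx] bspec[OF k chart_topspace[OF cx]] by simp
  then show "constant_mean_curvature A f \<eta>"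
    unfolding constant_mean_curvature_def by (intro exI[of _ k] ballI) (clarsimp simp del: o_apply)
qed

section \<open>The quadratic form in conformal parametrizations\<close>

lemma conformalD:
  assumes "conformal_parametrization M A f U G"
  shows "open U" "continuous_map (top_of_set U) M G" "inj_on G U"
    "(D, X) \<in> A \<Longrightarrow> smooth_on {z \<in> U. G z \<in> X ` D} (\<lambda>z. inv_into D X (G z))"
    "z \<in> U \<Longrightarrow> lor (frechet_derivative (f \<circ> G) (at z) 1) (frechet_derivative (f \<circ> G) (at z) 1) > 0"
    "z \<in> U \<Longrightarrow> lor (frechet_derivative (f \<circ> G) (at z) 1) (frechet_derivative (f \<circ> G) (at z) 1) =
       lor (frechet_derivative (f \<circ> G) (at z) \<i>) (frechet_derivative (f \<circ> G) (at z) \<i>)"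
    "z \<in> U \<Longrightarrow> lor (frechet_derivative (f \<circ> G) (at z) 1) (frechet_derivative (f \<circ> G) (at z) \<i>) = 0"
proof -
  note * = assms[unfolded conformal_parametrization_def Let_def]
  show "open U" "continuous_map (top_of_set U) M G" "inj_on G U" using * by blast+
  show "smooth_on {z \<in> U. G z \<in> X ` D} (\<lambda>z. inv_into D X (G z))" if "(D, X) \<in> A" using * that by fast
  assume z: "z \<in> U"
  show "lor (frechet_derivative (f \<circ> G) (at z) 1) (frechet_derivative (f \<circ> G) (at z) 1) > 0"
    "lor (frechet_derivative (f \<circ> G) (at z) 1) (frechet_derivative (f \<circ> G) (at z) 1) =
       lor (frechet_derivative (f \<circ> G) (at z) \<i>) (frechet_derivative (f \<circ> G) (at z) \<i>)"
    "lor (frechet_derivative (f \<circ> G) (at z) 1) (frechet_derivative (f \<circ> G) (at z) \<i>) = 0"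
    using * z by blast+
qed

text \<open>The coefficient is \<open>Q / 4 - \<i> * R / 2\<close> with the two functions of
  \<open>conformal_Codazzi\<close>. Its Cauchy-Riemann equations are the Codazzi equations without
  the gradient terms; as the conformal factor is positive, they hold at a point exactly when the
  gradient of \<open>H\<close> vanishes there.\<close>

lemma quadratic_coeff_differentiable_iff:
  assumes G: "conformal_parametrization M A f U G" and c: "(D, X) \<in> A"
    and x: "toC x \<in> U" "G (toC x) \<in> X ` D"
  shows "quadratic_coeff f (gauss_map f \<eta>) G field_differentiable (at (toC x)) \<longleftrightarrow>
    (\<forall>l. pd l (\<lambda>v. H X (inv_into D X (G (toC v)))) x = 0)"
proof -
  note C = conformalD[OF G]
  interpret p: surface_patch D "f \<circ> X" "\<eta> \<circ> X" by (rule chart_patch[OF c])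
  define U' where "U' = {z \<in> U. G z \<in> X ` D}"
  define T where "T = toC -` U'"
  define \<phi> where "\<phi> z = inv_into D X (G z)" for z
  define \<theta> where "\<theta> v = \<phi> (toC v)" for v
  define F n where "F = (\<lambda>v. f (G (toC v)))" and "n = (\<lambda>v. \<eta> (G (toC v)))"
  have U': "open U'"
    using openin_continuous_map_preimage[OF C(2) chartD(2)[OF c]] C(1) by (simp add: U'_def openin_open_eq)
  have T: "open T" unfolding T_def by (rule open_toC_vimage[OF U'])
  have xT: "x \<in> T" using x by (simp add: T_def U'_def)
  have X\<phi>: "X (\<phi> z) = G z" "\<phi> z \<in> D" if "z \<in> U'" for z
    using that by (auto simp: U'_def \<phi>_def intro: f_inv_into_f inv_into_into)
  have s\<phi>: "smooth_on U' \<phi>" using C(4)[OF c] by (simp add: U'_def \<phi>_def[abs_def])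
  have \<phi>U: "\<phi> ` U' \<subseteq> D" using X\<phi> by auto
  have sgen: "smooth_on U' (k \<circ> G)" if "smooth_on D (k \<circ> X)" for k :: "'m \<Rightarrow> 'b::euclidean_space"
  proof (rule smooth_on_cong[OF U'])
    show "smooth_on U' (\<lambda>z. (k \<circ> X) (\<phi> z))" by (rule smooth_on_compose[OF U' p.open_D \<phi>U that s\<phi>])
  qed (simp add: X\<phi>)
  have stoC: "smooth_on T (\<lambda>v. k (toC v))" if "smooth_on U' k" for k :: "complex \<Rightarrow> 'b::euclidean_space"
    by (rule smooth_on_compose[OF T U' _ that smooth_on_bounded_linear[OF T bounded_linear_toC]]) (auto simp: T_def)
  have sfG: "smooth_on U' (f \<circ> G)" by (rule sgen[OF p.smooth_F])
  have sF: "smooth_on T F" using stoC[OF sfG] by (simp add: F_def)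
  have sn: "smooth_on T n" using stoC[OF sgen[OF p.smooth_n]] by (simp add: n_def)
  have s\<theta>: "smooth_on T \<theta>" using stoC[OF s\<phi>] by (simp add: \<theta>_def[abs_def])
  have \<theta>T: "\<theta> ` T \<subseteq> D" using \<phi>U by (auto simp: \<theta>_def T_def)
  have F\<theta>: "F y = (f \<circ> X) (\<theta> y)" "n y = (\<eta> \<circ> X) (\<theta> y)" if "y \<in> T" for y
    using that X\<phi> by (auto simp: F_def n_def \<theta>_def T_def)
  have pdF: "pd 1 F y = frechet_derivative (f \<circ> G) (at (toC y)) 1" "pd 2 F y = frechet_derivative (f \<circ> G) (at (toC y)) \<i>"
    if "y \<in> T" for y
    using pd_toC[OF smooth_on_differentiable[OF sfG, of "toC y"]] that by (simp_all add: F_def T_def)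
  have yU: "toC y \<in> U" if "y \<in> T" for y using that by (simp add: T_def U'_def)
  have conf: "lor (pd 1 F y) (pd 1 F y) > 0" "lor (pd 1 F y) (pd 1 F y) = lor (pd 2 F y) (pd 2 F y)" "lor (pd 1 F y) (pd 2 F y) = 0"
    if "y \<in> T" for y
    using C(5,6,7)[OF yU[OF that]] by (simp_all add: pdF[OF that])
  have Dy: "\<theta> y \<in> D" if "y \<in> T" for y using \<theta>T that by auto
  \<comment> \<open>The conformal parametrization in real coordinates is again a surface patch; its
    derivative is injective because the two columns are orthogonal and of positive length.\<close>
  have patch: "surface_patch T F n"
  proof
    show "open T" "smooth_on T F" "smooth_on T n" by (rule T sF sn)+
    fix y assume y: "y \<in> T"
    show "F y \<in> hyp3" "lor (n y) (F y) = 0" "lor (n y) (n y) = 1"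
      unfolding F\<theta>[OF y] by (rule p.hyp[OF Dy[OF y]] p.nF[OF Dy[OF y]] p.nn[OF Dy[OF y]])+
    show "lor (n y) (pd i F y) = 0" for i
    proof -
      have "pd i F y = pd i (\<lambda>y. (f \<circ> X) (\<theta> y)) y" by (rule pd_cong[OF T y F\<theta>(1)])
      also have "\<dots> = (\<Sum>a\<in>UNIV. pd i \<theta> y $ a *\<^sub>R pd a (f \<circ> X) (\<theta> y))"
        by (rule pd_compose[OF smooth_on_differentiable[OF s\<theta> y] smooth_on_differentiable[OF p.smooth_F Dy[OF y]]])
      finally show ?thesis
        unfolding F\<theta>(2)[OF y] using p.ndF[OF Dy[OF y]] by (simp add: lor_sum_right lor_simps)
    qed
    note d = smooth_on_differentiable[OF sF y]
    show "inj (frechet_derivative F (at y))"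
    proof (subst linear_injective_0[OF linear_frechet_derivative[OF d]], intro allI impI)
      fix v assume "frechet_derivative F (at y) v = 0"
      then have v: "v $ 1 *\<^sub>R pd 1 F y + v $ 2 *\<^sub>R pd 2 F y = 0"
        unfolding frechet_pd_expansion[OF d] by (simp add: sum_2)
      have "v $ 1 * lor (pd 1 F y) (pd 1 F y) = 0" "v $ 2 * lor (pd 2 F y) (pd 2 F y) = 0"
        using arg_cong[OF v, of "\<lambda>w. lor w (pd 1 F y)"] arg_cong[OF v, of "\<lambda>w. lor w (pd 2 F y)"]
          conf(3)[OF y] lor_commute[of "pd 2 F y" "pd 1 F y"] by (simp_all add: lor_simps)
      then show "v = 0" using conf(1,2)[OF y] by (simp add: vec_eq_iff forall_2)
    qed
  qed
  interpret q: surface_patch T F n by (rule patch)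
  define Q where "Q = (\<lambda>y. lor (pd 1 n y) (pd 1 F y) - lor (pd 2 n y) (pd 2 F y))"
  define R where "R = (\<lambda>y. lor (pd 1 n y) (pd 2 F y))"
  have N: "gauss_map f \<eta> (G (toC y)) = q.N y" if "y \<in> T" for y
  proof -
    have "G (toC y) \<in> topspace M"
      using C(2) yU[OF that] unfolding continuous_map_def by auto
    then show ?thesis by (simp add: gauss_map_eq_wedge F_def n_def)
  qed
  have coeff: "quadratic_coeff f (gauss_map f \<eta>) G (toC y) = Complex (Q y / 4) (- R y / 2)" if y: "y \<in> T" for y
  proof -
    have "smooth_on U' (gauss_map f \<eta> \<circ> G)"
    proof (rule sgen)
      show "smooth_on D (gauss_map f \<eta> \<circ> X)"
        by (rule smooth_on_cong[OF p.open_D _ p.smooth_N]) (simp add: gauss_map_eq_wedge chart_topspace[OF c])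
    qed
    then have dN: "(gauss_map f \<eta> \<circ> G) differentiable (at (toC y))"
      by (rule smooth_on_differentiable) (use y in \<open>simp add: T_def\<close>)
    have pN: "pd i (\<lambda>v. gauss_map f \<eta> (G (toC v))) y = pd i q.N y" for i
      by (rule pd_cong[OF T y]) (simp add: N)
    have wN: "wirtinger (gauss_map f \<eta> \<circ> G) (toC y) = ((1/2) *\<^sub>R pd 1 q.N y, - (1/2) *\<^sub>R pd 2 q.N y)"
      using pd_toC[OF dN] by (simp add: wirtinger_def pN o_def)
    have wF: "wirtinger (f \<circ> G) (toC y) = ((1/2) *\<^sub>R pd 1 F y, - (1/2) *\<^sub>R pd 2 F y)"
      by (simp add: wirtinger_def pdF[OF y])
    have gam: "Gam (f (G (toC y))) (k *\<^sub>R pd i F y) = wedge (F y) (k *\<^sub>R pd i F y)" for k i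
      using Gam_eq_wedge[OF q.hyp[OF y], of "k *\<^sub>R pd i F y"] q.FFi[OF y] by (simp add: F_def lor_simps)
    have sk: "pd i q.N y \<in> skew" for i
      unfolding q.pd_N[OF y] by (rule subspace_add[OF subspace_skew wedge_skew wedge_skew])
    \<comment> \<open>Of the two summands of the derivative, \<open>wedge (F y) (pd i n y)\<close>
      sends \<open>F y\<close> to \<open>pd i n y\<close> and the other annihilates it. Pairing with
      \<open>wedge (F y) (pd j F y)\<close> therefore gives the second fundamental form up to
      sign.\<close>
    have NF: "pd i q.N y *v F y = pd i n y" for i
      unfolding q.pd_N[OF y]
      by (simp add: matvec_simps wedge_mult q.commuted_products[OF y] q.FF[OF y] q.nF[OF y] q.FFi[OF y] q.nn[OF y])
    have ip: "lie_ip (a *\<^sub>R pd i q.N y) (wedge (F y) (k *\<^sub>R pd j F y)) = a * k * lor (pd i n y) (pd j F y)" for a k i j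
      by (simp add: lie_ip_simps skew_lie_ip_wedge[OF sk] NF lor_simps)
    show ?thesis
      unfolding quadratic_coeff_def wN wF complex_linear_def complex_bilinear_def fst_conv snd_conv gam ip Q_def R_def
      using q.b_sym[OF y, of 2 1] by (simp add: complex_eq_iff field_simps)
  qed
  have sQ: "smooth_on T Q" and sR: "smooth_on T R"
    unfolding Q_def R_def by (intro smooth_on_diff smooth_on_lor T q.pdn q.pdF)+
  note dQ = smooth_on_differentiable[OF sQ xT] and dR = smooth_on_differentiable[OF sR xT]
  have pu: "pd i (\<lambda>y. Q y / 4) x = pd i Q x / 4" for i
    by (rule pd_linear[OF bounded_linear_divide dQ])
  have pv: "pd i (\<lambda>y. - R y / 2) x = - pd i R x / 2" for i
    by (rule pd_linear[OF _ dR, of "\<lambda>r. - r / 2"])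
       (intro bounded_linear_compose[OF bounded_linear_divide] bounded_linear_minus bounded_linear_ident)
  have g: "q.g y $ 1 $ 1 = q.g y $ 2 $ 2" "q.g y $ 1 $ 2 = 0" if "y \<in> T" for y
    using conf[OF that] by (simp_all add: q.g_nth)
  note cod = q.conformal_Codazzi[OF g xT, folded Q_def R_def]
  have E: "q.g x $ 1 $ 1 > 0" using conf(1)[OF xT] by (simp add: q.g_nth)
  have "quadratic_coeff f (gauss_map f \<eta>) G field_differentiable (at (toC x)) \<longleftrightarrow>
      pd 1 Q x / 4 = - pd 2 R x / 2 \<and> pd 2 Q x / 4 = pd 1 R x / 2"
  proof -
    have d: "(\<lambda>y. Q y / 4) differentiable (at x)" "(\<lambda>y. - R y / 2) differentiable (at x)"
      by (rule derivative_intros dQ dR; simp?)+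
    have "quadratic_coeff f (gauss_map f \<eta>) G field_differentiable (at (toC x)) \<longleftrightarrow>
        pd 1 (\<lambda>y. Q y / 4) x = pd 2 (\<lambda>y. - R y / 2) x \<and> pd 2 (\<lambda>y. Q y / 4) x = - pd 1 (\<lambda>y. - R y / 2) x"
      by (rule field_differentiable_iff_Cauchy_Riemann[OF T xT _ d]) (rule coeff)
    then show ?thesis unfolding pu pv by simp
  qed
  also have "\<dots> \<longleftrightarrow> q.g x $ 1 $ 1 * pd 1 q.H x = 0 \<and> q.g x $ 1 $ 1 * pd 2 q.H x = 0"
    using cod by auto
  also have "\<dots> \<longleftrightarrow> (\<forall>l. pd l q.H x = 0)" using E by (simp add: forall_2)
  also have "\<dots> \<longleftrightarrow> (\<forall>l. pd l (\<lambda>v. H X (\<theta> v)) x = 0)"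
  proof -
    have "q.H y = H X (\<theta> y)" if "y \<in> T" for y
      by (rule mean_curvature_compose[OF p.surface_patch_axioms patch T that subset_refl \<theta>T
            smooth_on_differentiable[OF s\<theta> that] F\<theta>])
    then have "pd l q.H x = pd l (\<lambda>v. H X (\<theta> v)) x" for l by (rule pd_cong[OF T xT])
    then show ?thesis by simp
  qed
  finally show ?thesis by (simp add: \<theta>_def \<phi>_def)
qed

lemma isothermal_parametrization:
  assumes c: "(D, X) \<in> A" and x0: "x0 \<in> D"
  obtains U V and \<gamma> :: "real^2 \<Rightarrow> real^2" and w where "open U" "x0 \<in> U" "U \<subseteq> D" "open V" "homeomorphism U V w \<gamma>" "smooth_on U w"
    "conformal_parametrization M A f (ofC -` V) (\<lambda>z. X (\<gamma> (ofC z)))"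
proof -
  interpret p: surface_patch D "f \<circ> X" "\<eta> \<circ> X" by (rule chart_patch[OF c])
  obtain U V and \<gamma> :: "real^2 \<Rightarrow> real^2" and w where U: "open U" "x0 \<in> U" "U \<subseteq> D" and V: "open V" and hom: "homeomorphism U V w \<gamma>"
    and sw: "smooth_on U w" and s\<gamma>: "smooth_on V \<gamma>"
    and conf: "\<And>y. y \<in> V \<Longrightarrow> lor (pd 1 (\<lambda>y. (f \<circ> X) (\<gamma> y)) y) (pd 1 (\<lambda>y. (f \<circ> X) (\<gamma> y)) y) > 0"
      "\<And>y. y \<in> V \<Longrightarrow> lor (pd 1 (\<lambda>y. (f \<circ> X) (\<gamma> y)) y) (pd 1 (\<lambda>y. (f \<circ> X) (\<gamma> y)) y)
         = lor (pd 2 (\<lambda>y. (f \<circ> X) (\<gamma> y)) y) (pd 2 (\<lambda>y. (f \<circ> X) (\<gamma> y)) y)"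
      "\<And>y. y \<in> V \<Longrightarrow> lor (pd 1 (\<lambda>y. (f \<circ> X) (\<gamma> y)) y) (pd 2 (\<lambda>y. (f \<circ> X) (\<gamma> y)) y) = 0"
    by (rule p.isothermal_coordinates[OF x0]) (rule that; assumption)
  define UC where "UC = ofC -` V"
  define G where "G z = X (\<gamma> (ofC z))" for z
  have UC: "open UC" unfolding UC_def by (rule open_ofC_vimage[OF V])
  have \<gamma>D: "\<gamma> y \<in> D" if "y \<in> V" for y using hom U(3) that by (auto simp: homeomorphism_def)
  have s: "smooth_on UC (\<lambda>z. \<gamma> (ofC z))"
    by (rule smooth_on_compose[OF UC V _ s\<gamma> smooth_on_bounded_linear[OF UC bounded_linear_ofC]]) (auto simp: UC_def)
  have sub: "(\<lambda>z. \<gamma> (ofC z)) ` UC \<subseteq> D" using \<gamma>D by (auto simp: UC_def)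
  have "conformal_parametrization M A f UC G"
    unfolding conformal_parametrization_def Let_def
  proof (intro conjI UC)
    have "continuous_map (top_of_set UC) (top_of_set D) (\<lambda>z. \<gamma> (ofC z))"
      using smooth_on_continuous_on[OF s] sub by (simp add: image_subset_iff_funcset)
    from continuous_map_compose[OF this chart_continuous[OF c]]
    show "continuous_map (top_of_set UC) M G" by (simp add: o_def G_def[abs_def])
    show "inj_on G UC"
    proof (rule inj_onI)
      fix z z' assume z: "z \<in> UC" "z' \<in> UC" "G z = G z'"
      then have "\<gamma> (ofC z) = \<gamma> (ofC z')"
        using inj_onD[OF chart_inj[OF c]] \<gamma>D by (auto simp: G_def UC_def)
      then have "w (\<gamma> (ofC z)) = w (\<gamma> (ofC z'))" by simp
      then have "ofC z = ofC z'" using hom z by (simp add: homeomorphism_def UC_def)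
      then show "z = z'" by (metis toC_ofC)
    qed
    show "\<forall>(E, Y)\<in>A. smooth_on {z \<in> UC. G z \<in> Y ` E} (\<lambda>z. inv_into E Y (G z))"
    proof (intro ballI, clarify)
      fix E Y assume cY: "(E, Y) \<in> A"
      let ?T = "{x \<in> D. X x \<in> Y ` E}" and ?S = "{z \<in> UC. G z \<in> Y ` E}"
      have T: "open ?T" by (rule chart_vimage_open[OF c chartD(2)[OF cY]])
      have "?S = UC \<inter> (\<lambda>z. \<gamma> (ofC z)) -` ?T" using sub by (auto simp: G_def)
      then have S: "open ?S" using continuous_open_preimage[OF smooth_on_continuous_on[OF s] UC T] by simp
      have "smooth_on ?S (\<lambda>z. (\<lambda>x. inv_into E Y (X x)) (\<gamma> (ofC z)))"
        by (rule smooth_on_compose[OF S T _ transition_smooth[OF c cY] smooth_on_subset[OF s]])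
           (use sub in \<open>auto simp: G_def\<close>)
      then show "smooth_on ?S (\<lambda>z. inv_into E Y (G z))" by (simp add: G_def)
    qed
    show "\<forall>z\<in>UC. 0 < lor (frechet_derivative (f \<circ> G) (at z) 1) (frechet_derivative (f \<circ> G) (at z) 1) \<and>
      lor (frechet_derivative (f \<circ> G) (at z) 1) (frechet_derivative (f \<circ> G) (at z) 1) =
        lor (frechet_derivative (f \<circ> G) (at z) \<i>) (frechet_derivative (f \<circ> G) (at z) \<i>) \<and>
      lor (frechet_derivative (f \<circ> G) (at z) 1) (frechet_derivative (f \<circ> G) (at z) \<i>) = 0"
    proof
      fix z assume z: "z \<in> UC"
      have "smooth_on UC (\<lambda>z. (f \<circ> X) (\<gamma> (ofC z)))"
        by (rule smooth_on_compose[OF UC p.open_D sub p.smooth_F s])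
      then have "smooth_on UC (f \<circ> G)" by (simp add: o_def G_def)
      then have "(f \<circ> G) differentiable (at (toC (ofC z)))" using smooth_on_differentiable z by simp
      from pd_toC[OF this]
      have "frechet_derivative (f \<circ> G) (at z) 1 = pd 1 (\<lambda>y. (f \<circ> X) (\<gamma> y)) (ofC z)"
        "frechet_derivative (f \<circ> G) (at z) \<i> = pd 2 (\<lambda>y. (f \<circ> X) (\<gamma> y)) (ofC z)"
        by (simp_all add: G_def o_def)
      moreover have "ofC z \<in> V" using z by (simp add: UC_def)
      ultimately show "0 < lor (frechet_derivative (f \<circ> G) (at z) 1) (frechet_derivative (f \<circ> G) (at z) 1) \<and>
      lor (frechet_derivative (f \<circ> G) (at z) 1) (frechet_derivative (f \<circ> G) (at z) 1) =
        lor (frechet_derivative (f \<circ> G) (at z) \<i>) (frechet_derivative (f \<circ> G) (at z) \<i>) \<and>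
      lor (frechet_derivative (f \<circ> G) (at z) 1) (frechet_derivative (f \<circ> G) (at z) \<i>) = 0"
        using conf by simp
    qed
  qed
  then show thesis by (intro that[OF U V hom sw]) (simp add: UC_def G_def[abs_def])
qed

text \<open>Both directions apply \<open>quadratic_coeff_differentiable_iff\<close> pointwise. The
  passage from holomorphy needs a conformal parametrization through each point; the converse starts
  from a given one and picks a chart around the image point.\<close>

lemma holomorphic_iff_stationary:
  "quadratic_form_holomorphic M A f (gauss_map f \<eta>) \<longleftrightarrow> stationary"
proof
  assume h: "quadratic_form_holomorphic M A f (gauss_map f \<eta>)"
  show stationary
    unfolding stationary_def
  proof safe
    fix D X x0 l assume c: "(D, X) \<in> A" and x0: "x0 \<in> D"
    interpret p: surface_patch D "f \<circ> X" "\<eta> \<circ> X" by (rule chart_patch[OF c])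
    obtain U V and \<gamma> :: "real^2 \<Rightarrow> real^2" and w where U: "open U" "x0 \<in> U" "U \<subseteq> D" and V: "open V"
      and hom: "homeomorphism U V w \<gamma>" and sw: "smooth_on U w"
      and conf: "conformal_parametrization M A f (ofC -` V) (\<lambda>z. X (\<gamma> (ofC z)))"
      by (rule isothermal_parametrization[OF c x0]) (rule that; assumption)
    let ?G = "\<lambda>z. X (\<gamma> (ofC z))" and ?y = "w x0"
    have wV: "w x \<in> V" "\<gamma> (w x) = x" if "x \<in> U" for x using hom that by (auto simp: homeomorphism_def)
    have inv: "inv_into D X (?G (toC v)) = \<gamma> v" if "v \<in> V" for v
    proof -
      have "\<gamma> v \<in> D" using hom U(3) that by (auto simp: homeomorphism_def)
      then show ?thesis using chart_inj[OF c] by simp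
    qed
    have yU: "toC ?y \<in> ofC -` V" using wV(1)[OF U(2)] by simp
    have "quadratic_coeff f (gauss_map f \<eta>) ?G holomorphic_on ofC -` V"
      using h conf unfolding quadratic_form_holomorphic_def by blast
    then have "quadratic_coeff f (gauss_map f \<eta>) ?G field_differentiable (at (toC ?y))"
      using yU at_within_open[OF yU open_ofC_vimage[OF V]] unfolding holomorphic_on_def by metis
    moreover have "?G (toC ?y) \<in> X ` D" using wV(2)[OF U(2)] x0 by simp
    ultimately have "\<forall>a. pd a (\<lambda>v. H X (inv_into D X (?G (toC v)))) ?y = 0"
      using quadratic_coeff_differentiable_iff[OF conf c yU] by blast
    moreover have "pd a (\<lambda>v. H X (inv_into D X (?G (toC v)))) ?y = pd a (\<lambda>v. H X (\<gamma> v)) ?y" for a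
      by (rule pd_cong[OF V wV(1)[OF U(2)]]) (simp only: inv)
    ultimately have z: "pd a (\<lambda>v. H X (\<gamma> v)) ?y = 0" for a by simp
    have W': "(\<lambda>v. H X (\<gamma> v)) differentiable (at ?y)"
    proof -
      have "smooth_on V (\<lambda>v. H X (inv_into D X (?G (toC v))))"
      proof -
        let ?S = "{z \<in> ofC -` V. ?G z \<in> X ` D}"
        have S: "?S = ofC -` V" using hom U(3) by (auto simp: homeomorphism_def)
        have o: "open (ofC -` V)" by (rule open_ofC_vimage[OF V])
        have "smooth_on (ofC -` V) (\<lambda>z. inv_into D X (?G z))" using conformalD(4)[OF conf c] unfolding S .
        then have "smooth_on V (\<lambda>v. inv_into D X (?G (toC v)))"
          by (rule smooth_on_compose[OF V o _ _ smooth_on_bounded_linear[OF V bounded_linear_toC], rotated]) auto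
        then show ?thesis
          by (rule smooth_on_compose[OF V p.open_D _ p.smooth_H, rotated])
             (use inv hom U(3) in \<open>auto simp: homeomorphism_def\<close>)
      qed
      then have "smooth_on V (\<lambda>v. H X (\<gamma> v))" by (rule smooth_on_cong[OF V, rotated]) (simp only: inv)
      then show ?thesis by (rule smooth_on_differentiable[OF _ wV(1)[OF U(2)]])
    qed
    \<comment> \<open>Undoing the coordinate change: by the chain rule the derivatives in the
      original chart are combinations of those in the isothermal coordinates, all of which
      vanish.\<close>
    have "pd l (H X) x0 = pd l (\<lambda>x. H X (\<gamma> (w x))) x0"
      by (rule pd_cong[OF U(1,2)]) (simp add: wV(2))
    also have "\<dots> = (\<Sum>a\<in>UNIV. pd l w x0 $ a *\<^sub>R pd a (\<lambda>v. H X (\<gamma> v)) ?y)"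
      by (rule pd_compose[OF smooth_on_differentiable[OF sw U(2)] W'])
    finally show "pd l (H X) x0 = 0" by (simp add: z)
  qed
next
  assume st: stationary
  show "quadratic_form_holomorphic M A f (gauss_map f \<eta>)"
    unfolding quadratic_form_holomorphic_def
  proof (intro allI impI)
    fix U G assume G: "conformal_parametrization M A f U G"
    note C = conformalD[OF G]
    show "quadratic_coeff f (gauss_map f \<eta>) G holomorphic_on U"
      unfolding holomorphic_on_def
    proof
      fix z assume z: "z \<in> U"
      have "G z \<in> topspace M" using C(2) z unfolding continuous_map_def by auto
      then obtain D X where c: "(D, X) \<in> A" and GX: "G z \<in> X ` D" using charts_cover by blast
      interpret p: surface_patch D "f \<circ> X" "\<eta> \<circ> X" by (rule chart_patch[OF c])
      let ?\<theta> = "\<lambda>v. inv_into D X (G (toC v))" and ?S = "{z \<in> U. G z \<in> X ` D}"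
      have S: "open ?S"
        using openin_continuous_map_preimage[OF C(2) chartD(2)[OF c]] C(1) by (simp add: openin_open_eq)
      have zS: "ofC z \<in> toC -` ?S" using z GX by simp
      have "smooth_on (toC -` ?S) ?\<theta>"
        by (rule smooth_on_compose[OF open_toC_vimage[OF S] S _ C(4)[OF c] smooth_on_bounded_linear[OF open_toC_vimage[OF S] bounded_linear_toC]])
           auto
      note d\<theta> = smooth_on_differentiable[OF this zS]
      have \<theta>D: "?\<theta> (ofC z) \<in> D" using GX by (simp add: inv_into_into)
      have "pd l (\<lambda>v. H X (?\<theta> v)) (ofC z) = 0" for l
        unfolding pd_compose[OF d\<theta> smooth_on_differentiable[OF p.smooth_H \<theta>D]]
        using stationaryD[OF st c \<theta>D] by simp
      then have "quadratic_coeff f (gauss_map f \<eta>) G field_differentiable (at (toC (ofC z)))"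
        using quadratic_coeff_differentiable_iff[OF G c, of "ofC z"] z GX by simp
      then show "quadratic_coeff f (gauss_map f \<eta>) G field_differentiable (at z within U)"
        by (simp add: field_differentiable_at_within)
    qed
  qed
qed

end

theorem theorem3:
  fixes M :: "'m topology"
    and A :: "((real^2) set \<times> (real^2 \<Rightarrow> 'm)) set"
    and f :: "'m \<Rightarrow> real^4"
    and \<eta> :: "'m \<Rightarrow> real^4"
  assumes "surface M A"
    and "immersed_in_hyp3 M A f"
    and "unit_normal_field M A f \<eta>"
  shows "(constant_mean_curvature A f \<eta> \<longleftrightarrow> harmonic_into_S5 M A f (gauss_map f \<eta>)) \<and>
    (harmonic_into_S5 M A f (gauss_map f \<eta>) \<longleftrightarrow>
       quadratic_form_holomorphic M A f (gauss_map f \<eta>))"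
proof -
  interpret immersed_surface M A f \<eta> by unfold_locales (rule assms)+
  show ?thesis
    unfolding harmonic_iff_stationary constant_mean_curvature_iff_stationary holomorphic_iff_stationary by simp
qed

end
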